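(* Let $\mu, \nu \in \mathcal{P}(\mathbb{C})$, and assume $\mu$ is not supported on a circle. For each $n \geq 1$, define the degree $n$ polynomials \[ p_n(z) := \prod_{i=1}^n (z - X_i), \qquad q_n(z) := \prod_{i=1}^n (z - Y_i), \] where $X_1, Y_1, X_2, Y_2, \ldots$ are independent random variables so that $X_i$ has distribution $\mu$ and $Y_i$ has distribution $\nu$ for each $i \geq 1$. Then there exists a (deterministic) probability measure $\rho$ on $\mathbb{C}$ so that, for any smooth and compactly supported function $\varphi: \mathbb{C} \to \mathbb{C}$, \[ \frac{1}{n} \sum_{i=1}^n \varphi(z_i^{(n)}) \longrightarrow \int_{\mathbb{C}} \varphi \, d\rho \] in probability as $n \to \infty$, where $z_1^{(n)}, \ldots, z_n^{(n)}$ are the zeros (counted with multiplicity) of the sum $p_n + q_n$. Here, $\rho$ depends only on $\mu$ and $\nu$ and is uniquely defined by the condition that \[ \int_{\mathbb{C}} \varphi \, d\rho = \frac{1}{2\pi} \int_{\mathbb{C}} \Delta\varphi(z) \, \max\{U_\mu(z), U_\nu(z)\} \, d\lambda(z) \quad \text{for all } \varphi \in C_c^\infty(\mathbb{C}). \]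
   Context: $\mathcal{P}(\mathbb{C})$ is the set of probability measures on $\mathbb{C}$ with compact support. $\lambda$ is Lebesgue measure on $\mathbb{C}$. $C_c^\infty(\mathbb{C})$ is the set of all smooth functions $\varphi:\mathbb{C}\to\mathbb{C}$ with compact support (smooth as functions of two real variables; $\Delta$ is the usual Laplacian on $\mathbb{C}\cong\mathbb{R}^2$). The logarithmic potential of $\mu\in\mathcal{P}(\mathbb{C})$ is $U_\mu:\mathbb{C}\to[-\infty,+\infty)$, $U_\mu(z) := \int_{\mathbb{C}} \log|z-w|\,d\mu(w)$. A measure $\mu\in\mathcal{P}(\mathbb{C})$ is supported on a circle if there exist $r\ge 0$ and $z\in\mathbb{C}$ such that $\operatorname{supp}(\mu)\subset\{w\in\mathbb{C}:|w-z|=r\}$ (so $r=0$, a point mass, is included); otherwise $\mu$ is not supported on a circle. *)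

theory Defs
  imports "HOL-Probability.Probability" "HOL-Computational_Algebra.Polynomial"
begin

text \<open>Smooth functions \<open>\<complex> \<rightarrow> \<complex>\<close>, with \<open>\<complex>\<close> as domain regarded as a real vector space:
  \<open>Ck k f\<close> says that \<open>f\<close> is \<open>k\<close> times continuously differentiable in the real sense.\<close>

definition dir_deriv :: "complex \<Rightarrow> (complex \<Rightarrow> complex) \<Rightarrow> complex \<Rightarrow> complex" where
  "dir_deriv v f z = frechet_derivative f (at z) v"

fun Ck :: "nat \<Rightarrow> (complex \<Rightarrow> complex) \<Rightarrow> bool" where
  "Ck 0 f \<longleftrightarrow> continuous_on UNIV f"
| "Ck (Suc k) f \<longleftrightarrow> (\<forall>z. f differentiable (at z)) \<and> Ck k (dir_deriv 1 f) \<and> Ck k (dir_deriv \<i> f)"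

definition Cc_infinity :: "(complex \<Rightarrow> complex) set" where
  "Cc_infinity = {\<phi>. (\<forall>k. Ck k \<phi>) \<and> compact (closure {z. \<phi> z \<noteq> 0})}"

definition laplacian :: "(complex \<Rightarrow> complex) \<Rightarrow> complex \<Rightarrow> complex" where
  "laplacian f z = dir_deriv 1 (dir_deriv 1 f) z + dir_deriv \<i> (dir_deriv \<i> f) z"

definition msupport :: "complex measure \<Rightarrow> complex set" where
  "msupport \<mu> = {z. \<forall>U. open U \<longrightarrow> z \<in> U \<longrightarrow> emeasure \<mu> U > 0}"

definition borel_prob_measures :: "complex measure set" where
  "borel_prob_measures = {\<mu>. prob_space \<mu> \<and> sets \<mu> = sets borel}"

definition compact_prob_measures :: "complex measure set" where
  "compact_prob_measures = {\<mu> \<in> borel_prob_measures. compact (msupport \<mu>)}"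

definition supported_on_circle :: "complex measure \<Rightarrow> bool" where
  "supported_on_circle \<mu> \<longleftrightarrow> (\<exists>r\<ge>0. \<exists>z. msupport \<mu> \<subseteq> {w. cmod (w - z) = r})"

text \<open>The library sets \<open>ln 0 = 0\<close>; the logarithmic potential needs \<open>log 0 = -\<infinity>\<close>.\<close>

definition elog :: "real \<Rightarrow> ereal" where
  "elog x = (if x = 0 then -\<infinity> else ereal (ln x))"

text \<open>Integral of the positive part minus integral of the negative part (\<open>e2ennreal\<close> sends
  negative values to \<open>0\<close>). For a compactly supported measure the first integral is finite.\<close>

definition log_potential :: "complex measure \<Rightarrow> complex \<Rightarrow> ereal" where
  "log_potential \<mu> z =
     enn2ereal (\<integral>\<^sup>+ w. e2ennreal (elog (cmod (z - w))) \<partial>\<mu>) -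
     enn2ereal (\<integral>\<^sup>+ w. e2ennreal (- elog (cmod (z - w))) \<partial>\<mu>)"

text \<open>Logarithmic potentials are finite Lebesgue-almost everywhere, so the value \<open>0\<close> that
  \<open>real_of_ereal\<close> takes at \<open>-\<infinity>\<close> does not affect the integral. Integrability is
  required explicitly because the Bochner integral is \<open>0\<close> on non-integrable functions.\<close>

definition laplace_max_condition ::
    "complex measure \<Rightarrow> complex measure \<Rightarrow> complex measure \<Rightarrow> bool" where
  "laplace_max_condition \<mu> \<nu> \<rho> \<longleftrightarrow>
     (\<forall>\<phi>\<in>Cc_infinity.
        (let g = (\<lambda>z. laplacian \<phi> z *
               complex_of_real (real_of_ereal (max (log_potential \<mu> z) (log_potential \<nu> z))))
         in integrable lborel g \<and>
            (\<integral>z. \<phi> z \<partial>\<rho>) = 1 / (2 * of_real pi) * (\<integral>z. g z \<partial>lborel)))"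

definition converges_in_prob ::
    "'a measure \<Rightarrow> (nat \<Rightarrow> 'a \<Rightarrow> complex) \<Rightarrow> complex \<Rightarrow> bool" where
  "converges_in_prob M Z c \<longleftrightarrow>
     (\<forall>n. Z n \<in> borel_measurable M) \<and>
     (\<forall>\<epsilon>>0. (\<lambda>n. measure M {\<omega> \<in> space M. cmod (Z n \<omega> - c) > \<epsilon>}) \<longlonglongrightarrow> 0)"

definition root_poly :: "(nat \<Rightarrow> complex) \<Rightarrow> nat \<Rightarrow> complex poly" where
  "root_poly x n = (\<Prod>i=1..n. [:- x i, 1:])"

end

theory Submission
  imports Defs "HOL-Computational_Algebra.Fundamental_Theorem_Algebra"
begin

text \<open>Write \<open>u = max U\<^sub>\<mu> U\<^sub>\<nu>\<close>. Since \<open>\<Delta> ln |z| = 2 \<pi> \<delta>\<^sub>0\<close>, the average of \<open>\<phi>\<close> over the zeros of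
  \<open>p\<^sub>n + q\<^sub>n\<close> is \<open>1/(2\<pi>) \<integral> \<Delta>\<phi> F\<^sub>n\<close> with \<open>F\<^sub>n = 1/n ln |p\<^sub>n + q\<^sub>n|\<close>, so it suffices that \<open>F\<^sub>n \<rightarrow> u\<close> in
  \<open>L\<^sup>1\<close> of every ball, in expectation. At almost every \<open>z\<close> the law of large numbers gives the limits
  \<open>U\<^sub>\<mu>\<close> and \<open>U\<^sub>\<nu>\<close> of \<open>1/n ln |p\<^sub>n|\<close> and \<open>1/n ln |q\<^sub>n|\<close>. The two polynomials cannot cancel:
  \<open>ln |p\<^sub>n / q\<^sub>n|\<close> is a sum of i.i.d. variables, not almost surely constant because \<open>\<mu>\<close> is not
  supported on a circle centred at \<open>z\<close>, so by the central limit theorem it leaves \<open>[-1, 1]\<close> with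
      probability
  tending to one. Pointwise convergence in probability improves to \<open>L\<^sup>1\<close> because the second
  moments of \<open>F\<^sub>n\<close> on a ball are bounded by those of \<open>ln |z|\<close>, uniformly in the position of the
      zeros.

  The limit \<open>\<rho>\<close> is a vague limit of zero distributions along one sequence of polynomials. Its
      existence
  is reduced to Helly's theorem on the line: transport the measures by a Borel right inverse of
  Schoenberg's space-filling curve, and pull the weak limit back along the continuous curve. No
      mass escapes
  to infinity, because \<open>u - U\<^sub>\<mu>\<close> vanishes there.\<close>

section \<open>Smooth functions on the complex plane\<close>

text \<open>The delicate points are those with U_mu(z) = U_nu(z), possibly a set of positive area
  (all of the plane if mu = nu). Where the potentials differ, the law of large numbers alone makes
  one polynomial exponentially dominant; where they agree, only the fluctuations of order sqrt n of
  ln |p_n / q_n| separate the two. A gap above 1 between the logarithms is enough, since the smaller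
  summand then changes the logarithm of the larger by a bounded amount, which the factor 1/n
  removes.

  Second rather than first moments are bounded because they give the uniform integrability that
  turns pointwise into L^1 convergence: the singularity of (ln |z|)^2 is integrable over the plane,
  with an integral invariant under translation.

  Actual zero distributions are used to obtain rho because they are positive by construction,
  whereas positivity is not visible in 1/(2 pi) times the integral of Delta phi against max(U_mu,
  U_nu). This formula involves mu and nu only, so a measure found with one sample space serves all
  of them.\<close>

lemma dir_deriv_eq:
  assumes "(f has_derivative f') (at z)"
  shows "dir_deriv v f z = f' v"
  using frechet_derivative_at[OF assms] by (simp add: dir_deriv_def)

lemma differentiable_has_dir_deriv:
  assumes "f differentiable (at z)"
  shows "(f has_derivative (\<lambda>v. dir_deriv v f z)) (at z)"
  using assms by (simp add: dir_deriv_def frechet_derivative_works eta_contract_eq)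

lemma Ck_imp_continuous: "Ck k f \<Longrightarrow> continuous_on UNIV f"
proof (cases k)
  case (Suc m)
  assume "Ck k f"
  then have "f differentiable (at z)" for z using Suc by simp
  then show ?thesis
    by (simp add: continuous_on_eq_continuous_at differentiable_imp_continuous_within)
qed simp

lemma Ck_SucD: "Ck (Suc k) f \<Longrightarrow> Ck k f"
proof (induction k arbitrary: f)
  case 0
  then show ?case using Ck_imp_continuous[of "Suc 0" f] by simp
next
  case (Suc k)
  from Suc.prems have "\<And>z. f differentiable (at z)"
    and "Ck (Suc k) (dir_deriv 1 f)" "Ck (Suc k) (dir_deriv \<i> f)"
    using Ck.simps(2)[of "Suc k" f] by blast+
  then have "Ck k (dir_deriv 1 f)" "Ck k (dir_deriv \<i> f)"
    by (blast intro: Suc.IH)+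
  with \<open>\<And>z. f differentiable (at z)\<close> show ?case by simp
qed

lemma Ck_add: "Ck k f \<Longrightarrow> Ck k g \<Longrightarrow> Ck k (\<lambda>z. f z + g z)"
proof (induction k arbitrary: f g)
  case 0
  then show ?case by (auto intro: continuous_intros)
next
  case (Suc k)
  have "dir_deriv v (\<lambda>z. f z + g z) = (\<lambda>z. dir_deriv v f z + dir_deriv v g z)" for v
    using Suc.prems
    by (auto intro!: ext dir_deriv_eq derivative_eq_intros differentiable_has_dir_deriv)
  moreover have "Ck k (\<lambda>z. dir_deriv v f z + dir_deriv v g z)" if "v = 1 \<or> v = \<i>" for v
    using that Suc.prems by (intro Suc.IH) auto
  moreover have "(\<lambda>z. f z + g z) differentiable at z" for z
    using Suc.prems by (intro differentiable_add) simp_all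
  ultimately show ?case by simp
qed

lemma Ck_mult: "Ck k f \<Longrightarrow> Ck k g \<Longrightarrow> Ck k (\<lambda>z. f z * g z)"
proof (induction k arbitrary: f g)
  case 0
  then show ?case by (auto intro: continuous_intros)
next
  case (Suc k)
  have "dir_deriv v (\<lambda>z. f z * g z) = (\<lambda>z. f z * dir_deriv v g z + dir_deriv v f z * g z)" for v
    using Suc.prems
    by (auto intro!: ext dir_deriv_eq derivative_eq_intros differentiable_has_dir_deriv)
  moreover have "Ck k (\<lambda>z. f z * dir_deriv v g z + dir_deriv v f z * g z)" if "v = 1 \<or> v = \<i>" for v
    using that Suc.prems Ck_SucD[OF Suc.prems(1)] Ck_SucD[OF Suc.prems(2)]
    by (intro Ck_add Suc.IH) auto
  moreover have "(\<lambda>z. f z * g z) differentiable at z" for z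
    using Suc.prems by (intro differentiable_mult) simp_all
  ultimately show ?case by simp
qed

lemma Ck_const: "Ck k (\<lambda>z. c)"
proof (induction k arbitrary: c)
  case (Suc k)
  have "dir_deriv v (\<lambda>z. c) = (\<lambda>z. 0)" for v
    by (auto intro!: ext dir_deriv_eq)
  then show ?case using Suc.IH[of 0] by simp
qed simp

lemma Ck_bounded_linear_compose: "bounded_linear L \<Longrightarrow> Ck k f \<Longrightarrow> Ck k (\<lambda>z. L (f z))"
proof (induction k arbitrary: f)
  case 0
  then show ?case
    by (auto intro: bounded_linear.continuous_on)
next
  case (Suc k)
  have "dir_deriv v (\<lambda>z. L (f z)) = (\<lambda>z. L (dir_deriv v f z))" for v
    using Suc.prems
    by (auto intro!: ext dir_deriv_eq bounded_linear.has_derivative[where f=L]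
        differentiable_has_dir_deriv)
  moreover have "(\<lambda>z. L (f z)) differentiable at z" for z
    using bounded_linear.has_derivative[OF Suc.prems(1) differentiable_has_dir_deriv[of f z]]
        Suc.prems(2)
    by (auto simp: differentiable_def)
  moreover have "Ck k (\<lambda>z. L (dir_deriv v f z))" if "v = 1 \<or> v = \<i>" for v
    using that Suc.prems by (intro Suc.IH) auto
  ultimately show ?case by simp
qed

lemma Ck_id: "Ck k (\<lambda>z. z)"
proof (cases k)
  case (Suc k)
  have "dir_deriv v (\<lambda>z. z) = (\<lambda>z. v)" for v
    by (auto intro!: ext dir_deriv_eq derivative_eq_intros)
  with Suc show ?thesis by (auto simp: Ck_const)
qed (auto intro: continuous_intros)

lemma Ck_exp: "Ck k f \<Longrightarrow> Ck k (\<lambda>z. exp (f z))"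
proof (induction k arbitrary: f)
  case 0
  then show ?case by (auto intro: continuous_intros)
next
  case (Suc k)
  have d: "((\<lambda>z. exp (f z)) has_derivative (\<lambda>v. exp (f z) * dir_deriv v f z)) (at z)" for z
    using has_derivative_compose[OF differentiable_has_dir_deriv[of f z], of exp "\<lambda>v. exp (f z) *
        v"]
      DERIV_exp[of "f z"] Suc.prems by (auto simp: has_field_derivative_def)
  then have "dir_deriv v (\<lambda>z. exp (f z)) = (\<lambda>z. exp (f z) * dir_deriv v f z)" for v
    by (auto intro!: ext dir_deriv_eq)
  moreover have "Ck k (\<lambda>z. exp (f z) * dir_deriv v f z)" if "v = 1 \<or> v = \<i>" for v
    using that Suc.prems by (intro Ck_mult Suc.IH Ck_SucD[OF Suc.prems]) auto
  moreover have "(\<lambda>z. exp (f z)) differentiable at z" for z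
    using d by (auto simp: differentiable_def)
  ultimately show ?case by simp
qed

lemma dir_deriv_scale:
  assumes "f differentiable (at (c *\<^sub>R z))"
  shows "dir_deriv v (\<lambda>z. f (c *\<^sub>R z)) z = c *\<^sub>R dir_deriv v f (c *\<^sub>R z)"
    and "(\<lambda>z. f (c *\<^sub>R z)) differentiable (at z)"
proof -
  have "((\<lambda>z. c *\<^sub>R z) has_derivative (\<lambda>v. c *\<^sub>R v)) (at z)"
    by (auto intro!: derivative_eq_intros)
  from has_derivative_compose[OF this differentiable_has_dir_deriv[OF assms]]
  have "((\<lambda>z. f (c *\<^sub>R z)) has_derivative (\<lambda>v. dir_deriv (c *\<^sub>R v) f (c *\<^sub>R z))) (at z)" .
  then show "dir_deriv v (\<lambda>z. f (c *\<^sub>R z)) z = c *\<^sub>R dir_deriv v f (c *\<^sub>R z)"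
    and "(\<lambda>z. f (c *\<^sub>R z)) differentiable (at z)"
    using linear_scale[OF has_derivative_linear[OF differentiable_has_dir_deriv[OF assms]]]
    by (auto simp: dir_deriv_eq differentiable_def)
qed

lemma Ck_scale: "Ck k f \<Longrightarrow> Ck k (\<lambda>z. f (c *\<^sub>R z))"
proof (induction k arbitrary: f)
  case 0
  then show ?case
    by (auto intro!: continuous_on_compose2[of UNIV f] continuous_intros)
next
  case (Suc k)
  have "dir_deriv v (\<lambda>z. f (c *\<^sub>R z)) = (\<lambda>z. c *\<^sub>R dir_deriv v f (c *\<^sub>R z))" for v
    using Suc.prems by (auto intro!: ext dir_deriv_scale)
  moreover have "Ck k (\<lambda>z. c *\<^sub>R dir_deriv v f (c *\<^sub>R z))" if "v = 1 \<or> v = \<i>" for v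
    using that Suc.prems
    by (intro Ck_bounded_linear_compose[where L="\<lambda>z. c *\<^sub>R z"] bounded_linear_scaleR_right Suc.IH)
        auto
  moreover have "(\<lambda>z. f (c *\<^sub>R z)) differentiable at z" for z
    using Suc.prems by (intro dir_deriv_scale) simp
  ultimately show ?case by simp
qed

section \<open>Functions flat at the origin\<close>

text \<open>The parameter \<open>m\<close> closes the family under differentiation (see
  \<open>DERIV_flat_exp\<close>), so that smoothness of the classical exp(-1/x) becomes a single
  induction.\<close>

definition flat_exp :: "nat \<Rightarrow> real \<Rightarrow> real" where
  "flat_exp m x = (if x > 0 then exp (- (1 / x)) / x ^ m else 0)"

lemma flat_exp_nonneg: "flat_exp m x \<ge> 0"
  by (simp add: flat_exp_def)

lemma flat_exp_pos_iff: "flat_exp m x > 0 \<longleftrightarrow> x > 0"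
  by (simp add: flat_exp_def)

lemma flat_exp_tendsto_0: "((\<lambda>x. flat_exp m x) \<longlongrightarrow> 0) (at_right 0)"
proof -
  have "((\<lambda>x. inverse x ^ m / exp (inverse x)) \<longlongrightarrow> (0::real)) (at_right 0)"
    by (rule filterlim_compose[OF tendsto_power_div_exp_0 filterlim_inverse_at_top_right])
  moreover have "\<forall>\<^sub>F x in at_right (0::real). inverse x ^ m / exp (inverse x) = flat_exp m x"
    using eventually_at_right_less[of "0::real"]
    by eventually_elim (simp add: flat_exp_def exp_minus field_simps)
  ultimately show ?thesis
    by (rule Lim_transform_eventually)
qed

lemma DERIV_flat_exp:
  "(flat_exp m has_real_derivative flat_exp (m + 2) x - m * flat_exp (m + 1) x) (at x)"
proof -
  consider "x > 0" | "x < 0" | "x = 0" by linarith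
  then show ?thesis
  proof cases
    case 1
    have "((\<lambda>x. exp (- (1 / x)) / x ^ m) has_real_derivative
        flat_exp (m + 2) x - m * flat_exp (m + 1) x) (at x)"
    \<comment> \<open>Writing a positive \<open>m\<close> as \<open>Suc n\<close> avoids the
      truncated exponent m - 1 in the derivative of x^m.\<close>
    proof (cases m)
      case 0
      then show ?thesis using 1
        by (auto intro!: derivative_eq_intros simp: flat_exp_def field_simps power2_eq_square)
    next
      case (Suc n)
      have *: "((\<lambda>x. x ^ Suc n) has_real_derivative (Suc n * x ^ n)) (at x)"
        using DERIV_pow[of "Suc n" x] by simp
      have "((\<lambda>x. exp (- (1 / x)) / x ^ Suc n) has_real_derivative
        (exp (- (1 / x)) * (1 / (x * x)) * x ^ Suc n - exp (- (1 / x)) * (Suc n * x ^ n)) / (x ^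
            Suc n * x ^ Suc n)) (at x)"
        using 1 by (auto intro!: derivative_eq_intros * simp del: power_Suc)
      also have "(exp (- (1 / x)) * (1 / (x * x)) * x ^ Suc n - exp (- (1 / x)) * (Suc n * x ^ n))
          / (x ^ Suc n * x ^ Suc n)
         = flat_exp (m + 2) x - m * flat_exp (m + 1) x"
        using 1 by (simp add: flat_exp_def Suc field_simps)
      finally show ?thesis by (simp add: Suc)
    qed
    then show ?thesis
      by (rule has_field_derivative_transform_within_open[of _ _ _ "{0<..}"])
        (use 1 in \<open>auto simp: flat_exp_def\<close>)
  next
    case 2
    have "((\<lambda>x. 0) has_real_derivative flat_exp (m + 2) x - m * flat_exp (m + 1) x) (at x)"
      using 2 by (simp add: flat_exp_def)
    then show ?thesis
      by (rule has_field_derivative_transform_within_open[of _ _ _ "{..<0}"])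
        (use 2 in \<open>auto simp: flat_exp_def\<close>)
  next
    case 3
    \<comment> \<open>From the right the difference quotient at 0 is
      \<open>flat_exp (Suc m)\<close>, which tends to 0; from the left it vanishes.\<close>
    have "((\<lambda>h. flat_exp m h / h) \<longlongrightarrow> 0) (at_right 0)"
    proof -
      have "\<forall>\<^sub>F x in at_right (0::real). flat_exp (Suc m) x = flat_exp m x / x"
        by (intro always_eventually allI) (simp add: flat_exp_def field_simps)
      with flat_exp_tendsto_0[of "Suc m"] show ?thesis
        by (rule Lim_transform_eventually)
    qed
    moreover have "((\<lambda>h. flat_exp m h / h) \<longlongrightarrow> 0) (at_left 0)"
    proof -
      have "\<forall>\<^sub>F x in at_left (0::real). 0 = flat_exp m x / x"
        unfolding eventually_at_filter
        by (intro always_eventually allI) (auto simp: flat_exp_def)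
      with tendsto_const[of 0] show ?thesis
        by (rule Lim_transform_eventually)
    qed
    ultimately have "((\<lambda>h. flat_exp m h / h) \<longlongrightarrow> 0) (at 0)"
      by (simp add: filterlim_split_at)
    then show ?thesis
      using 3 by (simp add: DERIV_def flat_exp_def)
  qed
qed

text \<open>The induction generalises over \<open>m\<close> because each derivative raises the index
  by one or two.\<close>

lemma Ck_flat_exp: "Ck k f \<Longrightarrow> Ck k (\<lambda>z. complex_of_real (flat_exp m (Re (f z))))"
proof (induction k arbitrary: m f)
  case 0
  have "continuous_on UNIV (flat_exp m)"
    by (auto simp: continuous_on_eq_continuous_at intro: DERIV_isCont[OF DERIV_flat_exp])
  then show ?case
    using 0 by (auto intro!: continuous_intros continuous_on_compose2[of UNIV "flat_exp m"])
next
  case (Suc k)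
  let ?d = "\<lambda>z. flat_exp (m + 2) (Re (f z)) - m * flat_exp (m + 1) (Re (f z))"
  let ?g = "\<lambda>v z. (complex_of_real (flat_exp (m + 2) (Re (f z))) +
      (- of_nat m) * complex_of_real (flat_exp (m + 1) (Re (f z)))) * complex_of_real (Re
          (dir_deriv v f z))"
  have d: "((\<lambda>z. complex_of_real (flat_exp m (Re (f z)))) has_derivative
      (\<lambda>v. of_real (?d z * Re (dir_deriv v f z)))) (at z)" for z
  proof -
    have "((\<lambda>z. Re (f z)) has_derivative (\<lambda>v. Re (dir_deriv v f z))) (at z)"
      using Suc.prems by (auto intro!: derivative_eq_intros differentiable_has_dir_deriv)
    then have "((\<lambda>z. flat_exp m (Re (f z))) has_derivative (\<lambda>v. ?d z * Re (dir_deriv v f z))) (at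
        z)"
      by (rule has_derivative_compose)
        (use DERIV_flat_exp[of m "Re (f z)"] in \<open>simp add: has_field_derivative_def\<close>)
    then show ?thesis
      by (rule has_derivative_of_real)
  qed
  then have "dir_deriv v (\<lambda>z. complex_of_real (flat_exp m (Re (f z)))) = ?g v" for v
    by (intro ext, subst dir_deriv_eq[OF d]) (simp add: algebra_simps)
  moreover have "Ck k (?g v)" if "v = 1 \<or> v = \<i>" for v
  proof -
    have "Ck k (dir_deriv v f)" using Suc.prems that by auto
    then show ?thesis
      using Suc.IH[OF Ck_SucD[OF Suc.prems]]
      by (intro Ck_mult Ck_add Ck_const Ck_bounded_linear_compose[where L="\<lambda>z. complex_of_real (Re
          z)"])
        (auto intro!: bounded_linear_compose[OF bounded_linear_of_real] bounded_linear_Re)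
  qed
  moreover have "(\<lambda>z. complex_of_real (flat_exp m (Re (f z)))) differentiable at z" for z
    using d by (auto simp: differentiable_def)
  ultimately show ?case by simp
qed

section \<open>Test functions with compact support\<close>

lemma Cc_infinityI:
  assumes "\<And>k. Ck k f" and "\<And>z. cmod z > R \<Longrightarrow> f z = 0"
  shows "f \<in> Cc_infinity"
proof -
  have "{z. f z \<noteq> 0} \<subseteq> cball 0 R"
    using assms(2) by (force simp: not_less[symmetric])
  then have "bounded {z. f z \<noteq> 0}"
    using bounded_subset bounded_cball by blast
  then show ?thesis
    using assms(1) by (auto simp: Cc_infinity_def)
qed

lemma Cc_infinity_bounded_support:
  assumes "f \<in> Cc_infinity"
  obtains R where "R > 0" and "\<And>z. cmod z > R \<Longrightarrow> f z = 0"
proof -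
  have "bounded {z. f z \<noteq> 0}"
    using assms by (auto simp: Cc_infinity_def)
  then obtain R where "R > 0" and R: "\<And>z. z \<in> {z. f z \<noteq> 0} \<Longrightarrow> norm z \<le> R"
    by (meson bounded_pos)
  then show ?thesis
    using that[of R] by force
qed

lemma dir_deriv_eq_0_outside:
  assumes "\<And>z. cmod z > R \<Longrightarrow> f z = 0" and "cmod z > R"
  shows "dir_deriv v f z = 0"
proof -
  have "open {z. cmod z > R}"
    by (intro open_Collect_less continuous_intros)
  then have "(f has_derivative (\<lambda>_. 0)) (at z)"
    using assms by (intro has_derivative_transform_within_open[OF has_derivative_const[of 0]]) auto
  then show ?thesis by (rule dir_deriv_eq)
qed

lemma Cc_infinity_Ck: "f \<in> Cc_infinity \<Longrightarrow> Ck k f"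
  by (simp add: Cc_infinity_def)

lemma Cc_infinity_dir_deriv:
  assumes "f \<in> Cc_infinity" and "v = 1 \<or> v = \<i>"
  shows "dir_deriv v f \<in> Cc_infinity"
proof -
  obtain R where R: "\<And>z. cmod z > R \<Longrightarrow> f z = 0"
    using Cc_infinity_bounded_support[OF assms(1)] by blast
  have "Ck k (dir_deriv v f)" for k
    using Cc_infinity_Ck[OF assms(1), of "Suc k"] assms(2) by auto
  then show ?thesis
    by (rule Cc_infinityI) (rule dir_deriv_eq_0_outside[OF R])
qed

lemma Cc_infinity_add:
  assumes "f \<in> Cc_infinity" "g \<in> Cc_infinity"
  shows "(\<lambda>z. f z + g z) \<in> Cc_infinity"
proof -
  obtain R where R: "\<And>z. cmod z > R \<Longrightarrow> f z = 0"
    using Cc_infinity_bounded_support[OF assms(1)] by blast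
  obtain S where S: "\<And>z. cmod z > S \<Longrightarrow> g z = 0"
    using Cc_infinity_bounded_support[OF assms(2)] by blast
  show ?thesis
    by (rule Cc_infinityI[of _ "max R S"]) (simp_all add: Ck_add Cc_infinity_Ck assms R S)
qed

lemma Cc_infinity_laplacian: "f \<in> Cc_infinity \<Longrightarrow> laplacian f \<in> Cc_infinity"
  unfolding laplacian_def by (intro Cc_infinity_add Cc_infinity_dir_deriv) auto

lemma Cc_infinity_continuous: "f \<in> Cc_infinity \<Longrightarrow> continuous_on UNIV f"
  using Cc_infinity_Ck[of f 0] by simp

lemma Cc_infinity_measurable: "f \<in> Cc_infinity \<Longrightarrow> f \<in> borel_measurable borel"
  by (intro borel_measurable_continuous_onI Cc_infinity_continuous)

lemma continuous_compact_support_bounded: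
  fixes f :: "complex \<Rightarrow> complex"
  assumes "continuous_on UNIV f" and "\<And>z. cmod z > R \<Longrightarrow> f z = 0"
  obtains C where "C > 0" and "\<And>z. cmod (f z) \<le> C * indicator (cball 0 R) z"
proof -
  have "compact (f ` cball 0 R)"
    by (intro compact_continuous_image continuous_on_subset[OF assms(1)]) auto
  then obtain C where "C > 0" "\<And>z. z \<in> cball 0 R \<Longrightarrow> cmod (f z) \<le> C"
    using compact_imp_bounded bounded_pos by (metis imageI)
  then show ?thesis
    using assms(2) by (intro that[of C]) (auto simp: indicator_def)
qed

lemma Cc_infinity_bounded:
  assumes "f \<in> Cc_infinity"
  obtains R C where "R > 0" "C > 0" and "\<And>z. cmod (f z) \<le> C * indicator (cball 0 R) z"
  using Cc_infinity_bounded_support[OF assms]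
    continuous_compact_support_bounded[OF Cc_infinity_continuous[OF assms]] by metis

lemma integrable_indicator_cball:
  "integrable lborel (indicator (cball (a::complex) r) :: complex \<Rightarrow> real)"
  using emeasure_bounded_finite[of "cball a r"] by (simp add: less_top[symmetric])

lemma Cc_infinity_integrable:
  assumes "f \<in> Cc_infinity"
  shows "integrable lborel f"
proof -
  obtain R C where C: "\<And>z. cmod (f z) \<le> C * indicator (cball 0 R) z"
    using Cc_infinity_bounded[OF assms] by blast
  have "f \<in> borel_measurable lborel" using assms by (simp add: Cc_infinity_measurable)
  then show ?thesis
    using C by (intro Bochner_Integration.integrable_bound[OF
      integrable_mult_right[OF integrable_indicator_cball[of 0 R], of C]] AE_I2)
      (auto intro: order_trans[OF C abs_ge_self])
qed

section \<open>Bump functions and uniqueness of measures\<close>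

text \<open>One flat factor for each side of the rectangle with corners a and b; multiplication by
  \<open>- \<i>\<close> turns imaginary parts into real parts. Differences are written with + and
  (-1) so that the closure rules for \<open>Ck\<close> apply verbatim.\<close>

definition box_bump :: "complex \<Rightarrow> complex \<Rightarrow> complex \<Rightarrow> real" where
  "box_bump a b z = flat_exp 0 (Re (z + - a)) * flat_exp 0 (Re (b + (- 1) * z)) *
     (flat_exp 0 (Re ((- \<i>) * (z + - a))) * flat_exp 0 (Re ((- \<i>) * (b + (- 1) * z))))"

lemma Ck_box_bump: "Ck k (\<lambda>z. complex_of_real (box_bump a b z))"
  unfolding box_bump_def of_real_mult
  by (intro Ck_mult Ck_flat_exp Ck_add Ck_const Ck_id)

lemma box_bump_nonneg: "box_bump a b z \<ge> 0"
  by (simp add: box_bump_def flat_exp_nonneg)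

lemma box_bump_pos: "z \<in> box a b \<Longrightarrow> box_bump a b z > 0"
  by (auto simp: box_bump_def flat_exp_pos_iff in_box_complex_iff intro!: mult_pos_pos)

lemma box_bump_eq_0: "z \<notin> box a b \<Longrightarrow> box_bump a b z = 0"
  by (auto simp: box_bump_def flat_exp_def in_box_complex_iff)

lemma box_bounded_complex:
  obtains R where "\<And>z. cmod z > R \<Longrightarrow> z \<notin> box a (b::complex)"
proof -
  obtain R where "\<And>z. z \<in> box a b \<Longrightarrow> cmod z \<le> R"
    using bounded_box[of a b] by (meson bounded_iff)
  then show ?thesis using that[of R] by (meson not_le)
qed

lemma Cc_infinity_box_bump: "(\<lambda>z. complex_of_real (box_bump a b z)) \<in> Cc_infinity"
proof -
  obtain R where "\<And>z. cmod z > R \<Longrightarrow> z \<notin> box a b"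
    using box_bounded_complex[of a b] by blast
  then show ?thesis
    by (intro Cc_infinityI[of _ R] Ck_box_bump) (simp add: box_bump_eq_0)
qed

text \<open>As n grows, these test functions tend pointwise to the indicator of the box: they vanish
  outside it, and inside it the exponential tends to 0.\<close>

lemma Cc_infinity_box_cutoff:
  "(\<lambda>z. 1 + (-1) * exp (- of_nat n * complex_of_real (box_bump a b z))) \<in> Cc_infinity"
proof -
  obtain R where "\<And>z. cmod z > R \<Longrightarrow> z \<notin> box a b"
    using box_bounded_complex[of a b] by blast
  then show ?thesis
    by (intro Cc_infinityI[of _ R] Ck_add Ck_mult Ck_exp Ck_const Ck_box_bump) (simp add:
        box_bump_eq_0)
qed

lemma measure_box_eq_limit:
  assumes "finite_measure \<rho>" "sets \<rho> = sets borel"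
  shows "(\<lambda>n. \<integral>z. 1 + (-1) * exp (- of_nat n * complex_of_real (box_bump a b z)) \<partial>\<rho>)
    \<longlonglongrightarrow> complex_of_real (measure \<rho> (box a b))"
proof -
  interpret finite_measure \<rho> by fact
  note [measurable_cong] = assms(2)
  let ?f = "\<lambda>n z. 1 + (-1) * exp (- of_nat n * complex_of_real (box_bump a b z))"
  have "(\<lambda>n. \<integral>z. ?f n z \<partial>\<rho>) \<longlonglongrightarrow> (\<integral>z. complex_of_real (indicator (box a b) z) \<partial>\<rho>)"
  proof (rule integral_dominated_convergence[where w="\<lambda>_. 2"])
    show "?f n \<in> borel_measurable \<rho>" for n
      using Cc_infinity_measurable[OF Cc_infinity_box_cutoff[of n a b]] assms(2)
      by (simp cong: measurable_cong_sets)
    have "(\<lambda>z. complex_of_real (indicator (box a b) z)) \<in> borel_measurable borel"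
      by measurable
    then show "(\<lambda>z. complex_of_real (indicator (box a b) z)) \<in> borel_measurable \<rho>"
      using assms(2) by (simp cong: measurable_cong_sets)
    show "AE z in \<rho>. (\<lambda>n. ?f n z) \<longlonglongrightarrow> complex_of_real (indicator (box a b) z)"
    proof (intro AE_I2)
      fix z
      show "(\<lambda>n. ?f n z) \<longlonglongrightarrow> complex_of_real (indicator (box a b) z)"
      proof (cases "z \<in> box a b")
        case True
        have "(\<lambda>n. exp (- real n * box_bump a b z)) \<longlonglongrightarrow> 0"
          using box_bump_pos[OF True] by real_asymp
        then have "(\<lambda>n. 1 + (-1) * complex_of_real (exp (- real n * box_bump a b z))) \<longlonglongrightarrow> 1 + (-1) *
            complex_of_real 0"
          by (intro tendsto_intros)
        then show ?thesis using True by (simp add: exp_of_real[symmetric])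
      qed (simp add: box_bump_eq_0)
    qed
    show "AE z in \<rho>. norm (?f n z) \<le> 2" for n
    proof (intro AE_I2)
      fix z
      have "norm (?f n z) \<le> 1 + norm (exp (- of_nat n * complex_of_real (box_bump a b z)))"
        using norm_triangle_ineq[of 1 "(-1) * exp (- of_nat n * complex_of_real (box_bump a b
            z))"] by simp
      also have "\<dots> \<le> 2"
        using box_bump_nonneg[of a b z] by (simp add: norm_exp_eq_Re)
      finally show "norm (?f n z) \<le> 2" .
    qed
  qed auto
  then show ?thesis
    by (subst (asm) integral_complex_of_real) (auto simp: assms(2))
qed

text \<open>Integrals of test functions determine the measure of every open box through
  \<open>measure_box_eq_limit\<close>, and the boxes are an intersection-stable generator of the
  Borel sets.\<close>

lemma prob_measure_eq_if_Cc_integrals_eq: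
  assumes "\<rho> \<in> borel_prob_measures" "\<rho>' \<in> borel_prob_measures"
    and "\<And>\<phi>. \<phi> \<in> Cc_infinity \<Longrightarrow> (\<integral>z. \<phi> z \<partial>\<rho>) = (\<integral>z. \<phi> z \<partial>\<rho>')"
  shows "\<rho> = \<rho>'"
proof -
  interpret P: prob_space \<rho> using assms by (simp add: borel_prob_measures_def)
  interpret Q: prob_space \<rho>' using assms by (simp add: borel_prob_measures_def)
  have sets: "sets \<rho> = sets borel" "sets \<rho>' = sets borel"
    using assms by (simp_all add: borel_prob_measures_def)
  have box: "emeasure \<rho> (box a b) = emeasure \<rho>' (box a b)" for a b
  proof -
    have "complex_of_real (measure \<rho> (box a b)) = complex_of_real (measure \<rho>' (box a b))"
      using measure_box_eq_limit[OF P.finite_measure_axioms sets(1), of a b]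
        measure_box_eq_limit[OF Q.finite_measure_axioms sets(2), of a b]
      unfolding assms(3)[OF Cc_infinity_box_cutoff] by (rule LIMSEQ_unique)
    then show ?thesis
      by (simp add: P.emeasure_eq_measure Q.emeasure_eq_measure)
  qed
  let ?E = "range (\<lambda>(a, b). box a b :: complex set)"
  show ?thesis
  proof (rule measure_eqI_generator_eq[where E="?E" and \<Omega>=UNIV
        and A="\<lambda>n::nat. box (- (real n *\<^sub>R One)) (real n *\<^sub>R One)"])
    show "Int_stable ?E"
      by (auto simp: Int_stable_def box_Int_box)
    show "sets \<rho> = sigma_sets UNIV ?E" "sets \<rho>' = sigma_sets UNIV ?E"
      by (simp_all add: sets borel_eq_box)
    show "range (\<lambda>n. box (- (real n *\<^sub>R One)) (real n *\<^sub>R One)) \<subseteq> ?E" by auto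
    show "(\<Union>n. box (- (real n *\<^sub>R One)) (real n *\<^sub>R One)) = (UNIV :: complex set)"
      by (rule UN_box_eq_UNIV)
  qed (auto simp: box)
qed

section \<open>Integrals of derivatives\<close>

text \<open>Steps of length 1/(n+1) make the difference quotients a sequence, the form in which
  dominated convergence applies.\<close>

lemma dir_deriv_sequence:
  assumes "g differentiable (at z)" "norm v = 1"
  shows "(\<lambda>n. of_nat (Suc n) * (g (z + v / of_nat (Suc n)) - g z)) \<longlonglongrightarrow> dir_deriv v g z"
proof -
  define h where "h n = v / of_nat (Suc n)" for n
  have nh: "norm (h n) = 1 / Suc n" for n
    using assms(2) by (simp add: h_def norm_divide del: of_nat_Suc)
  have lim: "(\<lambda>h. norm (g (z + h) - g z - dir_deriv h g z) / norm h) \<midarrow>0\<rightarrow> 0"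
    using differentiable_has_dir_deriv[OF assms(1)] by (simp add: has_derivative_at)
  have "(\<lambda>n. norm (h n)) \<longlonglongrightarrow> 0"
    unfolding nh using LIMSEQ_Suc[OF lim_1_over_n] by simp
  then have "h \<longlonglongrightarrow> 0" by (rule tendsto_norm_zero_cancel)
  moreover have "h n \<noteq> 0" for n
    using nh[of n] by (metis norm_zero divide_eq_0_iff of_nat_eq_0_iff one_neq_zero nat.simps(3))
  ultimately have "filterlim h (at 0) sequentially"
    by (intro filterlim_atI) simp_all
  from filterlim_compose[OF lim this]
  have "(\<lambda>n. norm (g (z + h n) - g z - dir_deriv (h n) g z) / norm (h n)) \<longlonglongrightarrow> 0" .
  moreover have "norm (g (z + h n) - g z - dir_deriv (h n) g z) / norm (h n)
     = norm (of_nat (Suc n) * (g (z + h n) - g z) - dir_deriv v g z)" for n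
  proof -
    have "h n = (1 / real (Suc n)) *\<^sub>R v"
      by (simp add: h_def scaleR_conv_of_real del: of_nat_Suc)
    then have *: "dir_deriv (h n) g z = (1 / real (Suc n)) *\<^sub>R dir_deriv v g z"
      using linear_scale[OF has_derivative_linear[OF differentiable_has_dir_deriv[OF assms(1)]]]
          by metis
    have eq: "of_nat (Suc n) * (g (z + h n) - g z) - dir_deriv v g z
        = of_nat (Suc n) * (g (z + h n) - g z - dir_deriv (h n) g z)"
      unfolding * by (simp add: scaleR_conv_of_real right_diff_distrib del: of_nat_Suc)
    show ?thesis
      unfolding nh eq norm_mult norm_of_nat by (simp del: of_nat_Suc)
  qed
  ultimately show ?thesis
    unfolding h_def by (simp add: tendsto_norm_zero_iff LIM_zero_iff del: of_nat_Suc)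
qed

text \<open>Mean value inequality along a segment in direction v; it supplies the majorant for the
  difference quotients in \<open>integral_dir_deriv_eq_0\<close>.\<close>

lemma dir_deriv_lipschitz:
  assumes "\<And>z. g differentiable (at z)" and "\<And>z. cmod (dir_deriv v g z) \<le> C" and "t \<ge> 0"
  shows "cmod (g (z + t *\<^sub>R v) - g z) \<le> C * t"
proof -
  have d: "((\<lambda>s. g (z + s *\<^sub>R v)) has_derivative (\<lambda>s. s *\<^sub>R dir_deriv v g (z + x *\<^sub>R v))) (at x
      within {0..t})" for x
  proof -
    have 1: "((\<lambda>s. z + s *\<^sub>R v) has_derivative (\<lambda>s. s *\<^sub>R v)) (at x within {0..t})"
      by (auto intro!: derivative_eq_intros)
    have "((\<lambda>s. g (z + s *\<^sub>R v)) has_derivative (\<lambda>s. dir_deriv (s *\<^sub>R v) g (z + x *\<^sub>R v))) (at x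
        within {0..t})"
      using has_derivative_compose[OF 1 differentiable_has_dir_deriv[OF assms(1)]] .
    then show ?thesis
      using linear_scale[OF has_derivative_linear[OF differentiable_has_dir_deriv[OF assms(1)]]]
          by simp
  qed
  have "onorm (\<lambda>s. s *\<^sub>R dir_deriv v g (z + x *\<^sub>R v)) \<le> C" for x
    using assms(2)[of "z + x *\<^sub>R v"] 
    by (intro onorm_le) (auto simp: mult.commute[of C] intro: mult_left_mono)
  from differentiable_bound[OF convex_real_interval(5)[of 0 t] d this, of t 0]
  show ?thesis using assms(3) by simp
qed

text \<open>Translation invariance of Lebesgue measure makes the integrals of all difference quotients
  vanish.\<close>

lemma integral_dir_deriv_eq_0:
  assumes g: "Ck 1 g" and R: "\<And>z. cmod z > R \<Longrightarrow> g z = 0" and v: "v = 1 \<or> v = \<i>"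
  shows "(\<integral>z. dir_deriv v g z \<partial>lborel) = 0"
proof -
  have nv: "norm v = 1" using v by auto
  have diff: "\<And>z. g differentiable (at z)" using g by simp
  have [measurable]: "g \<in> borel_measurable borel"
    by (intro borel_measurable_continuous_onI Ck_imp_continuous[OF g])
  have cont: "continuous_on UNIV (dir_deriv v g)" using g v by auto
  then have [measurable]: "dir_deriv v g \<in> borel_measurable borel"
    by (intro borel_measurable_continuous_onI)
  have "dir_deriv v g z = 0" if "cmod z > R" for z
    by (rule dir_deriv_eq_0_outside[OF R that])
  then obtain C where C: "\<And>z. cmod (dir_deriv v g z) \<le> C * indicator (cball 0 R) z" "C > 0"
    using continuous_compact_support_bounded[OF cont] by blast
  then have C': "cmod (dir_deriv v g z) \<le> C" for z
    by (intro order_trans[OF C(1)]) (use C(2) in \<open>auto simp: indicator_def\<close>)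
  obtain B where B: "\<And>z. cmod (g z) \<le> B * indicator (cball 0 R) z"
    using continuous_compact_support_bounded[OF Ck_imp_continuous[OF g] R] by blast
  have gi: "integrable lborel g"
    using B by (intro Bochner_Integration.integrable_bound[OF
      integrable_mult_right[OF integrable_indicator_cball[of 0 R], of B]] AE_I2)
      (auto intro: order_trans[OF B abs_ge_self])
  let ?q = "\<lambda>n z. of_nat (Suc n) * (g (z + v / of_nat (Suc n)) - g z)"
  have shift: "integrable lborel (\<lambda>z. g (z + c))" "(\<integral>z. g (z + c) \<partial>lborel) = (\<integral>z. g z \<partial>lborel)"
      for c
  proof -
    have "integrable (distr lborel borel ((+) c)) g" using gi by (simp add: lborel_distr_plus)
    then show "integrable lborel (\<lambda>z. g (z + c))"
      by (subst (asm) integrable_distr_eq) (auto simp: add.commute)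
    have "(\<integral>z. g z \<partial>distr lborel borel ((+) c)) = (\<integral>z. g (z + c) \<partial>lborel)"
      by (subst integral_distr) (auto simp: add.commute)
    then show "(\<integral>z. g (z + c) \<partial>lborel) = (\<integral>z. g z \<partial>lborel)" by (simp add: lborel_distr_plus)
  qed
  have "(\<lambda>n. \<integral>z. ?q n z \<partial>lborel) \<longlonglongrightarrow> (\<integral>z. dir_deriv v g z \<partial>lborel)"
  \<comment> \<open>Shifts of length at most 1 move the support by at most 1, hence the radius R +
    1.\<close>
  proof (rule integral_dominated_convergence[where w="\<lambda>z. C * indicator (cball 0 (R + 1)) z"])
    show "AE z in lborel. (\<lambda>n. ?q n z) \<longlonglongrightarrow> dir_deriv v g z"
      by (intro AE_I2 dir_deriv_sequence diff nv)
    show "AE z in lborel. norm (?q n z) \<le> C * indicator (cball 0 (R + 1)) z" for n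
    proof (intro AE_I2)
      fix z
      show "norm (?q n z) \<le> C * indicator (cball 0 (R + 1)) z"
      proof (cases "z \<in> cball 0 (R + 1)")
        case True
        have "cmod (g (z + (1 / real (Suc n)) *\<^sub>R v) - g z) \<le> C * (1 / real (Suc n))"
          by (rule dir_deriv_lipschitz[OF diff C']) simp
        then have "real (Suc n) * cmod (g (z + v / of_nat (Suc n)) - g z) \<le> C"
          by (simp add: scaleR_conv_of_real field_simps del: of_nat_Suc)
        moreover have "norm (?q n z) = real (Suc n) * cmod (g (z + v / of_nat (Suc n)) - g z)"
          unfolding norm_mult norm_of_nat ..
        ultimately show ?thesis using True by (simp del: of_nat_Suc)
      next
        case False
        have "norm (v / of_nat (Suc n)) \<le> 1"
          using nv by (simp add: norm_divide del: of_nat_Suc)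
        then have "cmod (z + v / of_nat (Suc n)) > R"
          using False norm_diff_ineq[of z "v / of_nat (Suc n)"] by simp
        then show ?thesis using False R by simp
      qed
    qed
    show "integrable lborel (\<lambda>z::complex. C * indicator (cball 0 (R + 1)) z :: real)"
      using integrable_mult_right[OF integrable_indicator_cball] .
  qed simp_all
  moreover have "(\<integral>z. ?q n z \<partial>lborel) = 0" for n
    using shift gi by simp
  ultimately have "(\<lambda>n. 0) \<longlonglongrightarrow> (\<integral>z. dir_deriv v g z \<partial>lborel)"
    by (simp only:)
  then show ?thesis
    by (simp only: LIMSEQ_const_iff)
qed

section \<open>The logarithm as fundamental solution of the Laplacian\<close>

lemma measurable_Complex [measurable]:
  "(\<lambda>p. Complex (fst p) (snd p)) \<in> borel_measurable (borel \<Otimes>\<^sub>M borel)"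
  unfolding Complex_eq by simp

text \<open>Lebesgue measure is determined by its values on boxes, so the product measure need only
  be compared there.\<close>

lemma lborel_complex:
  "(lborel :: complex measure) = distr (lborel \<Otimes>\<^sub>M lborel) borel (\<lambda>p. Complex (fst p) (snd p))"
proof (rule lborel_eqI)
  fix l u :: complex
  assume le: "\<And>b. b \<in> Basis \<Longrightarrow> l \<bullet> b \<le> u \<bullet> b"
  have le': "Re l \<le> Re u" "Im l \<le> Im u"
    using le[of 1] le[of \<i>] by (simp_all add: Basis_complex_def inner_complex_def)
  have "emeasure (distr (lborel \<Otimes>\<^sub>M lborel) borel (\<lambda>p. Complex (fst p) (snd p))) (box l u)
     = emeasure (lborel \<Otimes>\<^sub>M lborel) ({Re l<..<Re u} \<times> {Im l<..<Im u})"
    by (subst emeasure_distr) (auto intro!: arg_cong2[where f=emeasure] simp: in_box_complex_iff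
        space_pair_measure)
  also have "\<dots> = ennreal ((Re u - Re l) * (Im u - Im l))"
    using le' by (subst lborel.emeasure_pair_measure_Times) (auto simp: ennreal_mult)
  also have "(Re u - Re l) * (Im u - Im l) = (\<Prod>b\<in>Basis. (u - l) \<bullet> b)"
    by (simp add: Basis_complex_def inner_complex_def)
  finally show "emeasure (distr (lborel \<Otimes>\<^sub>M lborel) borel (\<lambda>p. Complex (fst p) (snd p))) (box l u)
     = ennreal (\<Prod>b\<in>Basis. (u - l) \<bullet> b)" .
qed simp

lemma nn_integral_lborel_complex:
  assumes [measurable]: "f \<in> borel_measurable borel"
  shows "(\<integral>\<^sup>+z. f z \<partial>lborel) = (\<integral>\<^sup>+x. \<integral>\<^sup>+y. f (Complex x y) \<partial>lborel \<partial>lborel)"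
proof -
  have "(\<integral>\<^sup>+z. f z \<partial>lborel) = (\<integral>\<^sup>+p. f (Complex (fst p) (snd p)) \<partial>(lborel \<Otimes>\<^sub>M lborel))"
    by (subst lborel_complex, subst nn_integral_distr) auto
  also have "\<dots> = (\<integral>\<^sup>+x. \<integral>\<^sup>+y. f (Complex x y) \<partial>lborel \<partial>lborel)"
    by (subst lborel.nn_integral_fst[symmetric]) auto
  finally show ?thesis .
qed

lemma nn_integral_FTC_einterval:
  fixes f F :: "real \<Rightarrow> real" and a b :: ereal
  assumes "a < b"
    and "\<And>x. a < ereal x \<Longrightarrow> ereal x < b \<Longrightarrow> DERIV F x :> f x"
    and "\<And>x. a < ereal x \<Longrightarrow> ereal x < b \<Longrightarrow> isCont f x"
    and nonneg: "\<And>x. a < ereal x \<Longrightarrow> ereal x < b \<Longrightarrow> 0 \<le> f x"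
    and "((F \<circ> real_of_ereal) \<longlongrightarrow> A) (at_right a)"
    and "((F \<circ> real_of_ereal) \<longlongrightarrow> B) (at_left b)"
  shows "(\<integral>\<^sup>+x. ennreal (indicator (einterval a b) x * f x) \<partial>lborel) = ennreal (B - A)"
proof -
  have *: "set_integrable lborel (einterval a b) f" "(LBINT x=a..b. f x) = B - A"
    using interval_integral_FTC_nonneg[OF assms(1-3) _ assms(5,6)] nonneg by (auto intro!: AE_I2)
  have "(\<integral>\<^sup>+x. ennreal (indicator (einterval a b) x * f x) \<partial>lborel)
     = ennreal (\<integral>x. indicator (einterval a b) x * f x \<partial>lborel)"
    using *(1) nonneg
    by (intro nn_integral_eq_integral) (auto simp: set_integrable_def einterval_def indicator_def)
  also have "(\<integral>x. indicator (einterval a b) x * f x \<partial>lborel) = B - A"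
    using *(2) less_imp_le[OF assms(1)] by (simp add: interval_lebesgue_integral_def
        set_lebesgue_integral_def)
  finally show ?thesis .
qed

lemma nn_integral_FTC_UNIV:
  fixes f F :: "real \<Rightarrow> real"
  assumes "\<And>x. DERIV F x :> f x" and "\<And>x. isCont f x" and "\<And>x. 0 \<le> f x"
    and "(F \<longlongrightarrow> A) at_bot" and "(F \<longlongrightarrow> B) at_top"
  shows "(\<integral>\<^sup>+x. ennreal (f x) \<partial>lborel) = ennreal (B - A)"
  using nn_integral_FTC_einterval[of "-\<infinity>" \<infinity> F f A B] assms
  by (simp add: ereal_tendsto_simps einterval_def)

text \<open>The Laplacian of \<open>ln ((cmod z)\<^sup>2 + 1) / 2\<close>.\<close>

definition bubble :: "complex \<Rightarrow> real" where
  "bubble z = 2 / ((cmod z)\<^sup>2 + 1)\<^sup>2"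

lemma bubble_measurable [measurable]: "bubble \<in> borel_measurable borel"
  unfolding bubble_def by measurable

text \<open>This mass is the constant in Delta ln |z| = 2 pi delta_0. With a^2 = 1 + x^2 the inner
  integral is pi / a^3, which has the antiderivative pi x / sqrt (1 + x^2); Cartesian iteration thus
  takes the place of polar coordinates.\<close>

lemma nn_integral_bubble: "(\<integral>\<^sup>+z. ennreal (bubble z) \<partial>lborel) = ennreal (2 * pi)"
proof -
  have inner: "(\<integral>\<^sup>+y. ennreal (bubble (Complex x y)) \<partial>lborel) = ennreal (pi / sqrt (1 + x\<^sup>2) ^ 3)"
      for x
  proof -
    define a where "a = sqrt (1 + x\<^sup>2)"
    have a: "a > 0" "a\<^sup>2 = 1 + x\<^sup>2" by (auto simp: a_def add_pos_nonneg)
    have pos: "a\<^sup>2 + y\<^sup>2 > 0" for y :: real using a by (simp add: add_pos_nonneg)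
    have "(\<integral>\<^sup>+y. ennreal (2 / (a\<^sup>2 + y\<^sup>2)\<^sup>2) \<partial>lborel) = ennreal (pi / 2 / a ^ 3 - - (pi / 2) / a ^
        3)"
    proof (rule nn_integral_FTC_UNIV[where F="\<lambda>y. y / (a\<^sup>2 * (a\<^sup>2 + y\<^sup>2)) + arctan (y / a) / a ^
        3"])
      fix y :: real
      have d1: "((\<lambda>y. arctan (y / a) / a ^ 3) has_real_derivative (1 / (a\<^sup>2 * (a\<^sup>2 + y\<^sup>2)))) (at y)"
      proof -
        have "((\<lambda>y. arctan (y / a)) has_real_derivative (inverse (1 + (y / a)\<^sup>2) * (1 / a))) (at y)"
          using a by (auto intro!: derivative_eq_intros)
        then have "((\<lambda>y. arctan (y / a) / a ^ 3) has_real_derivative (inverse (1 + (y / a)\<^sup>2) * (1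
            / a) / a ^ 3)) (at y)"
          by (rule DERIV_cdivide)
        also have "inverse (1 + (y / a)\<^sup>2) * (1 / a) / a ^ 3 = 1 / (a\<^sup>2 * (a\<^sup>2 + y\<^sup>2))"
        proof -
          have "1 + (y / a)\<^sup>2 = (a\<^sup>2 + y\<^sup>2) / a\<^sup>2" using a(1) by (simp add: field_simps)
          then show ?thesis using a(1) pos[of y]
            by (simp add: divide_simps) (simp add: power2_eq_square power3_eq_cube power4_eq_xxxx)
        qed
        finally show ?thesis .
      qed
      have d2: "((\<lambda>y. y / (a\<^sup>2 * (a\<^sup>2 + y\<^sup>2))) has_real_derivative
          ((a\<^sup>2 * (a\<^sup>2 + y\<^sup>2) - y * (a\<^sup>2 * (2 * y))) / (a\<^sup>2 * (a\<^sup>2 + y\<^sup>2))\<^sup>2)) (at y)"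
        using a(1) pos[of y] by (auto intro!: derivative_eq_intros simp: power2_eq_square)
      have eq: "((a\<^sup>2 * (a\<^sup>2 + y\<^sup>2) - y * (a\<^sup>2 * (2 * y))) / (a\<^sup>2 * (a\<^sup>2 + y\<^sup>2))\<^sup>2) +
          1 / (a\<^sup>2 * (a\<^sup>2 + y\<^sup>2)) = 2 / (a\<^sup>2 + y\<^sup>2)\<^sup>2"
      proof -
        define c d where "c = a\<^sup>2" and "d = a\<^sup>2 + y\<^sup>2"
        have "c > 0" "d > 0" "y * y = d - c" using a(1) pos[of y] by (auto simp: c_def d_def
            power2_eq_square)
        have "y * (c * (2 * y)) = 2 * c * (y * y)" by simp
        then have "(c * d - y * (c * (2 * y))) / (c * d)\<^sup>2 + 1 / (c * d) = (c * d - 2 * c * (d -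
            c)) / (c * d)\<^sup>2 + 1 / (c * d)"
          by (simp only: \<open>y * y = d - c\<close>)
        also have "\<dots> = 2 / d\<^sup>2"
          using \<open>c > 0\<close> \<open>d > 0\<close> by (simp add: divide_simps power2_eq_square) (simp add:
              algebra_simps)
        finally show ?thesis by (simp add: c_def d_def)
      qed
      show "((\<lambda>y. y / (a\<^sup>2 * (a\<^sup>2 + y\<^sup>2)) + arctan (y / a) / a ^ 3) has_real_derivative
          2 / (a\<^sup>2 + y\<^sup>2)\<^sup>2) (at y)"
        using DERIV_add[OF d2 d1] unfolding eq .
      show "isCont (\<lambda>y. 2 / (a\<^sup>2 + y\<^sup>2)\<^sup>2) y"
        using pos[of y] by (intro continuous_intros) auto
    next
      have "((\<lambda>y. y / (a\<^sup>2 * (a\<^sup>2 + y\<^sup>2)) + arctan (y / a) / a ^ 3) \<longlongrightarrow> 0 + - (pi / 2) / a ^ 3)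
          at_bot"
      proof (intro tendsto_intros)
        show "((\<lambda>y. y / (a\<^sup>2 * (a\<^sup>2 + y\<^sup>2))) \<longlongrightarrow> 0) at_bot" using a(1) by real_asymp
        show "((\<lambda>y. arctan (y / a)) \<longlongrightarrow> - (pi / 2)) at_bot" using a(1) by real_asymp
      qed (use a in auto)
      then show "((\<lambda>y. y / (a\<^sup>2 * (a\<^sup>2 + y\<^sup>2)) + arctan (y / a) / a ^ 3) \<longlongrightarrow> - (pi / 2) / a ^ 3)
          at_bot" by simp
      have "((\<lambda>y. y / (a\<^sup>2 * (a\<^sup>2 + y\<^sup>2)) + arctan (y / a) / a ^ 3) \<longlongrightarrow> 0 + (pi / 2) / a ^ 3) at_top"
      proof (intro tendsto_intros)
        show "((\<lambda>y. y / (a\<^sup>2 * (a\<^sup>2 + y\<^sup>2))) \<longlongrightarrow> 0) at_top" using a(1) by real_asymp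
        show "((\<lambda>y. arctan (y / a)) \<longlongrightarrow> pi / 2) at_top" using a(1) by real_asymp
      qed (use a in auto)
      then show "((\<lambda>y. y / (a\<^sup>2 * (a\<^sup>2 + y\<^sup>2)) + arctan (y / a) / a ^ 3) \<longlongrightarrow> pi / 2 / a ^ 3) at_top"
          by simp
    qed simp
    moreover have "bubble (Complex x y) = 2 / (a\<^sup>2 + y\<^sup>2)\<^sup>2" for y
      by (simp add: bubble_def a(2) cmod_power2 add_ac)
    ultimately show ?thesis by (simp add: a_def)
  qed
  have "(\<integral>\<^sup>+x. ennreal (pi / sqrt (1 + x\<^sup>2) ^ 3) \<partial>lborel) = ennreal (pi - - pi)"
  proof (rule nn_integral_FTC_UNIV[where F="\<lambda>x. pi * (x / sqrt (1 + x\<^sup>2))"])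
    fix x :: real
    define s where "s = sqrt (1 + x\<^sup>2)"
    have s: "s > 0" "s\<^sup>2 = 1 + x\<^sup>2" "1 + x\<^sup>2 > 0" by (auto simp: s_def add_pos_nonneg)
    have ds: "((\<lambda>x. sqrt (1 + x\<^sup>2)) has_real_derivative x / s) (at x)"
      using s by (auto intro!: derivative_eq_intros simp: s_def field_simps)
    have "((\<lambda>x. pi * (x / sqrt (1 + x\<^sup>2))) has_real_derivative pi * ((s - x * (x / s)) / (s * s)))
        (at x)"
      using DERIV_cmult[OF DERIV_divide[OF DERIV_ident ds], of pi] s(1) by (simp add: s_def)
    also have "pi * ((s - x * (x / s)) / (s * s)) = pi / s ^ 3"
    proof -
      have "s - x * (x / s) = 1 / s" using s by (simp add: field_simps power2_eq_square)
      then show ?thesis using s by (simp add: power3_eq_cube)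
    qed
    finally show "((\<lambda>x. pi * (x / sqrt (1 + x\<^sup>2))) has_real_derivative pi / sqrt (1 + x\<^sup>2) ^ 3)
        (at x)"
      by (simp add: s_def)
    show "isCont (\<lambda>x. pi / sqrt (1 + x\<^sup>2) ^ 3) x"
      using s by (intro continuous_intros) auto
  next
    show "((\<lambda>x. pi * (x / sqrt (1 + x\<^sup>2))) \<longlongrightarrow> - pi) at_bot" by real_asymp
    show "((\<lambda>x. pi * (x / sqrt (1 + x\<^sup>2))) \<longlongrightarrow> pi) at_top" by real_asymp
  qed simp
  then show ?thesis
    by (subst nn_integral_lborel_complex) (simp_all add: inner)
qed

lemma bubble_nonneg: "bubble z \<ge> 0"
  by (simp add: bubble_def)

lemma bubble_integrable: "integrable lborel bubble"
  by (rule integrableI_nonneg) (simp_all add: bubble_nonneg nn_integral_bubble)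

lemma integral_bubble: "(\<integral>z. bubble z \<partial>lborel) = 2 * pi"
  by (subst integral_eq_nn_integral) (simp_all add: bubble_nonneg nn_integral_bubble)

section \<open>Square-integrability of the logarithmic singularity\<close>

text \<open>The singular part of (ln |z|)^2. It vanishes outside the unit disc, so that its integral
  over the whole plane is finite; at z = 0 the library value \<open>ln 0 = 0\<close> makes it
  0.\<close>

definition neglog_sq :: "complex \<Rightarrow> real" where
  "neglog_sq z = (min 0 (ln (cmod z)))\<^sup>2"

lemma neglog_sq_measurable [measurable]: "neglog_sq \<in> borel_measurable borel"
  unfolding neglog_sq_def by measurable

lemma neglog_sq_nonneg [simp]: "neglog_sq z \<ge> 0"
  by (simp add: neglog_sq_def)

text \<open>Because |z| >= |Re z|, the planar singularity is dominated by a function of Re z whose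
  own singularity is integrable on the line.\<close>

lemma neglog_sq_le:
  assumes "Re z \<noteq> 0"
  shows "neglog_sq z \<le> (if \<bar>Re z\<bar> \<le> 1 \<and> \<bar>Im z\<bar> \<le> 1 then 16 / sqrt \<bar>Re z\<bar> else 0)"
proof (cases "cmod z \<le> 1")
  case True
  define t where "t = \<bar>Re z\<bar>"
  have t: "t > 0" "t \<le> cmod z" using assms by (auto simp: t_def abs_Re_le_cmod)
  have im: "\<bar>Im z\<bar> \<le> 1" using True abs_Im_le_cmod[of z] by linarith
  \<comment> \<open>With s = t^(1/4), the inequality ln (1/s) <= 1/s reads - ln t <= 4/s, and the
    square of the right side is 16 / sqrt t.\<close>
  define s where "s = sqrt (sqrt t)"
  have s: "s > 0" "s\<^sup>2 = sqrt t" using t by (auto simp: s_def)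
  have "ln (1 / s) \<le> 1 / s" using s(1) ln_le_minus_one[of "1 / s"] by simp
  moreover have "ln s = ln t / 4" using t by (simp add: s_def ln_sqrt)
  ultimately have "- ln t \<le> 4 / s" using s(1) by (simp add: ln_div)
  moreover have "ln t \<le> ln (cmod z)" using t by (subst ln_le_cancel_iff) auto
  moreover have "ln (cmod z) \<le> 0" using True t by (subst ln_le_zero_iff) auto
  ultimately have "\<bar>ln (cmod z)\<bar> \<le> \<bar>4 / s\<bar>" using s(1) by simp
  then have "(ln (cmod z))\<^sup>2 \<le> (4 / s)\<^sup>2" by (simp only: abs_le_square_iff)
  also have "(4 / s)\<^sup>2 = 16 / sqrt t" using s by (simp add: power_divide)
  finally show ?thesis
    using True t im \<open>ln (cmod z) \<le> 0\<close> by (simp add: neglog_sq_def t_def[symmetric])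
next
  case False
  then have "ln (cmod z) \<ge> 0" by simp
  then show ?thesis by (simp add: neglog_sq_def)
qed

lemma nn_integral_inverse_sqrt:
  "(\<integral>\<^sup>+x. ennreal (indicator {0<..<1} x * (16 / sqrt x)) \<partial>lborel) = 32"
  "(\<integral>\<^sup>+x. ennreal (indicator {-1<..<0} x * (16 / sqrt (- x))) \<partial>lborel) = 32"
proof -
  have "(\<integral>\<^sup>+x. ennreal (indicator (einterval 0 1) x * (16 / sqrt x)) \<partial>lborel) = ennreal (32 - 0)"
  proof (rule nn_integral_FTC_einterval[where F="\<lambda>x. 32 * sqrt x"])
    show "((\<lambda>x. 32 * sqrt x) has_real_derivative 16 / sqrt x) (at x)" if "0 < ereal x" "ereal x <
        1" for x
      using that by (auto intro!: derivative_eq_intros simp: field_simps)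
    show "isCont (\<lambda>x. 16 / sqrt x) x" if "0 < ereal x" "ereal x < 1" for x
      using that by (intro continuous_intros) auto
    show "(((\<lambda>x. 32 * sqrt x) \<circ> real_of_ereal) \<longlongrightarrow> 0) (at_right 0)"
      unfolding zero_ereal_def ereal_tendsto_simps by (auto intro!: tendsto_eq_intros)
    show "(((\<lambda>x. 32 * sqrt x) \<circ> real_of_ereal) \<longlongrightarrow> 32) (at_left 1)"
      unfolding one_ereal_def ereal_tendsto_simps by (auto intro!: tendsto_eq_intros)
  qed auto
  moreover have "einterval 0 1 = {0<..<1}" by (auto simp: einterval_def)
  ultimately show "(\<integral>\<^sup>+x. ennreal (indicator {0<..<1} x * (16 / sqrt x)) \<partial>lborel) = 32" by simp
  have "(\<integral>\<^sup>+x. ennreal (indicator (einterval (ereal (-1)) 0) x * (16 / sqrt (-x))) \<partial>lborel) =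
      ennreal (0 - (-32))"
  proof (rule nn_integral_FTC_einterval[where F="\<lambda>x. - 32 * sqrt (-x)"])
    show "((\<lambda>x. - 32 * sqrt (- x)) has_real_derivative 16 / sqrt (- x)) (at x)" if "ereal (-1) <
        ereal x" "ereal x < 0" for x
      using that by (auto intro!: derivative_eq_intros simp: field_simps)
    show "isCont (\<lambda>x. 16 / sqrt (- x)) x" if "ereal (-1) < ereal x" "ereal x < 0" for x
      using that by (intro continuous_intros) auto
    show "(((\<lambda>x. - 32 * sqrt (- x)) \<circ> real_of_ereal) \<longlongrightarrow> - 32) (at_right (ereal (-1)))"
      unfolding ereal_tendsto_simps by (auto intro!: tendsto_eq_intros)
    show "(((\<lambda>x. - 32 * sqrt (- x)) \<circ> real_of_ereal) \<longlongrightarrow> 0) (at_left 0)"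
      unfolding zero_ereal_def ereal_tendsto_simps by (auto intro!: tendsto_eq_intros)
  qed auto
  moreover have "einterval (ereal (-1)) 0 = {-1<..<0}" by (auto simp: einterval_def)
  ultimately show "(\<integral>\<^sup>+x. ennreal (indicator {-1<..<0} x * (16 / sqrt (- x))) \<partial>lborel) = 32" by simp
qed

lemma neglog_sq_integrable: "integrable lborel neglog_sq"
proof -
  let ?g = "\<lambda>x. ennreal (indicator {0<..<1} x * (16 / sqrt x)) + ennreal (indicator {-1<..<0} x *
      (16 / sqrt (- x)))"
  \<comment> \<open>x = 0 is the singular line; x = 1 and x = -1 are left out because
    \<open>?g\<close> uses open intervals.\<close>
  have le: "(\<integral>\<^sup>+y. ennreal (neglog_sq (Complex x y)) \<partial>lborel) \<le> 2 * ?g x"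
    if "x \<noteq> 0" "x \<noteq> 1" "x \<noteq> -1" for x
  proof -
    have "(\<integral>\<^sup>+y. ennreal (neglog_sq (Complex x y)) \<partial>lborel) \<le> (\<integral>\<^sup>+y. ?g x * indicator
        {-1..1::real} y \<partial>lborel)"
    proof (rule nn_integral_mono)
      fix y :: real
      have "neglog_sq (Complex x y) \<le> (if \<bar>x\<bar> \<le> 1 \<and> \<bar>y\<bar> \<le> 1 then 16 / sqrt \<bar>x\<bar> else 0)"
        using neglog_sq_le[of "Complex x y", unfolded complex.sel] that by blast
      moreover have "ennreal (if \<bar>x\<bar> \<le> 1 \<and> \<bar>y\<bar> \<le> 1 then 16 / sqrt \<bar>x\<bar> else 0) = ?g x * indicator
          {-1..1} y"
        using that by (auto simp: indicator_def abs_if)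
      ultimately show "ennreal (neglog_sq (Complex x y)) \<le> ?g x * indicator {-1..1} y"
        by (metis ennreal_leI)
    qed
    also have "\<dots> = ?g x * 2" by (simp add: nn_integral_cmult)
    finally show ?thesis by (simp add: mult.commute)
  qed
  have "AE x in lborel. x \<noteq> 0 \<and> x \<noteq> 1 \<and> x \<noteq> (-1::real)"
    using AE_lborel_singleton[of "0::real"] AE_lborel_singleton[of "1::real"]
        AE_lborel_singleton[of "-1::real"]
    by eventually_elim auto
  then have "(\<integral>\<^sup>+x. \<integral>\<^sup>+y. ennreal (neglog_sq (Complex x y)) \<partial>lborel \<partial>lborel) \<le> (\<integral>\<^sup>+x. 2 * ?g x
      \<partial>lborel)"
    by (intro nn_integral_mono_AE, elim eventually_mono) (rule le, auto)
  also have "\<dots> = 2 * (32 + 32)"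
    by (subst nn_integral_cmult) (auto simp: nn_integral_add nn_integral_inverse_sqrt simp del:
        times_divide_eq_right)
  also have "\<dots> < \<infinity>" by simp
  finally have "(\<integral>\<^sup>+z. ennreal (neglog_sq z) \<partial>lborel) < \<infinity>"
    by (subst nn_integral_lborel_complex) auto
  then show ?thesis by (intro integrableI_nonneg) simp_all
qed

section \<open>Regularised logarithms and Green's identity\<close>

lemma has_derivative_reg_dist:
  "((\<lambda>z. (cmod (z - w))\<^sup>2 + e) has_derivative (\<lambda>u. 2 * ((z - w) \<bullet> u))) (at z)"
  unfolding power2_norm_eq_inner
  by (auto intro!: derivative_eq_intros simp: inner_commute)

text \<open>For e > 0 the singularity at w is smoothed out, and ln |z - w| returns as e tends to 0.
  The Laplacian is a rescaled \<open>bubble\<close> centred at w with length scale sqrt e.\<close>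

definition reg_log :: "complex \<Rightarrow> real \<Rightarrow> complex \<Rightarrow> complex" where
  "reg_log w e z = complex_of_real (ln ((cmod (z - w))\<^sup>2 + e) / 2)"

lemma has_derivative_reg_log:
  assumes "e > 0"
  shows "(reg_log w e has_derivative (\<lambda>u. complex_of_real (((z - w) \<bullet> u) / ((cmod (z - w))\<^sup>2 +
      e)))) (at z)"
proof -
  have pos: "(cmod (z - w))\<^sup>2 + e > 0" using assms by (simp add: add_nonneg_pos)
  have "((\<lambda>z. ln ((cmod (z - w))\<^sup>2 + e)) has_derivative
      (\<lambda>u. inverse ((cmod (z - w))\<^sup>2 + e) * (2 * ((z - w) \<bullet> u)))) (at z)"
    using has_derivative_compose[OF has_derivative_reg_dist
      DERIV_ln[OF pos, unfolded has_field_derivative_def]] by simp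
  have cancel: "inverse D * (2 * x) / 2 = x / D" for x D :: real
    by (cases "D = 0") (auto simp: field_simps)
  from bounded_linear.has_derivative[OF bounded_linear_divide[of 2] \<open>((\<lambda>z. ln ((cmod (z - w))\<^sup>2 +
      e)) has_derivative
      (\<lambda>u. inverse ((cmod (z - w))\<^sup>2 + e) * (2 * ((z - w) \<bullet> u)))) (at z)\<close>]
  have "((\<lambda>z. ln ((cmod (z - w))\<^sup>2 + e) / 2) has_derivative
      (\<lambda>u. ((z - w) \<bullet> u) / ((cmod (z - w))\<^sup>2 + e))) (at z)"
    by (rule has_derivative_eq_rhs) (simp only: cancel)
  then show ?thesis unfolding reg_log_def
    by (rule has_derivative_of_real)
qed

lemma has_derivative_reg_log_deriv:
  assumes "e > 0"
  shows "((\<lambda>z. complex_of_real (((z - w) \<bullet> v) / ((cmod (z - w))\<^sup>2 + e))) has_derivative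
    (\<lambda>u. complex_of_real ((u \<bullet> v) / ((cmod (z - w))\<^sup>2 + e)
        - 2 * ((z - w) \<bullet> v) * ((z - w) \<bullet> u) / ((cmod (z - w))\<^sup>2 + e)\<^sup>2))) (at z)"
proof -
  have pos: "(cmod (z - w))\<^sup>2 + e > 0" using assms by (simp add: add_nonneg_pos)
  have "((\<lambda>z. (z - w) \<bullet> v) has_derivative (\<lambda>u. u \<bullet> v)) (at z)"
    by (auto intro!: derivative_eq_intros)
  have "((\<lambda>z. ((z - w) \<bullet> v) / ((cmod (z - w))\<^sup>2 + e)) has_derivative
    (\<lambda>u. (u \<bullet> v) / ((cmod (z - w))\<^sup>2 + e)
        - 2 * ((z - w) \<bullet> v) * ((z - w) \<bullet> u) / ((cmod (z - w))\<^sup>2 + e)\<^sup>2)) (at z)"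
    by (rule has_derivative_eq_rhs[OF has_derivative_divide'[OF \<open>((\<lambda>z. (z - w) \<bullet> v) has_derivative
        (\<lambda>u. u \<bullet> v)) (at z)\<close>
        has_derivative_reg_dist]])
      (use pos in \<open>simp_all add: fun_eq_iff diff_divide_distrib power2_eq_square[of "(cmod (z -
          w))\<^sup>2 + e"]\<close>)
  then show ?thesis
    by (rule has_derivative_of_real)
qed

lemma reg_log_Ck_2:
  assumes "e > 0"
  shows "Ck (Suc (Suc 0)) (reg_log w e)"
    and "dir_deriv v (reg_log w e) = (\<lambda>z. complex_of_real (((z - w) \<bullet> v) / ((cmod (z - w))\<^sup>2 + e)))"
    and "laplacian (reg_log w e) z = complex_of_real (2 * e / ((cmod (z - w))\<^sup>2 + e)\<^sup>2)"
proof -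
  have pos: "(cmod (z - w))\<^sup>2 + e > 0" for z using assms by (simp add: add_nonneg_pos)
  show d: "dir_deriv v (reg_log w e) = (\<lambda>z. complex_of_real (((z - w) \<bullet> v) / ((cmod (z - w))\<^sup>2 +
      e)))" for v
    by (intro ext dir_deriv_eq[OF has_derivative_reg_log[OF assms]])
  have d2: "dir_deriv u (dir_deriv v (reg_log w e)) = (\<lambda>z. complex_of_real ((u \<bullet> v) / ((cmod (z -
      w))\<^sup>2 + e)
        - 2 * ((z - w) \<bullet> v) * ((z - w) \<bullet> u) / ((cmod (z - w))\<^sup>2 + e)\<^sup>2))" for u v
    unfolding d by (intro ext dir_deriv_eq[OF has_derivative_reg_log_deriv[OF assms]])
  have "continuous_on UNIV (dir_deriv u (dir_deriv v (reg_log w e)))" for u v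
    unfolding d2 using pos by (intro continuous_intros) (auto simp: less_imp_neq[OF pos, symmetric])
  moreover have "dir_deriv v (reg_log w e) differentiable (at z)" for v z
    unfolding d using has_derivative_reg_log_deriv[OF assms] differentiable_def by blast
  moreover have "reg_log w e differentiable (at z)" for z
    using has_derivative_reg_log[OF assms] differentiable_def by blast
  ultimately show "Ck (Suc (Suc 0)) (reg_log w e)" by simp
  define D where "D = (cmod (z - w))\<^sup>2 + e"
  have D: "D > 0" "(Re (z - w))\<^sup>2 + (Im (z - w))\<^sup>2 = D - e" using pos by (auto simp: D_def
      cmod_power2)
  have "laplacian (reg_log w e) z = complex_of_real (1 / D - 2 * (Re (z - w))\<^sup>2 / D\<^sup>2 + (1 / D - 2
      * (Im (z - w))\<^sup>2 / D\<^sup>2))"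
  proof -
    have "(z - w) \<bullet> 1 = Re (z - w)" "(z - w) \<bullet> \<i> = Im (z - w)" "(1::complex) \<bullet> 1 = 1" "\<i> \<bullet> \<i> = 1"
      by (simp_all add: inner_complex_def)
    then show ?thesis
      unfolding laplacian_def d2 D_def[symmetric]
      by (simp only: of_real_add[symmetric] power2_eq_square[of "Re (z - w)"] power2_eq_square[of
          "Im (z - w)"] mult.assoc)
  qed
  \<comment> \<open>The numerators combine to |z - w|^2 = D - e, which leaves only 2 e /
    D^2.\<close>
  also have "1 / D - 2 * (Re (z - w))\<^sup>2 / D\<^sup>2 + (1 / D - 2 * (Im (z - w))\<^sup>2 / D\<^sup>2)
      = 2 / D - 2 * ((Re (z - w))\<^sup>2 + (Im (z - w))\<^sup>2) / D\<^sup>2"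
    by (simp add: add_divide_distrib distrib_left)
  also have "\<dots> = 2 * e / D\<^sup>2"
    unfolding D(2) using D(1) by (simp add: divide_simps power2_eq_square)
  finally show "laplacian (reg_log w e) z = complex_of_real (2 * e / ((cmod (z - w))\<^sup>2 + e)\<^sup>2)"
    by (simp add: D_def)
qed

lemma integrable_compact_support:
  fixes f :: "complex \<Rightarrow> complex"
  assumes "continuous_on UNIV f" and "\<And>z. cmod z > R \<Longrightarrow> f z = 0"
  shows "integrable lborel f"
proof -
  obtain C where C: "\<And>z. cmod (f z) \<le> C * indicator (cball 0 R) z"
    using continuous_compact_support_bounded[OF assms] by blast
  have "f \<in> borel_measurable lborel"
    using borel_measurable_continuous_onI[OF assms(1)] by simp
  then show ?thesis
    using C by (intro Bochner_Integration.integrable_bound[OF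
      integrable_mult_right[OF integrable_indicator_cball[of 0 R], of C]] AE_I2)
      (auto intro: order_trans[OF C abs_ge_self])
qed

text \<open>In each coordinate direction v, the field (d_v phi) h - phi (d_v h) has compact support
  and v-derivative (d_v d_v phi) h - phi (d_v d_v h), so the latter integrates to zero.\<close>

lemma green_identity:
  assumes \<phi>: "\<phi> \<in> Cc_infinity" and h: "Ck (Suc (Suc 0)) h"
  shows "(\<integral>z. laplacian \<phi> z * h z \<partial>lborel) = (\<integral>z. \<phi> z * laplacian h z \<partial>lborel)"
proof -
  obtain R where R: "\<And>z. cmod z > R \<Longrightarrow> \<phi> z = 0"
    using Cc_infinity_bounded_support[OF \<phi>] by blast
  have R1: "dir_deriv v \<phi> z = 0" if "cmod z > R" for v z
    by (rule dir_deriv_eq_0_outside[OF R that])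
  have R2: "dir_deriv v (dir_deriv v \<phi>) z = 0" if "cmod z > R" for v z
    by (rule dir_deriv_eq_0_outside[OF R1 that])
  have part: "integrable lborel (\<lambda>z. dir_deriv v (dir_deriv v \<phi>) z * h z)"
    "integrable lborel (\<lambda>z. \<phi> z * dir_deriv v (dir_deriv v h) z)"
    "(\<integral>z. dir_deriv v (dir_deriv v \<phi>) z * h z \<partial>lborel) = (\<integral>z. \<phi> z * dir_deriv v (dir_deriv v h) z
        \<partial>lborel)"
    if v: "v = 1 \<or> v = \<i>" for v
  proof -
    have C\<phi>: "Ck k (dir_deriv v \<phi>)" "Ck k (dir_deriv v (dir_deriv v \<phi>))" for k
      using \<phi> v Cc_infinity_dir_deriv Cc_infinity_Ck by metis+
    have Ch: "Ck (Suc 0) (dir_deriv v h)" "Ck 0 (dir_deriv v (dir_deriv v h))" "Ck (Suc 0) h"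
      using h v Ck_SucD[OF h] by auto
    have cont: "continuous_on UNIV h" "continuous_on UNIV (dir_deriv v (dir_deriv v h))"
      "continuous_on UNIV \<phi>" "continuous_on UNIV (dir_deriv v (dir_deriv v \<phi>))"
      using Ck_imp_continuous Ch C\<phi> Cc_infinity_continuous[OF \<phi>] by blast+
    show 1: "integrable lborel (\<lambda>z. dir_deriv v (dir_deriv v \<phi>) z * h z)"
      by (rule integrable_compact_support[of _ R]) (auto intro!: continuous_on_mult cont simp: R2)
    show 2: "integrable lborel (\<lambda>z. \<phi> z * dir_deriv v (dir_deriv v h) z)"
      by (rule integrable_compact_support[of _ R]) (auto intro!: continuous_on_mult cont simp: R)
    define g where "g z = dir_deriv v \<phi> z * h z + (-1) * (\<phi> z * dir_deriv v h z)" for z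
    have "Ck 1 g"
      unfolding g_def One_nat_def by (intro Ck_add Ck_mult Ck_const C\<phi> Ch Cc_infinity_Ck \<phi>)
    moreover have "g z = 0" if "cmod z > R" for z
      using that R R1 by (simp add: g_def)
    ultimately have "(\<integral>z. dir_deriv v g z \<partial>lborel) = 0"
      using v by (rule integral_dir_deriv_eq_0)
    moreover have "dir_deriv v g z = dir_deriv v (dir_deriv v \<phi>) z * h z - \<phi> z * dir_deriv v
        (dir_deriv v h) z" for z
    proof -
      have diff: "dir_deriv v \<phi> differentiable at z" "\<phi> differentiable at z" "h differentiable at z"
        "dir_deriv v h differentiable at z"
        using C\<phi>(1)[of "Suc 0"] Cc_infinity_Ck[OF \<phi>, of "Suc 0"] Ch by auto
      note hd = diff[THEN differentiable_has_dir_deriv]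
      have "(g has_derivative (\<lambda>u. dir_deriv v \<phi> z * dir_deriv u h z + dir_deriv u (dir_deriv v \<phi>)
          z * h z +
          (-1) * (\<phi> z * dir_deriv u (dir_deriv v h) z + dir_deriv u \<phi> z * dir_deriv v h z))) (at z)"
        unfolding g_def
        by (intro has_derivative_add has_derivative_mult has_derivative_mult_right hd)
      from dir_deriv_eq[OF this, of v] show ?thesis by simp
    qed
    ultimately show "(\<integral>z. dir_deriv v (dir_deriv v \<phi>) z * h z \<partial>lborel) = (\<integral>z. \<phi> z * dir_deriv v
        (dir_deriv v h) z \<partial>lborel)"
      using 1 2 by simp
  qed
  show ?thesis
    unfolding laplacian_def distrib_left distrib_right
    using part[of 1] part[of \<i>] by simp
qed

text \<open>The two sources of unboundedness are separated: \<open>neglog_sq\<close> covers the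
  origin, the modulus covers infinity.\<close>

lemma abs_ln_cmod_le: "\<bar>ln (cmod z)\<bar> \<le> 1 + neglog_sq z + cmod z"
proof (cases "cmod z \<le> 1")
  case True
  then have "ln (cmod z) \<le> 0" by (cases "z = 0") (simp, subst ln_le_zero_iff, auto)
  have "\<bar>x\<bar> \<le> 1 + x\<^sup>2" for x :: real
    using sum_squares_ge_zero[of "\<bar>x\<bar> - 1" 0] zero_le_power2[of "\<bar>x\<bar> - 1"] 
    by (auto simp: power2_eq_square algebra_simps abs_if split: if_splits)
  from this[of "ln (cmod z)"] have "\<bar>ln (cmod z)\<bar> \<le> 1 + (ln (cmod z))\<^sup>2" .
  moreover have "neglog_sq z = (ln (cmod z))\<^sup>2"
    using \<open>ln (cmod z) \<le> 0\<close> by (simp add: neglog_sq_def min_absorb2)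
  ultimately show ?thesis
    using norm_ge_zero[of z] by linarith
next
  case False
  then have "cmod z > 0" "ln (cmod z) \<ge> 0" by auto
  then show ?thesis using ln_le_minus_one[of "cmod z"] neglog_sq_nonneg[of z] norm_ge_zero[of z]
      by linarith
qed

text \<open>That the integral does not depend on w is the source of all later uniformity in the
  positions of zeros and sample points.\<close>

lemma neglog_sq_shift_integrable:
  "integrable lborel (\<lambda>z. neglog_sq (z - w))"
  "(\<integral>z. neglog_sq (z - w) \<partial>lborel) = (\<integral>z. neglog_sq z \<partial>lborel)"
proof -
  have "integrable (distr lborel borel ((+) (- w))) neglog_sq"
    using neglog_sq_integrable by (simp add: lborel_distr_plus)
  then show "integrable lborel (\<lambda>z. neglog_sq (z - w))"
    by (subst (asm) integrable_distr_eq) auto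
  have "(\<integral>z. neglog_sq z \<partial>distr lborel borel ((+) (- w))) = (\<integral>z. neglog_sq (z - w) \<partial>lborel)"
    by (subst integral_distr) auto
  then show "(\<integral>z. neglog_sq (z - w) \<partial>lborel) = (\<integral>z. neglog_sq z \<partial>lborel)"
    by (simp add: lborel_distr_plus)
qed

lemma nn_integral_neglog_sq_shift:
  "(\<integral>\<^sup>+z. ennreal (neglog_sq (z - w)) \<partial>lborel) = ennreal (\<integral>z. neglog_sq z \<partial>lborel)"
  using neglog_sq_shift_integrable[of w] by (subst nn_integral_eq_integral) auto

text \<open>Substituting z = w + e u turns the kernel into \<open>bubble\<close>, of mass 2 pi: the
  kernels are 2 pi times an approximate identity at w.\<close>

lemma integral_Cc_bubble_limit:
  assumes \<phi>: "\<phi> \<in> Cc_infinity"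
  shows "(\<lambda>n. \<integral>z. \<phi> z * complex_of_real (2 * (1 / Suc n)\<^sup>2 / ((cmod (z - w))\<^sup>2 + (1 / Suc n)\<^sup>2)\<^sup>2)
      \<partial>lborel)
    \<longlonglongrightarrow> 2 * of_real pi * \<phi> w"
proof -
  obtain R C where C: "C > 0" "\<And>z. cmod (\<phi> z) \<le> C * indicator (cball 0 R) z"
    using Cc_infinity_bounded[OF \<phi>] by metis
  have C': "cmod (\<phi> z) \<le> C" for z
    by (rule order_trans[OF C(2)]) (use C(1) in \<open>auto simp: indicator_def\<close>)
  have [measurable]: "\<phi> \<in> borel_measurable borel" by (rule Cc_infinity_measurable[OF \<phi>])
  have scale: "(\<integral>z. \<phi> z * complex_of_real (2 * e\<^sup>2 / ((cmod (z - w))\<^sup>2 + e\<^sup>2)\<^sup>2) \<partial>lborel)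
      = (\<integral>u. \<phi> (w + e *\<^sub>R u) * complex_of_real (bubble u) \<partial>lborel)" if "e > 0" for e
  proof -
    let ?f = "\<lambda>z. \<phi> z * complex_of_real (2 * e\<^sup>2 / ((cmod (z - w))\<^sup>2 + e\<^sup>2)\<^sup>2)"
    have "lborel = density (distr lborel borel (\<lambda>u. w + e *\<^sub>R u)) (\<lambda>_. ennreal (e\<^sup>2))"
      using lborel_affine[of e w] that by (simp add: ennreal_power)
    then have "(\<integral>z. ?f z \<partial>lborel) = (\<integral>z. ?f z \<partial>density (distr lborel borel (\<lambda>u. w + e *\<^sub>R u)) (\<lambda>_.
        ennreal (e\<^sup>2)))"
      by simp
    also have "\<dots> = (\<integral>u. e\<^sup>2 *\<^sub>R ?f (w + e *\<^sub>R u) \<partial>lborel)"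
      by (subst integral_density) (auto simp: integral_distr)
    also have "\<dots> = (\<integral>u. \<phi> (w + e *\<^sub>R u) * complex_of_real (bubble u) \<partial>lborel)"
    proof (rule Bochner_Integration.integral_cong[OF refl])
      fix u :: complex
      have pull: "r *\<^sub>R (x * complex_of_real k) = x * complex_of_real (r * k)" for r k x
        by (simp add: scaleR_conv_of_real)
      have "(cmod (e *\<^sub>R u))\<^sup>2 + e\<^sup>2 = e\<^sup>2 * ((cmod u)\<^sup>2 + 1)" by (simp add: power_mult_distrib
          algebra_simps)
      then have "e\<^sup>2 * (2 * e\<^sup>2 / ((cmod (e *\<^sub>R u))\<^sup>2 + e\<^sup>2)\<^sup>2) = e\<^sup>2 * (2 * e\<^sup>2 / (e\<^sup>2 * ((cmod
          u)\<^sup>2 + 1))\<^sup>2)"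
        by (simp only:)
      also have "\<dots> = bubble u"
        using that by (simp add: bubble_def power_mult_distrib power2_eq_square)
      finally have "complex_of_real (e\<^sup>2 * (2 * e\<^sup>2 / ((cmod (e *\<^sub>R u))\<^sup>2 + e\<^sup>2)\<^sup>2)) =
          complex_of_real (bubble u)"
        by (simp only:)
      then show "e\<^sup>2 *\<^sub>R ?f (w + e *\<^sub>R u) = \<phi> (w + e *\<^sub>R u) * complex_of_real (bubble u)"
        by (simp only: add_diff_cancel_left' pull)
    qed
    finally show ?thesis .
  qed
  have "(\<lambda>n. \<integral>u. \<phi> (w + (1 / Suc n) *\<^sub>R u) * complex_of_real (bubble u) \<partial>lborel)
      \<longlonglongrightarrow> (\<integral>u. \<phi> w * complex_of_real (bubble u) \<partial>lborel)"
  proof (rule integral_dominated_convergence[where w="\<lambda>u. C * bubble u"])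
    show "integrable lborel (\<lambda>u. C * bubble u)" by (intro integrable_mult_right bubble_integrable)
    show "AE u in lborel. (\<lambda>n. \<phi> (w + (1 / Suc n) *\<^sub>R u) * complex_of_real (bubble u)) \<longlonglongrightarrow> \<phi> w *
        complex_of_real (bubble u)"
    proof (intro AE_I2 tendsto_intros)
      fix u :: complex
      have "(\<lambda>n. w + (1 / real (Suc n)) *\<^sub>R u) \<longlonglongrightarrow> w + 0 *\<^sub>R u"
        by (intro tendsto_intros LIMSEQ_Suc[OF lim_1_over_n])
      moreover have "isCont \<phi> w"
        using Cc_infinity_continuous[OF \<phi>] by (simp add: continuous_on_eq_continuous_at)
      ultimately show "(\<lambda>n. \<phi> (w + (1 / real (Suc n)) *\<^sub>R u)) \<longlonglongrightarrow> \<phi> w"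
        using isCont_tendsto_compose[of w \<phi>] by simp
    qed
    show "AE u in lborel. norm (\<phi> (w + (1 / Suc n) *\<^sub>R u) * complex_of_real (bubble u)) \<le> C *
        bubble u" for n
      by (intro AE_I2) (auto simp: norm_mult bubble_nonneg intro!: mult_right_mono C')
  qed measurable
  moreover have "(\<integral>u. \<phi> w * complex_of_real (bubble u) \<partial>lborel) = 2 * of_real pi * \<phi> w"
    by (simp add: integral_bubble)
  moreover have "(\<integral>z. \<phi> z * complex_of_real (2 * (1 / Suc n)\<^sup>2 / ((cmod (z - w))\<^sup>2 + (1 / Suc
      n)\<^sup>2)\<^sup>2) \<partial>lborel)
      = (\<integral>u. \<phi> (w + (1 / Suc n) *\<^sub>R u) * complex_of_real (bubble u) \<partial>lborel)" for n
    by (rule scale) simp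
  ultimately show ?thesis by (simp only:)
qed

text \<open>Green's identity is applied to \<open>reg_log\<close> with regularisation (1/(n+1))^2.
  As n grows, the side with Delta phi converges by dominated convergence, the other one by
  \<open>integral_Cc_bubble_limit\<close>.\<close>

theorem laplacian_log_integral:
  assumes \<phi>: "\<phi> \<in> Cc_infinity"
  shows "integrable lborel (\<lambda>z. laplacian \<phi> z * complex_of_real (ln (cmod (z - w))))"
    and "(\<integral>z. laplacian \<phi> z * complex_of_real (ln (cmod (z - w))) \<partial>lborel) = 2 * of_real pi * \<phi> w"
proof -
  obtain R C where R: "R > 0" and C: "C > 0" "\<And>z. cmod (laplacian \<phi> z) \<le> C * indicator (cball 0 R)
      z"
    using Cc_infinity_bounded[OF Cc_infinity_laplacian[OF \<phi>]] by metis
  have [measurable]: "laplacian \<phi> \<in> borel_measurable borel"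
    by (rule Cc_infinity_measurable[OF Cc_infinity_laplacian[OF \<phi>]])
  let ?W = "\<lambda>z. C * (1 + 2 * (R + cmod w)) * indicator (cball 0 R) z + C * neglog_sq (z - w)"
  have W: "integrable lborel ?W"
    by (intro Bochner_Integration.integrable_add integrable_mult_right integrable_indicator_cball
        neglog_sq_shift_integrable)
  \<comment> \<open>The coefficient 2 leaves room for the regularisation: one |z - w| bounds the
    logarithm far away, the other comes from ln (s^2 + e^2) / 2 <= s.\<close>
  have dom: "norm (laplacian \<phi> z * complex_of_real x) \<le> ?W z"
    if "\<bar>x\<bar> \<le> 1 + neglog_sq (z - w) + 2 * cmod (z - w)" for z x
  proof (cases "z \<in> cball 0 R")
    case True
    have "cmod (z - w) \<le> R + cmod w" using True norm_triangle_ineq4[of z w] by simp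
    then have "\<bar>x\<bar> \<le> 1 + 2 * (R + cmod w) + neglog_sq (z - w)" using that by simp
    then have "cmod (laplacian \<phi> z) * \<bar>x\<bar> \<le> C * (1 + 2 * (R + cmod w) + neglog_sq (z - w))"
      using C(2)[of z] C(1) True by (intro mult_mono) auto
    then show ?thesis using True by (simp add: norm_mult algebra_simps)
  next
    case False
    then show ?thesis using C(2)[of z] C(1) by (simp add: norm_mult)
  qed
  have lim: "(\<lambda>n. reg_log w ((1 / Suc n)\<^sup>2) z) \<longlonglongrightarrow> complex_of_real (ln (cmod (z - w)))" if "z \<noteq> w"
      for z
  proof -
    have "(\<lambda>n. ln ((cmod (z - w))\<^sup>2 + (1 / Suc n)\<^sup>2) / 2) \<longlonglongrightarrow> ln ((cmod (z - w))\<^sup>2 + 0\<^sup>2) / 2"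
      using that by (intro tendsto_intros LIMSEQ_Suc[OF lim_1_over_n]) auto
    also have "ln ((cmod (z - w))\<^sup>2 + 0\<^sup>2) / 2 = ln (cmod (z - w))"
      using that by (simp add: ln_realpow)
    finally show ?thesis unfolding reg_log_def by (rule tendsto_of_real)
  qed
  have bound: "norm (laplacian \<phi> z * reg_log w ((1 / Suc n)\<^sup>2) z) \<le> ?W z" if "z \<noteq> w" for n z
  proof -
    define s e where "s = cmod (z - w)" and "e = 1 / real (Suc n)"
    have s: "s > 0" and e: "0 < e" "e \<le> 1" using that by (auto simp: s_def e_def)
    have "ln (s\<^sup>2) \<le> ln (s\<^sup>2 + e\<^sup>2)" using s e by (subst ln_le_cancel_iff) (auto intro:
        add_pos_nonneg)
    then have 1: "ln s \<le> ln (s\<^sup>2 + e\<^sup>2) / 2" using s by (simp add: ln_realpow)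
    have "e\<^sup>2 \<le> 1" using e by (simp add: power_le_one)
    then have "s\<^sup>2 + e\<^sup>2 \<le> (1 + s)\<^sup>2" using s by (simp add: power2_sum)
    then have "ln (s\<^sup>2 + e\<^sup>2) \<le> ln ((1 + s)\<^sup>2)" using s e by (subst ln_le_cancel_iff) (auto intro:
        add_pos_pos)
    also have "\<dots> = 2 * ln (1 + s)" using s by (simp add: ln_realpow)
    also have "ln (1 + s) \<le> s" using s by (intro ln_add_one_self_le_self) simp
    finally have "ln (s\<^sup>2 + e\<^sup>2) / 2 \<le> s" by simp
    with 1 have "\<bar>ln (s\<^sup>2 + e\<^sup>2) / 2\<bar> \<le> \<bar>ln s\<bar> + s" using s by linarith
    also have "\<dots> \<le> 1 + neglog_sq (z - w) + 2 * s" using abs_ln_cmod_le[of "z - w"] by (simp add: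
        s_def)
    finally show ?thesis unfolding reg_log_def by (intro dom) (simp add: s_def e_def)
  qed
  have ae: "AE z in lborel. z \<noteq> w" by (rule AE_lborel_singleton)
  have meas: "reg_log w e \<in> borel_measurable borel" for e
    unfolding reg_log_def by measurable
  show "integrable lborel (\<lambda>z. laplacian \<phi> z * complex_of_real (ln (cmod (z - w))))"
  proof (rule Bochner_Integration.integrable_bound[OF W])
    show "AE z in lborel. norm (laplacian \<phi> z * complex_of_real (ln (cmod (z - w)))) \<le> norm (?W z)"
    proof (intro AE_I2)
      fix z
      have "norm (laplacian \<phi> z * complex_of_real (ln (cmod (z - w)))) \<le> ?W z"
        using abs_ln_cmod_le[of "z - w"] norm_ge_zero[of "z - w"] by (intro dom) linarith
      then show "norm (laplacian \<phi> z * complex_of_real (ln (cmod (z - w)))) \<le> norm (?W z)"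
        by simp
    qed
  qed simp
  have L: "(\<lambda>n. \<integral>z. laplacian \<phi> z * reg_log w ((1 / Suc n)\<^sup>2) z \<partial>lborel)
      \<longlonglongrightarrow> (\<integral>z. laplacian \<phi> z * complex_of_real (ln (cmod (z - w))) \<partial>lborel)"
  proof (rule integral_dominated_convergence[OF _ _ W])
    show "AE z in lborel. (\<lambda>n. laplacian \<phi> z * reg_log w ((1 / Suc n)\<^sup>2) z) \<longlonglongrightarrow> laplacian \<phi> z *
        complex_of_real (ln (cmod (z - w)))"
      using ae by eventually_elim (intro tendsto_intros lim)
    show "AE z in lborel. norm (laplacian \<phi> z * reg_log w ((1 / Suc n)\<^sup>2) z) \<le> ?W z" for n
      using ae by eventually_elim (rule bound)
    show "(\<lambda>z. laplacian \<phi> z * reg_log w ((1 / Suc n)\<^sup>2) z) \<in> borel_measurable lborel" for n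
      using meas by simp
  qed simp
  have E: "(\<integral>z. laplacian \<phi> z * reg_log w ((1 / Suc n)\<^sup>2) z \<partial>lborel)
     = (\<integral>z. \<phi> z * complex_of_real (2 * (1 / Suc n)\<^sup>2 / ((cmod (z - w))\<^sup>2 + (1 / Suc n)\<^sup>2)\<^sup>2)
         \<partial>lborel)" for n
    by (subst green_identity[OF \<phi> reg_log_Ck_2(1)]) (simp_all add: reg_log_Ck_2(3) del: of_nat_Suc)
  from L[unfolded E] integral_Cc_bubble_limit[OF \<phi>, of w]
  show "(\<integral>z. laplacian \<phi> z * complex_of_real (ln (cmod (z - w))) \<partial>lborel) = 2 * of_real pi * \<phi> w"
    by (rule LIMSEQ_unique)
qed

section \<open>Logarithmic potentials\<close>

lemma cball_measurable [measurable]: "cball (a :: complex) r \<in> sets borel"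
  by (intro borel_closed closed_cball)

text \<open>Second countability: the complement of the support is covered by countably many basic
  open sets of measure zero.\<close>

lemma AE_msupport:
  assumes "\<mu> \<in> borel_prob_measures"
  shows "AE w in \<mu>. w \<in> msupport \<mu>"
proof -
  have sets: "sets \<mu> = sets borel" using assms by (simp add: borel_prob_measures_def)
  obtain B :: "complex set set" where B: "countable B" "topological_basis B"
    using ex_countable_basis by blast
  let ?N = "{b \<in> B. emeasure \<mu> b = 0}"
  have "b \<in> sets \<mu>" if "b \<in> B" for b
    using topological_basis_open[OF B(2) that] by (simp add: sets)
  then have "(\<Union>b\<in>?N. b) \<in> null_sets \<mu>"
    using B(1) by (intro null_sets_UN') (auto intro: null_setsI)
  moreover have "{w \<in> space \<mu>. w \<notin> msupport \<mu>} \<subseteq> (\<Union>b\<in>?N. b)"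
  proof
    fix w assume "w \<in> {w \<in> space \<mu>. w \<notin> msupport \<mu>}"
    then obtain U where U: "open U" "w \<in> U" "emeasure \<mu> U = 0"
      by (auto simp: msupport_def)
    then obtain b where b: "b \<in> B" "w \<in> b" "b \<subseteq> U"
      using topological_basisE[OF B(2)] by metis
    have "emeasure \<mu> b \<le> emeasure \<mu> U"
      using b U by (intro emeasure_mono) (auto simp: sets)
    then show "w \<in> (\<Union>b\<in>?N. b)" using b U(3) by auto
  qed
  ultimately show ?thesis by (intro AE_I') auto
qed

text \<open>Compactness of the support enters as an almost sure bound, which may be enlarged so that
  one \<open>K\<close> serves both measures.\<close>

locale bounded_prob = prob_space \<mu> for \<mu> :: "complex measure" +
  fixes K :: real
  assumes sets_eq [measurable_cong]: "sets \<mu> = sets borel"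
    and K_nonneg: "K \<ge> 0"
    and AE_bound: "AE w in \<mu>. cmod w \<le> K"

lemma compact_prob_measures_bounded:
  assumes "\<mu> \<in> compact_prob_measures"
  obtains K where "bounded_prob \<mu> K"
proof -
  have \<mu>: "\<mu> \<in> borel_prob_measures" using assms by (simp add: compact_prob_measures_def)
  have "bounded (msupport \<mu>)"
    using assms by (auto simp: compact_prob_measures_def intro: compact_imp_bounded)
  then obtain K where K: "K > 0" "\<And>w. w \<in> msupport \<mu> \<Longrightarrow> norm w \<le> K"
    by (meson bounded_pos)
  have "AE w in \<mu>. cmod w \<le> K"
    using AE_msupport[OF \<mu>] by eventually_elim (rule K)
  then have "bounded_prob \<mu> K"
    using \<mu> K(1) by (auto simp: bounded_prob_def bounded_prob_axioms_def borel_prob_measures_def)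
  then show ?thesis by (rule that)
qed

text \<open>The library value \<open>ln 0 = 0\<close> and the value \<open>0\<close> of divergent integrals make \<open>log_pot\<close>
  meaningful only at points that are \<open>tame\<close> in the sense below, which are almost all points.\<close>

definition log_pot :: "complex measure \<Rightarrow> complex \<Rightarrow> real" where
  "log_pot \<mu> z = (\<integral>w. ln (cmod (z - w)) \<partial>\<mu>)"

text \<open>The first condition controls the size of \<open>log_pot\<close>, the second provides the
  finite variance for the limit theorems, and the third rules out an atom at z, where
  \<open>ln 0 = 0\<close> would falsify the potential.\<close>

definition tame :: "complex measure \<Rightarrow> complex \<Rightarrow> bool" where
  "tame \<mu> z \<longleftrightarrow> integrable \<mu> (\<lambda>w. neglog_sq (z - w)) \<and> integrable \<mu> (\<lambda>w. (ln (cmod (z - w)))\<^sup>2) \<and>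
      (AE w in \<mu>. w \<noteq> z)"

lemma ln_cmod_sq_le: "(ln (cmod z))\<^sup>2 \<le> neglog_sq z + (cmod z)\<^sup>2"
proof (cases "cmod z \<le> 1")
  case True
  then have "ln (cmod z) \<le> 0" by (cases "z = 0") (simp, subst ln_le_zero_iff, auto)
  then show ?thesis by (simp add: neglog_sq_def min_absorb2)
next
  case False
  then have "0 \<le> ln (cmod z)" "ln (cmod z) \<le> cmod z"
    using ln_le_minus_one[of "cmod z"] by (simp, linarith)
  then have "(ln (cmod z))\<^sup>2 \<le> (cmod z)\<^sup>2" by (intro power_mono)
  then show ?thesis by (simp add: add_increasing)
qed

context bounded_prob
begin

lemma AE_dist_le: "AE w in \<mu>. cmod (z - w) \<le> cmod z + K"
  using AE_bound by eventually_elim (metis add_left_mono norm_triangle_ineq4 order_trans)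

text \<open>By Tonelli: the integral of \<open>neglog_sq (z - w)\<close> over z is the same finite
  number for every w, so the integral over w is finite for almost every z. Exchanging quantifiers in
  "w differs from almost every z" shows that almost no z is an atom.\<close>

lemma AE_lborel_tame: "AE z in lborel. tame \<mu> z"
proof -
  interpret P: pair_sigma_finite lborel \<mu> ..
  have m: "(\<lambda>p. ennreal (neglog_sq (fst p - snd p))) \<in> borel_measurable (lborel \<Otimes>\<^sub>M \<mu>)"
    by measurable
  have "(\<integral>\<^sup>+z. \<integral>\<^sup>+w. ennreal (neglog_sq (z - w)) \<partial>\<mu> \<partial>lborel) = (\<integral>\<^sup>+w. \<integral>\<^sup>+z. ennreal (neglog_sq (z
      - w)) \<partial>lborel \<partial>\<mu>)"
    using P.Fubini'[of "\<lambda>z w. ennreal (neglog_sq (z - w))"] by simp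
  also have "\<dots> < \<infinity>"
    by (simp add: nn_integral_neglog_sq_shift emeasure_space_1)
  finally have "AE z in lborel. (\<integral>\<^sup>+w. ennreal (neglog_sq (z - w)) \<partial>\<mu>) \<noteq> \<infinity>"
    by (intro nn_integral_PInf_AE) auto
  moreover have "AE z in lborel. AE w in \<mu>. w \<noteq> z"
  proof -
    have "AE z in lborel. w \<noteq> z" for w :: complex
      using AE_lborel_singleton[of w] by eventually_elim auto
    then have "AE w in \<mu>. AE z in lborel. w \<noteq> z"
      by simp
    moreover have "{p \<in> space (lborel \<Otimes>\<^sub>M \<mu>). snd p \<noteq> fst p} \<in> sets (lborel \<Otimes>\<^sub>M \<mu>)"
    proof -
      have "(\<lambda>p. snd p - fst p) \<in> borel_measurable (lborel \<Otimes>\<^sub>M \<mu>)"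
        by measurable
      from measurable_sets[OF this, of "- {0}"] show ?thesis
        by (simp add: vimage_def Int_def conj_commute)
    qed
    ultimately show ?thesis by (simp only: P.AE_commute)
  qed
  ultimately show ?thesis
  proof eventually_elim
    case (elim z)
    have 1: "integrable \<mu> (\<lambda>w. neglog_sq (z - w))"
      using elim(1) by (intro integrableI_nonneg) (auto simp: less_top)
    have "AE w in \<mu>. norm ((ln (cmod (z - w)))\<^sup>2) \<le> norm (neglog_sq (z - w) + (cmod z + K)\<^sup>2)"
      using AE_dist_le[of z]
    proof eventually_elim
      case (elim w)
      then have "(cmod (z - w))\<^sup>2 \<le> (cmod z + K)\<^sup>2" by (intro power_mono) auto
      then show ?case using ln_cmod_sq_le[of "z - w"] by simp
    qed
    moreover have "integrable \<mu> (\<lambda>w. neglog_sq (z - w) + (cmod z + K)\<^sup>2)"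
      using 1 by simp
    moreover have "(\<lambda>w. (ln (cmod (z - w)))\<^sup>2) \<in> borel_measurable \<mu>"
      by measurable
    ultimately have "integrable \<mu> (\<lambda>w. (ln (cmod (z - w)))\<^sup>2)"
      using Bochner_Integration.integrable_bound by blast
    then show ?case using 1 elim(2) by (simp add: tame_def)
  qed
qed

lemma tame_integrable_ln: "tame \<mu> z \<Longrightarrow> integrable \<mu> (\<lambda>w. ln (cmod (z - w)))"
  by (rule square_integrable_imp_integrable) (auto simp: tame_def)

lemma log_potential_eq:
  assumes "tame \<mu> z"
  shows "log_potential \<mu> z = ereal (log_pot \<mu> z)"
proof -
  let ?f = "\<lambda>w. ln (cmod (z - w))"
  have int: "integrable \<mu> ?f" by (rule tame_integrable_ln[OF assms])
  have ae: "AE w in \<mu>. w \<noteq> z" using assms by (simp add: tame_def)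
  have "(\<integral>\<^sup>+w. e2ennreal (elog (cmod (z - w))) \<partial>\<mu>) = (\<integral>\<^sup>+w. ennreal (?f w) \<partial>\<mu>)"
    by (intro nn_integral_cong_AE, use ae in eventually_elim) (auto simp: elog_def e2ennreal_ereal)
  moreover have "(\<integral>\<^sup>+w. e2ennreal (- elog (cmod (z - w))) \<partial>\<mu>) = (\<integral>\<^sup>+w. ennreal (- ?f w) \<partial>\<mu>)"
    by (intro nn_integral_cong_AE, use ae in eventually_elim) (auto simp: elog_def e2ennreal_ereal)
  moreover have fin: "(\<integral>\<^sup>+w. ennreal (?f w) \<partial>\<mu>) < \<top>" "(\<integral>\<^sup>+w. ennreal (- ?f w) \<partial>\<mu>) < \<top>"
    using int by (auto simp: real_integrable_def less_top)
  have "enn2ereal x = ereal (enn2real x)" if "x < \<top>" for x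
    using that by (metis ennreal_enn2real enn2ereal_ennreal enn2real_nonneg)
  ultimately show ?thesis
    unfolding log_potential_def log_pot_def real_lebesgue_integral_def[OF int]
    using fin by simp
qed

lemma log_pot_measurable [measurable]: "log_pot \<mu> \<in> borel_measurable borel"
  unfolding log_pot_def by measurable

lemma log_pot_sq_le:
  assumes "tame \<mu> z"
  shows "(log_pot \<mu> z)\<^sup>2 \<le> (\<integral>w. neglog_sq (z - w) \<partial>\<mu>) + (cmod z + K)\<^sup>2"
proof -
  let ?f = "\<lambda>w. ln (cmod (z - w))"
  have i: "integrable \<mu> (\<lambda>w. neglog_sq (z - w))" "integrable \<mu> (\<lambda>w. (?f w)\<^sup>2)" "integrable \<mu> ?f"
    using assms tame_integrable_ln by (auto simp: tame_def)
  \<comment> \<open>Jensen's inequality for the square, in the form variance >= 0.\<close>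
  have "(log_pot \<mu> z)\<^sup>2 \<le> (\<integral>w. (?f w)\<^sup>2 \<partial>\<mu>)"
    using variance_positive[of ?f] variance_eq[OF i(3,2)] by (simp add: log_pot_def)
  also have "\<dots> \<le> (\<integral>w. neglog_sq (z - w) + (cmod z + K)\<^sup>2 \<partial>\<mu>)"
  proof (rule integral_mono_AE)
    show "AE w in \<mu>. (?f w)\<^sup>2 \<le> neglog_sq (z - w) + (cmod z + K)\<^sup>2"
      using AE_dist_le[of z]
    proof eventually_elim
      case (elim w)
      then have "(cmod (z - w))\<^sup>2 \<le> (cmod z + K)\<^sup>2" by (intro power_mono) auto
      then show ?case using ln_cmod_sq_le[of "z - w"] by simp
    qed
  qed (use i in auto)
  also have "\<dots> = (\<integral>w. neglog_sq (z - w) \<partial>\<mu>) + (cmod z + K)\<^sup>2"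
    using i(1) by (simp add: prob_space)
  finally show ?thesis .
qed

text \<open>After \<open>log_pot_sq_le\<close>, the singular term is integrable over the whole plane
  by Tonelli, and the remaining constant is integrated over a ball of finite area.\<close>

lemma log_pot_sq_integrable:
  "integrable lborel (\<lambda>z. indicator (cball 0 R) z * (log_pot \<mu> z)\<^sup>2)"
proof (rule integrableI_bounded)
  interpret P: pair_sigma_finite lborel \<mu> ..
  have le: "AE z in lborel. ennreal (norm (indicator (cball 0 R) z * (log_pot \<mu> z)\<^sup>2))
      \<le> (\<integral>\<^sup>+w. ennreal (neglog_sq (z - w)) \<partial>\<mu>) + ennreal ((R + K)\<^sup>2) * indicator (cball 0 R) z"
    using AE_lborel_tame
  proof eventually_elim
    case (elim z)
    show ?case
    proof (cases "z \<in> cball 0 R")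
      case True
      have "(log_pot \<mu> z)\<^sup>2 \<le> (\<integral>w. neglog_sq (z - w) \<partial>\<mu>) + (cmod z + K)\<^sup>2"
        by (rule log_pot_sq_le[OF elim])
      also have "\<dots> \<le> (\<integral>w. neglog_sq (z - w) \<partial>\<mu>) + (R + K)\<^sup>2"
        using True K_nonneg by (intro add_left_mono power_mono) auto
      finally have "ennreal ((log_pot \<mu> z)\<^sup>2) \<le> ennreal ((\<integral>w. neglog_sq (z - w) \<partial>\<mu>) + (R + K)\<^sup>2)"
        by (rule ennreal_leI)
      also have "\<dots> = ennreal (\<integral>w. neglog_sq (z - w) \<partial>\<mu>) + ennreal ((R + K)\<^sup>2)"
        by (intro ennreal_plus integral_nonneg_AE) auto
      also have "ennreal (\<integral>w. neglog_sq (z - w) \<partial>\<mu>) = (\<integral>\<^sup>+w. ennreal (neglog_sq (z - w)) \<partial>\<mu>)"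
        using elim by (subst nn_integral_eq_integral) (auto simp: tame_def)
      finally show ?thesis using True by simp
    qed simp
  qed
  have "(\<integral>\<^sup>+z. ennreal (norm (indicator (cball 0 R) z * (log_pot \<mu> z)\<^sup>2)) \<partial>lborel)
      \<le> (\<integral>\<^sup>+z. (\<integral>\<^sup>+w. ennreal (neglog_sq (z - w)) \<partial>\<mu>) + ennreal ((R + K)\<^sup>2) * indicator (cball 0
          R) z \<partial>lborel)"
    by (rule nn_integral_mono_AE[OF le])
  also have "\<dots> = (\<integral>\<^sup>+z. (\<integral>\<^sup>+w. ennreal (neglog_sq (z - w)) \<partial>\<mu>) \<partial>lborel) + ennreal ((R + K)\<^sup>2) *
      emeasure lborel (cball (0::complex) R)"
    by (subst nn_integral_add) (auto simp: nn_integral_cmult_indicator)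
  also have "(\<integral>\<^sup>+z. \<integral>\<^sup>+w. ennreal (neglog_sq (z - w)) \<partial>\<mu> \<partial>lborel) = (\<integral>\<^sup>+w. \<integral>\<^sup>+z. ennreal
      (neglog_sq (z - w)) \<partial>lborel \<partial>\<mu>)"
    using P.Fubini'[of "\<lambda>z w. ennreal (neglog_sq (z - w))"] by simp
  also have "\<dots> + ennreal ((R + K)\<^sup>2) * emeasure lborel (cball (0::complex) R) < \<infinity>"
    using emeasure_bounded_finite[of "cball (0::complex) R"]
    by (simp add: nn_integral_neglog_sq_shift emeasure_space_1 ennreal_mult_less_top less_top)
  finally show "(\<integral>\<^sup>+z. ennreal (norm (indicator (cball 0 R) z * (log_pot \<mu> z)\<^sup>2)) \<partial>lborel) < \<infinity>" .
qed measurable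

lemma log_pot_locally_integrable:
  "integrable lborel (\<lambda>z. indicator (cball 0 R) z * log_pot \<mu> z)"
proof (rule Bochner_Integration.integrable_bound)
  show "integrable lborel (\<lambda>z. indicator (cball 0 R) z + indicator (cball 0 R) z * (log_pot \<mu> z)\<^sup>2)"
    by (intro Bochner_Integration.integrable_add integrable_indicator_cball log_pot_sq_integrable)
  have "\<bar>x\<bar> \<le> 1 + x\<^sup>2" for x :: real
    using zero_le_power2[of "\<bar>x\<bar> - 1"]
    by (auto simp: power2_eq_square algebra_simps abs_if split: if_splits)
  then show "AE z in lborel. norm (indicator (cball 0 R) z * log_pot \<mu> z)
      \<le> norm (indicator (cball 0 R) z + indicator (cball 0 R) z * (log_pot \<mu> z)\<^sup>2)"
    by (intro AE_I2) (simp add: indicator_def)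
qed simp

text \<open>Almost every w lies at a distance between |z| - K and |z| + K from z. Any two such
  potentials are therefore close near infinity, which later prevents loss of mass.\<close>

lemma log_pot_bounds:
  assumes "cmod z > K"
  shows "ln (cmod z - K) \<le> log_pot \<mu> z" "log_pot \<mu> z \<le> ln (cmod z + K)"
proof -
  have b: "AE w in \<mu>. ln (cmod z - K) \<le> ln (cmod (z - w)) \<and> ln (cmod (z - w)) \<le> ln (cmod z + K)"
    using AE_bound
  proof eventually_elim
    case (elim w)
    have "cmod z - K \<le> cmod (z - w)" using norm_triangle_ineq2[of z w] elim by linarith
    moreover have "cmod (z - w) \<le> cmod z + K" using norm_triangle_ineq4[of z w] elim by linarith
    ultimately show ?case using assms by (intro conjI ln_mono) auto
  qed
  from b have "AE w in \<mu>. norm (ln (cmod (z - w))) \<le> max \<bar>ln (cmod z - K)\<bar> \<bar>ln (cmod z + K)\<bar>"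
    by eventually_elim (unfold real_norm_def, linarith)
  then have i: "integrable \<mu> (\<lambda>w. ln (cmod (z - w)))"
    by (rule integrable_const_bound) measurable
  show "ln (cmod z - K) \<le> log_pot \<mu> z" "log_pot \<mu> z \<le> ln (cmod z + K)"
    unfolding log_pot_def using b
    by (auto intro!: integral_ge_const integral_le_const i elim!: eventually_mono)
qed

text \<open>Fubini applied to \<open>laplacian_log_integral\<close>. The integral of the majorant
  \<open>?W w\<close> does not depend on w, so the inner integrals are bounded uniformly.\<close>

lemma laplacian_log_pot_integral:
  assumes \<phi>: "\<phi> \<in> Cc_infinity"
  shows "(\<integral>z. laplacian \<phi> z * complex_of_real (log_pot \<mu> z) \<partial>lborel) = 2 * of_real pi * (\<integral>w. \<phi> w
      \<partial>\<mu>)"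
proof -
  interpret P: pair_sigma_finite \<mu> lborel ..
  obtain R C where R: "R > 0" and C: "C > 0" "\<And>z. cmod (laplacian \<phi> z) \<le> C * indicator (cball 0 R)
      z"
    using Cc_infinity_bounded[OF Cc_infinity_laplacian[OF \<phi>]] by metis
  have [measurable]: "laplacian \<phi> \<in> borel_measurable borel"
    by (rule Cc_infinity_measurable[OF Cc_infinity_laplacian[OF \<phi>]])
  let ?f = "\<lambda>w z. laplacian \<phi> z * complex_of_real (ln (cmod (z - w)))"
  let ?W = "\<lambda>w z. C * (1 + R + K) * indicator (cball 0 R) z + C * neglog_sq (z - w)"
  have dom: "cmod (?f w z) \<le> ?W w z" if "cmod w \<le> K" for w z
  proof (cases "z \<in> cball 0 R")
    case True
    have "cmod (z - w) \<le> R + K" using True that norm_triangle_ineq4[of z w] by simp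
    then have "\<bar>ln (cmod (z - w))\<bar> \<le> 1 + R + K + neglog_sq (z - w)"
      using abs_ln_cmod_le[of "z - w"] by linarith
    then have "cmod (laplacian \<phi> z) * \<bar>ln (cmod (z - w))\<bar> \<le> C * (1 + R + K + neglog_sq (z - w))"
      using C(2)[of z] C(1) True by (intro mult_mono) auto
    then show ?thesis using True by (simp add: norm_mult algebra_simps)
  next
    case False
    then show ?thesis using C(2)[of z] C(1) by (simp add: norm_mult)
  qed
  have W: "integrable lborel (?W w)" for w
    by (intro Bochner_Integration.integrable_add integrable_mult_right integrable_indicator_cball
        neglog_sq_shift_integrable)
  have aux: "(\<integral>z. ?W w z \<partial>lborel) = (\<integral>z. C * (1 + R + K) * indicator (cball (0::complex) R) z
      \<partial>lborel) + C * (\<integral>z. neglog_sq z \<partial>lborel)" for w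
    by (subst Bochner_Integration.integral_add)
      (auto intro!: integrable_mult_right integrable_indicator_cball neglog_sq_shift_integrable
          simp: neglog_sq_shift_integrable(2))
  have IW: "(\<integral>z. ?W w z \<partial>lborel) = (\<integral>z. ?W 0 z \<partial>lborel)" for w
    by (rule trans[OF aux aux[symmetric]])
  have fi: "integrable lborel (?f w)" for w by (rule laplacian_log_integral(1)[OF \<phi>])
  have "integrable (\<mu> \<Otimes>\<^sub>M lborel) (\<lambda>(w, z). ?f w z)"
  proof (rule P.Fubini_integrable)
    show "(\<lambda>(w, z). ?f w z) \<in> borel_measurable (\<mu> \<Otimes>\<^sub>M lborel)" by measurable
    show "AE x in \<mu>. integrable lborel (\<lambda>y. (\<lambda>(w, z). ?f w z) (x, y))" using fi by simp
    have "AE w in \<mu>. norm (\<integral>z. norm (?f w z) \<partial>lborel) \<le> (\<integral>z. ?W 0 z \<partial>lborel)"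
      using AE_bound
    proof eventually_elim
      case (elim w)
      have "(\<integral>z. norm (?f w z) \<partial>lborel) \<le> (\<integral>z. ?W w z \<partial>lborel)"
      proof (rule integral_mono)
        show "integrable lborel (\<lambda>z. norm (?f w z))" by (rule integrable_norm[OF fi])
        show "integrable lborel (?W w)" by (rule W)
        show "norm (?f w z) \<le> ?W w z" for z by (rule dom[OF elim])
      qed
      moreover have "0 \<le> (\<integral>z. norm (?f w z) \<partial>lborel)" by (rule integral_nonneg_AE) simp
      ultimately have "\<bar>\<integral>z. norm (?f w z) \<partial>lborel\<bar> \<le> (\<integral>z. ?W w z \<partial>lborel)" by linarith
      then show ?case unfolding IW[of w] real_norm_def .
    qed
    moreover have "(\<lambda>w. \<integral>z. norm (?f w z) \<partial>lborel) \<in> borel_measurable \<mu>"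
      by measurable
    ultimately have "integrable \<mu> (\<lambda>w. \<integral>z. norm (?f w z) \<partial>lborel)"
      by (rule integrable_const_bound)
    then show "integrable \<mu> (\<lambda>x. \<integral>y. norm ((\<lambda>(w, z). ?f w z) (x, y)) \<partial>lborel)"
      by simp
  qed
  from P.Fubini_integral[OF this]
  have "(\<integral>z. \<integral>w. ?f w z \<partial>\<mu> \<partial>lborel) = (\<integral>w. \<integral>z. ?f w z \<partial>lborel \<partial>\<mu>)" .
  then show ?thesis by (simp add: log_pot_def laplacian_log_integral(2)[OF \<phi>])
qed

end

section \<open>Law of large numbers and anticoncentration\<close>

context prob_space
begin

lemma indep_sum_second_moment:
  fixes W :: "nat \<Rightarrow> 'a \<Rightarrow> real"
  assumes indep: "indep_vars (\<lambda>_. borel) W UNIV"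
    and sq: "\<And>i. integrable M (\<lambda>\<omega>. (W i \<omega>)\<^sup>2)"
    and mean: "\<And>i. expectation (W i) = 0" and var: "\<And>i. expectation (\<lambda>\<omega>. (W i \<omega>)\<^sup>2) = s"
  shows "integrable M (\<lambda>\<omega>. (\<Sum>i<n. W i \<omega>)\<^sup>2) \<and> expectation (\<lambda>\<omega>. (\<Sum>i<n. W i \<omega>)\<^sup>2) = n * s"
proof (induction n)
  case (Suc n)
  let ?S = "\<lambda>\<omega>. \<Sum>i<n. W i \<omega>"
  have rv [measurable]: "W i \<in> borel_measurable M" for i
    using indep by (auto simp: indep_vars_def)
  have int: "integrable M (W i)" for i
    by (rule square_integrable_imp_integrable[OF rv sq])
  have intS: "integrable M ?S" by (intro Bochner_Integration.integrable_sum int)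
  have iv: "indep_var borel (W n) borel ?S"
    by (rule indep_vars_sum) (auto intro: indep_vars_subset[OF indep])
  have prod: "integrable M (\<lambda>\<omega>. W n \<omega> * ?S \<omega>)" "expectation (\<lambda>\<omega>. W n \<omega> * ?S \<omega>) = 0"
    using indep_var_integrable[OF iv int intS] indep_var_lebesgue_integral[OF iv int intS] mean by
        auto
  have "(\<Sum>i<Suc n. W i \<omega>)\<^sup>2 = (?S \<omega>)\<^sup>2 + 2 * (W n \<omega> * ?S \<omega>) + (W n \<omega>)\<^sup>2" for \<omega>
    by (simp add: power2_sum algebra_simps)
  then show ?case
    using Suc prod sq[of n] var[of n] by (simp add: algebra_simps)
qed (simp add: prob_space)

text \<open>Chebyshev's inequality: the centred sum has second moment n t, to be compared with (n
  \<epsilon>)^2.\<close>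

lemma weak_law_of_large_numbers:
  fixes W :: "nat \<Rightarrow> 'a \<Rightarrow> real"
  assumes indep: "indep_vars (\<lambda>_. borel) W UNIV"
    and sq: "\<And>i. integrable M (\<lambda>\<omega>. (W i \<omega>)\<^sup>2)"
    and mean: "\<And>i. expectation (W i) = m" and second: "\<And>i. expectation (\<lambda>\<omega>. (W i \<omega>)\<^sup>2) = s"
    and "\<epsilon> > 0"
  shows "(\<lambda>n. prob {\<omega> \<in> space M. \<bar>(\<Sum>i<n. W i \<omega>) / n - m\<bar> > \<epsilon>}) \<longlonglongrightarrow> 0"
proof -
  have rv [measurable]: "W i \<in> borel_measurable M" for i
    using indep by (auto simp: indep_vars_def)
  have int: "integrable M (W i)" for i
    by (rule square_integrable_imp_integrable[OF rv sq])
  define V where "V i \<omega> = W i \<omega> - m" for i \<omega>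
  have [measurable]: "V i \<in> borel_measurable M" for i unfolding V_def by measurable
  have Vi: "indep_vars (\<lambda>_. borel) V UNIV"
    unfolding V_def by (rule indep_vars_compose2[OF indep]) auto
  have V0: "expectation (V i) = 0" for i
    unfolding V_def using int mean by (simp add: prob_space)
  have exp: "(V i \<omega>)\<^sup>2 = (W i \<omega>)\<^sup>2 - 2 * m * W i \<omega> + m\<^sup>2" for i \<omega>
    by (simp add: V_def power2_diff algebra_simps)
  have V2: "integrable M (\<lambda>\<omega>. (V i \<omega>)\<^sup>2)" "expectation (\<lambda>\<omega>. (V i \<omega>)\<^sup>2) = s - 2 * m * m + m\<^sup>2" for i
    unfolding exp using int sq mean second by (simp_all add: prob_space)
  define t where "t = s - 2 * m * m + m\<^sup>2"
  have S: "integrable M (\<lambda>\<omega>. (\<Sum>i<n. V i \<omega>)\<^sup>2)" "expectation (\<lambda>\<omega>. (\<Sum>i<n. V i \<omega>)\<^sup>2) = n * t" for n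
    using indep_sum_second_moment[OF Vi V2(1) V0 V2(2)] by (auto simp: t_def)
  have VI: "integrable M (V i)" for i unfolding V_def using int by simp
  have ES: "expectation (\<lambda>\<omega>. \<Sum>i<n. V i \<omega>) = 0" for n
    using VI V0 by simp
  have bound: "prob {\<omega> \<in> space M. \<bar>(\<Sum>i<n. W i \<omega>) / n - m\<bar> > \<epsilon>} \<le> t / \<epsilon>\<^sup>2 * inverse n" if "n > 0"
      for n
  proof -
    have eq: "(\<Sum>i<n. W i \<omega>) / n - m = (\<Sum>i<n. V i \<omega>) / n" for \<omega>
      using that by (simp add: V_def sum_subtractf field_simps)
    have "prob {\<omega> \<in> space M. \<bar>(\<Sum>i<n. W i \<omega>) / n - m\<bar> > \<epsilon>} \<le> prob {\<omega> \<in> space M. \<bar>(\<Sum>i<n. V i \<omega>) -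
        expectation (\<lambda>\<omega>. \<Sum>i<n. V i \<omega>)\<bar> \<ge> n * \<epsilon>}"
      unfolding eq ES using that
      by (intro finite_measure_mono) (auto simp: abs_divide pos_less_divide_eq mult.commute)
    also have "\<dots> \<le> variance (\<lambda>\<omega>. \<Sum>i<n. V i \<omega>) / (n * \<epsilon>)\<^sup>2"
      using that \<open>\<epsilon> > 0\<close> by (intro Chebyshev_inequality S) auto
    also have "\<dots> = n * t / (n * \<epsilon>)\<^sup>2"
      unfolding ES using S(2) by simp
    also have "\<dots> = t / \<epsilon>\<^sup>2 * inverse n"
      using that \<open>\<epsilon> > 0\<close> by (simp add: field_simps power2_eq_square)
    finally show ?thesis .
  qed
  have "(\<lambda>n. t / \<epsilon>\<^sup>2 * inverse (real n)) \<longlonglongrightarrow> t / \<epsilon>\<^sup>2 * 0"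
    by (intro tendsto_intros lim_inverse_n)
  then have lim: "(\<lambda>n. t / \<epsilon>\<^sup>2 * inverse (real n)) \<longlonglongrightarrow> 0" by simp
  have "\<forall>\<^sub>F n in sequentially. prob {\<omega> \<in> space M. \<bar>(\<Sum>i<n. W i \<omega>) / n - m\<bar> > \<epsilon>} \<le> t / \<epsilon>\<^sup>2 * inverse
      (real n)"
    using eventually_gt_at_top[of 0] by eventually_elim (rule bound)
  then show ?thesis
    by (intro tendsto_sandwich[OF _ _ tendsto_const lim]) auto
qed

end

lemma std_normal_interval_le:
  assumes "d > 0"
  shows "measure std_normal_distribution {-d<..d} \<le> 2 * d"
proof -
  interpret N: real_distribution std_normal_distribution by (rule real_dist_normal_dist)
  have "emeasure std_normal_distribution {-d<..d} = (\<integral>\<^sup>+x\<in>{-d<..d}. ennreal (std_normal_density x)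
      \<partial>lborel)"
    by (subst emeasure_density) auto
  also have "\<dots> \<le> (\<integral>\<^sup>+x\<in>{-d<..d}. 1 \<partial>lborel)"
  proof (intro nn_integral_mono mult_right_mono)
    fix x :: real
    have "exp (- x\<^sup>2 / 2) / sqrt (2 * pi) \<le> 1 / 1"
    proof (rule frac_le)
      have "1 \<le> 2 * pi" using pi_gt3 by simp
      then show "1 \<le> sqrt (2 * pi)" by simp
    qed auto
    then show "ennreal (std_normal_density x) \<le> 1"
      by (simp add: std_normal_density_def)
  qed auto
  also have "\<dots> = ennreal (2 * d)" using assms by simp
  finally have "emeasure std_normal_distribution {-d<..d} \<le> ennreal (2 * d)" .
  then show ?thesis
    using assms by (simp add: N.emeasure_eq_measure)
qed

context prob_space
begin

text \<open>If the mean is nonzero, the sum grows linearly by the law of large numbers. If it is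
  zero, division by sqrt n times the standard deviation shrinks [-1, 1] into (-d, d], whose limiting
  normal probability is at most 2 d.\<close>

lemma iid_sum_anticoncentration:
  fixes W :: "nat \<Rightarrow> 'a \<Rightarrow> real"
  assumes indep: "indep_vars (\<lambda>_. borel) W UNIV"
    and distr: "\<And>i. distr M borel (W i) = D"
    and sq: "integrable M (\<lambda>\<omega>. (W 0 \<omega>)\<^sup>2)"
    and var: "variance (W 0) > 0"
  shows "(\<lambda>n. prob {\<omega> \<in> space M. \<bar>\<Sum>i<n. W i \<omega>\<bar> \<le> 1}) \<longlonglongrightarrow> 0"
proof -
  have rv [measurable]: "W i \<in> borel_measurable M" for i
    using indep by (auto simp: indep_vars_def)
  have transfer: "expectation (\<lambda>\<omega>. h (W i \<omega>)) = expectation (\<lambda>\<omega>. h (W 0 \<omega>))"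
    "integrable M (\<lambda>\<omega>. h (W i \<omega>)) \<longleftrightarrow> integrable M (\<lambda>\<omega>. h (W 0 \<omega>))"
    if [measurable]: "h \<in> borel_measurable borel" for h :: "real \<Rightarrow> real" and i
  proof -
    have "(\<integral>x. h x \<partial>distr M borel (W i)) = (\<integral>x. h x \<partial>distr M borel (W 0))"
      by (simp only: distr)
    then show "expectation (\<lambda>\<omega>. h (W i \<omega>)) = expectation (\<lambda>\<omega>. h (W 0 \<omega>))"
      by (simp add: integral_distr)
    have "integrable (distr M borel (W i)) h \<longleftrightarrow> integrable (distr M borel (W 0)) h"
      by (simp only: distr)
    then show "integrable M (\<lambda>\<omega>. h (W i \<omega>)) \<longleftrightarrow> integrable M (\<lambda>\<omega>. h (W 0 \<omega>))"
      by (simp add: integrable_distr_eq)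
  qed
  have sqi: "integrable M (\<lambda>\<omega>. (W i \<omega>)\<^sup>2)" for i
    using transfer(2)[of "\<lambda>x. x\<^sup>2" i] sq by simp
  define m where "m = expectation (W 0)"
  have mean: "expectation (W i) = m" for i
    using transfer(1)[of "\<lambda>x. x" i] by (simp add: m_def)
  have second: "expectation (\<lambda>\<omega>. (W i \<omega>)\<^sup>2) = expectation (\<lambda>\<omega>. (W 0 \<omega>)\<^sup>2)" for i
    using transfer(1)[of "\<lambda>x. x\<^sup>2" i] by simp
  have wi: "integrable M (W i)" for i by (rule square_integrable_imp_integrable[OF rv sqi])
  show ?thesis
  proof (cases "m = 0")
    case False
    \<comment> \<open>Writing S for the sum, |S/n| < e forces |S/n - m| > |m| - e = e, above the
      threshold e/2.\<close>
    define e where "e = \<bar>m\<bar> / 2"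
    have e: "e > 0" using False by (simp add: e_def)
    have lim: "(\<lambda>n. prob {\<omega> \<in> space M. \<bar>(\<Sum>i<n. W i \<omega>) / n - m\<bar> > e / 2}) \<longlonglongrightarrow> 0"
      using e by (intro weak_law_of_large_numbers[OF indep sqi mean second]) auto
    have "\<forall>\<^sub>F n in sequentially. real n > 2 / e"
      by (rule filterlim_real_sequentially[THEN filterlim_at_top_dense[THEN iffD1], rule_format])
    then have "\<forall>\<^sub>F n in sequentially. prob {\<omega> \<in> space M. \<bar>\<Sum>i<n. W i \<omega>\<bar> \<le> 1}
        \<le> prob {\<omega> \<in> space M. \<bar>(\<Sum>i<n. W i \<omega>) / n - m\<bar> > e / 2}"
    proof eventually_elim
      case (elim n)
      have n: "real n > 0" using elim e by (meson divide_pos_pos less_trans zero_less_numeral)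
      have "\<bar>(\<Sum>i<n. W i \<omega>) / n - m\<bar> > e / 2" if "\<bar>\<Sum>i<n. W i \<omega>\<bar> \<le> 1" for \<omega>
      proof -
        have "\<bar>(\<Sum>i<n. W i \<omega>) / n\<bar> \<le> 1 / n" using that n by (simp add: divide_right_mono)
        also have "1 / n < e" using elim e n by (simp add: field_simps)
        finally show ?thesis using e unfolding e_def by linarith
      qed
      then show ?case by (intro finite_measure_mono) auto
    qed
    then show ?thesis
      by (intro tendsto_sandwich[OF _ _ tendsto_const lim]) auto
  next
    case True
    define \<sigma> where "\<sigma> = sqrt (variance (W 0))"
    have \<sigma>: "\<sigma> > 0" "\<sigma>\<^sup>2 = variance (W 0)" using var by (auto simp: \<sigma>_def)
    define Q where "Q n = distr M borel (\<lambda>\<omega>. (\<Sum>i<n. W i \<omega>) / sqrt (n * \<sigma>\<^sup>2))" for n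
    have "variance (W i) = \<sigma>\<^sup>2" for i
      using second mean True \<sigma>(2) by simp
    then have conv: "weak_conv_m Q std_normal_distribution"
      unfolding Q_def
      using mean True by (intro central_limit_theorem_zero_mean[OF indep _ \<sigma>(1) sqi _ distr]) auto
    interpret N: real_distribution std_normal_distribution by (rule real_dist_normal_dist)
    have cont: "isCont (cdf std_normal_distribution) x" for x
    proof -
      have "emeasure std_normal_distribution {x} = 0"
        by (subst emeasure_density) (auto intro!: nn_integral_zero' AE_lborel_singleton[THEN
            eventually_mono])
      then show ?thesis by (simp add: N.isCont_cdf measure_def)
    qed
    show ?thesis
    proof (rule LIMSEQ_I)
      fix r :: real assume r: "r > 0"
      \<comment> \<open>The limiting probability is then at most 2 d = r/2, strictly below
        r.\<close>
      define d where "d = r / 4"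
      have d: "d > 0" using r by (simp add: d_def)
      have "(\<lambda>n. cdf (Q n) d - cdf (Q n) (- d)) \<longlonglongrightarrow> cdf std_normal_distribution d - cdf
          std_normal_distribution (- d)"
        using conv cont by (intro tendsto_diff) (auto simp: weak_conv_m_def weak_conv_def)
      moreover have "cdf std_normal_distribution d - cdf std_normal_distribution (- d) < r"
        using N.cdf_diff_eq[of "- d" d] std_normal_interval_le[OF d] d r by (simp add: d_def)
      ultimately have "\<forall>\<^sub>F n in sequentially. cdf (Q n) d - cdf (Q n) (- d) < r"
        by (rule order_tendstoD)
      \<comment> \<open>Equivalent to 1 / (sqrt n \<sigma>) < d, so that the rescaled interval fits
        into (-d, d].\<close>
      moreover have "\<forall>\<^sub>F n in sequentially. real n > (1 / (d * \<sigma>))\<^sup>2"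
        by (rule filterlim_real_sequentially[THEN filterlim_at_top_dense[THEN iffD1], rule_format])
      ultimately have "\<forall>\<^sub>F n in sequentially. norm (prob {\<omega> \<in> space M. \<bar>\<Sum>i<n. W i \<omega>\<bar> \<le> 1} - 0) < r"
      proof eventually_elim
        case (elim n)
        interpret Q: real_distribution "Q n" unfolding Q_def by (rule real_distribution_distr)
            measurable
        have "sqrt ((1 / (d * \<sigma>))\<^sup>2) < sqrt n" using elim(2) by (rule real_sqrt_less_mono)
        then have sn: "1 / (d * \<sigma>) < sqrt n" using d \<sigma>(1) by simp
        then have "sqrt n > 0" using d \<sigma>(1) by (meson divide_pos_pos less_trans mult_pos_pos
            zero_less_one)
        then have "1 / (sqrt n * \<sigma>) < d" using sn d \<sigma>(1) by (simp add: field_simps)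
        moreover have sq': "sqrt (n * \<sigma>\<^sup>2) = sqrt n * \<sigma>" using \<sigma>(1) by (simp add: real_sqrt_mult)
        ultimately have small: "1 / sqrt (n * \<sigma>\<^sup>2) < d" "sqrt (n * \<sigma>\<^sup>2) > 0" using \<open>sqrt n > 0\<close>
            \<sigma>(1) by auto
        have "(\<Sum>i<n. W i \<omega>) / sqrt (n * \<sigma>\<^sup>2) \<in> {-d<..d}" if "\<bar>\<Sum>i<n. W i \<omega>\<bar> \<le> 1" for \<omega>
        proof -
          have "\<bar>(\<Sum>i<n. W i \<omega>) / sqrt (n * \<sigma>\<^sup>2)\<bar> \<le> 1 / sqrt (n * \<sigma>\<^sup>2)"
            using that small(2) unfolding abs_divide by (simp add: divide_right_mono)
          then have "\<bar>(\<Sum>i<n. W i \<omega>) / sqrt (n * \<sigma>\<^sup>2)\<bar> < d" using small(1) by linarith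
          then show ?thesis unfolding abs_less_iff greaterThanAtMost_iff by linarith
        qed
        then have "prob {\<omega> \<in> space M. \<bar>\<Sum>i<n. W i \<omega>\<bar> \<le> 1} \<le> prob ((\<lambda>\<omega>. (\<Sum>i<n. W i \<omega>) / sqrt (n *
            \<sigma>\<^sup>2)) -` {-d<..d} \<inter> space M)"
          by (intro finite_measure_mono) auto
        also have "\<dots> = measure (Q n) {-d<..d}"
          unfolding Q_def by (subst measure_distr) auto
        also have "\<dots> < r" using elim(1) Q.cdf_diff_eq[of "- d" d] d by simp
        finally show ?case by simp
      qed
      then show "\<exists>n0. \<forall>n\<ge>n0. norm (prob {\<omega> \<in> space M. \<bar>\<Sum>i<n. W i \<omega>\<bar> \<le> 1} - 0) < r"
        by (simp add: eventually_sequentially)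
    qed
  qed
qed

end

text \<open>Since e >= 2, a gap above 1 makes the larger modulus at least twice the smaller. The
  modulus of the sum then lies between half and twice the larger one, hence within a factor e of
  it.\<close>

lemma abs_ln_norm_add_sub_max_le:
  fixes a b :: complex
  assumes "a \<noteq> 0" "b \<noteq> 0" "\<bar>ln (cmod a) - ln (cmod b)\<bar> > 1"
  shows "\<bar>ln (cmod (a + b)) - max (ln (cmod a)) (ln (cmod b))\<bar> \<le> 1"
proof -
  have *: "\<bar>ln (cmod (a + b)) - ln (cmod a)\<bar> \<le> 1"
    if nz: "a \<noteq> 0" "b \<noteq> 0" and gt: "ln (cmod a) > ln (cmod b) + 1" for a b :: complex
  proof -
    have e2: "exp (1::real) \<ge> 2" using exp_ge_add_one_self[of 1] by simp
    have "cmod b * exp 1 = exp (ln (cmod b) + 1)" using nz by (simp add: exp_add)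
    also have "\<dots> \<le> exp (ln (cmod a))" using gt by simp
    finally have ba: "cmod b * exp 1 \<le> cmod a" using nz by simp
    have "cmod b * 2 \<le> cmod b * exp 1" using e2 by (intro mult_left_mono) auto
    then have b2: "cmod b * 2 \<le> cmod a" using ba by simp
    have "exp (-1) * 2 \<le> (1::real)" using e2 by (simp add: exp_minus field_simps)
    then have "cmod a * (exp (-1) * 2) \<le> cmod a * 1" by (intro mult_left_mono) auto
    moreover have "cmod a - cmod b \<le> cmod (a + b)" using norm_diff_ineq[of a b] .
    ultimately have lower: "cmod a * exp (-1) \<le> cmod (a + b)" using b2 by simp
    have "cmod a * 2 \<le> cmod a * exp 1" using e2 by (intro mult_left_mono) auto
    then have upper: "cmod (a + b) \<le> cmod a * exp 1" using norm_triangle_ineq[of a b] b2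
        norm_ge_zero[of a] by linarith
    have "cmod a * exp (-1) > 0" using nz by simp
    then have pos: "cmod a > 0" "cmod (a + b) > 0"
      using nz lower by (simp, linarith)
    have "ln (cmod a * exp (-1)) \<le> ln (cmod (a + b))" using lower pos by (intro ln_mono) auto
    moreover have "ln (cmod (a + b)) \<le> ln (cmod a * exp 1)" using upper pos by (intro ln_mono) auto
    ultimately show ?thesis using pos by (simp add: ln_mult)
  qed
  consider "ln (cmod a) > ln (cmod b) + 1" | "ln (cmod b) > ln (cmod a) + 1" using assms(3) by
      linarith
  then show ?thesis
  proof cases
    case 1
    then show ?thesis using *[of a b] assms by simp
  next
    case 2
    then show ?thesis using *[of b a] assms by (simp add: add.commute)
  qed
qed

section \<open>The logarithm of the sum of two random polynomials\<close>

text \<open>The complement of the circle of radius exp c about z is open and null, hence free of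
  support points. Excluding w = z keeps \<open>ln 0 = 0\<close> from placing the centre at distance
  1 from itself.\<close>

lemma supported_on_circleI:
  assumes "\<mu> \<in> borel_prob_measures" and "AE w in \<mu>. w \<noteq> z" and "AE w in \<mu>. ln (cmod (z - w)) = c"
  shows "supported_on_circle \<mu>"
proof -
  have sets: "sets \<mu> = sets borel" using assms(1) by (simp add: borel_prob_measures_def)
  have "w \<notin> msupport \<mu>" if "cmod (w - z) \<noteq> exp c" for w
  proof -
    let ?U = "{w. cmod (w - z) \<noteq> exp c}"
    have "open ?U"
      by (intro open_Collect_neq continuous_intros)
    then have U: "?U \<in> sets \<mu>" by (simp add: sets)
    have "AE w in \<mu>. w \<notin> ?U"
      using assms(2,3)
    proof eventually_elim
      case (elim w)
      then have "cmod (z - w) = exp c" by (metis exp_ln right_minus_eq zero_less_norm_iff)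
      then show ?case by (simp add: norm_minus_commute)
    qed
    then have "emeasure \<mu> ?U = 0"
      using AE_iff_null_sets[OF U] by auto
    then show ?thesis
      using \<open>open ?U\<close> that by (auto simp: msupport_def)
  qed
  then have "msupport \<mu> \<subseteq> {w. cmod (w - z) = exp c}" by blast
  then show ?thesis
    unfolding supported_on_circle_def by (intro exI[of _ "exp c"] conjI exI[of _ z]) auto
qed

lemma poly_root_poly: "poly (root_poly x n) z = (\<Prod>i<n. z - x (Suc i))"
  by (simp add: root_poly_def poly_prod prod.atLeast1_atMost_eq)

section \<open>Two independent samples and the sum of their polynomials at a point\<close>

text \<open>A single family over a sum type expresses joint independence of all X_i and Y_j. Nothing
  is assumed about index 0, hence the \<open>Suc\<close> in everything that follows.\<close>

locale two_samples = prob_space M + A: bounded_prob \<mu> K + B: bounded_prob \<nu> K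
  for M :: "'a measure" and \<mu> \<nu> :: "complex measure" and K :: real +
  fixes X Y :: "nat \<Rightarrow> 'a \<Rightarrow> complex"
  assumes indep: "indep_vars (\<lambda>_. borel) (case_sum X Y) ({1..} <+> {1..})"
    and X_distr: "\<And>i. i \<ge> 1 \<Longrightarrow> distr M borel (X i) = \<mu>"
    and Y_distr: "\<And>i. i \<ge> 1 \<Longrightarrow> distr M borel (Y i) = \<nu>"
begin

lemma X_rv [measurable]: "X (Suc i) \<in> borel_measurable M"
proof -
  have "(case_sum X Y) (Inl (Suc i)) \<in> borel_measurable M"
    using indep by (intro indep_vars_def[THEN iffD1, THEN conjunct1, rule_format]) auto
  then show ?thesis by simp
qed

lemma Y_rv [measurable]: "Y (Suc i) \<in> borel_measurable M"
proof -
  have "(case_sum X Y) (Inr (Suc i)) \<in> borel_measurable M"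
    using indep by (intro indep_vars_def[THEN iffD1, THEN conjunct1, rule_format]) auto
  then show ?thesis by simp
qed

text \<open>Functions of disjoint blocks of an independent family are independent. A
  \<open>g\<close> that ignores one argument covers the \<open>X\<close> or the \<open>Y\<close>
  alone.\<close>

lemma indep_vars_pairs:
  fixes g :: "complex \<Rightarrow> complex \<Rightarrow> real"
  assumes [measurable]: "(\<lambda>p. g (fst p) (snd p)) \<in> borel_measurable (borel \<Otimes>\<^sub>M borel)"
  shows "indep_vars (\<lambda>_. borel) (\<lambda>j \<omega>. g (X (Suc j) \<omega>) (Y (Suc j) \<omega>)) UNIV"
proof -
  let ?K = "\<lambda>j. {Inl (Suc j), Inr (Suc j)} :: (nat + nat) set"
  have 1: "indep_vars (\<lambda>j. PiM (?K j) (\<lambda>_. borel)) (\<lambda>j \<omega>. restrict (\<lambda>i. case_sum X Y i \<omega>) (?K j))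
      UNIV"
    by (rule indep_vars_restrict[OF indep]) (auto simp: disjoint_family_on_def)
  have 2: "(\<lambda>f. g (f (Inl (Suc j))) (f (Inr (Suc j)))) \<in> borel_measurable (PiM (?K j) (\<lambda>_.
      borel))" for j
  proof -
    have "(\<lambda>f. (f (Inl (Suc j)), f (Inr (Suc j)))) \<in> PiM (?K j) (\<lambda>_. borel) \<rightarrow>\<^sub>M borel \<Otimes>\<^sub>M borel"
      by (intro measurable_Pair measurable_component_singleton) auto
    from measurable_compose[OF this assms] show ?thesis by simp
  qed
  from indep_vars_compose2[OF 1, of "\<lambda>j f. g (f (Inl (Suc j))) (f (Inr (Suc j)))" "\<lambda>_. borel", OF 2]
  show ?thesis by simp
qed

lemma pair_distr: "distr M (borel \<Otimes>\<^sub>M borel) (\<lambda>\<omega>. (X (Suc j) \<omega>, Y (Suc j) \<omega>)) = \<mu> \<Otimes>\<^sub>M \<nu>"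
proof -
  have 1: "indep_var (PiM {Inl (Suc j)} (\<lambda>_. borel)) (\<lambda>\<omega>. restrict (\<lambda>i. case_sum X Y i \<omega>) {Inl
      (Suc j)})
      (PiM {Inr (Suc j)} (\<lambda>_. borel)) (\<lambda>\<omega>. restrict (\<lambda>i. case_sum X Y i \<omega>) {Inr (Suc j)})"
    by (rule indep_var_restrict[OF indep]) auto
  have "indep_var borel ((\<lambda>f. f (Inl (Suc j))) \<circ> (\<lambda>\<omega>. restrict (\<lambda>i. case_sum X Y i \<omega>) {Inl (Suc
      j)}))
      borel ((\<lambda>f. f (Inr (Suc j))) \<circ> (\<lambda>\<omega>. restrict (\<lambda>i. case_sum X Y i \<omega>) {Inr (Suc j)}))"
    by (rule indep_var_compose[OF 1]) (auto intro!: measurable_component_singleton)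
  then have "indep_var borel (X (Suc j)) borel (Y (Suc j))" by (simp add: comp_def)
  then show ?thesis
    using X_distr[of "Suc j"] Y_distr[of "Suc j"] by (simp add: indep_var_distribution_eq)
qed

lemma transfer_X:
  fixes h :: "complex \<Rightarrow> real"
  assumes [measurable]: "h \<in> borel_measurable borel"
  shows "expectation (\<lambda>\<omega>. h (X (Suc i) \<omega>)) = (\<integral>x. h x \<partial>\<mu>)"
    "integrable M (\<lambda>\<omega>. h (X (Suc i) \<omega>)) \<longleftrightarrow> integrable \<mu> h"
  unfolding X_distr[of "Suc i", simplified, symmetric]
  by (simp_all add: integral_distr integrable_distr_eq)

lemma transfer_Y:
  fixes h :: "complex \<Rightarrow> real"
  assumes [measurable]: "h \<in> borel_measurable borel"
  shows "expectation (\<lambda>\<omega>. h (Y (Suc i) \<omega>)) = (\<integral>x. h x \<partial>\<nu>)"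
    "integrable M (\<lambda>\<omega>. h (Y (Suc i) \<omega>)) \<longleftrightarrow> integrable \<nu> h"
  unfolding Y_distr[of "Suc i", simplified, symmetric]
  by (simp_all add: integral_distr integrable_distr_eq)

lemma AE_X:
  assumes "AE x in \<mu>. P x"
  shows "AE \<omega> in M. \<forall>i. P (X (Suc i) \<omega>)"
proof -
  have "AE \<omega> in M. P (X (Suc i) \<omega>)" for i
    using assms unfolding X_distr[of "Suc i", simplified, symmetric]
    by (rule AE_distrD[rotated]) measurable
  then show ?thesis by (simp add: AE_all_countable)
qed

lemma AE_Y:
  assumes "AE x in \<nu>. P x"
  shows "AE \<omega> in M. \<forall>i. P (Y (Suc i) \<omega>)"
proof -
  have "AE \<omega> in M. P (Y (Suc i) \<omega>)" for i
    using assms unfolding Y_distr[of "Suc i", simplified, symmetric]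
    by (rule AE_distrD[rotated]) measurable
  then show ?thesis by (simp add: AE_all_countable)
qed

definition pq :: "nat \<Rightarrow> 'a \<Rightarrow> complex poly" where
  "pq n \<omega> = root_poly (\<lambda>i. X i \<omega>) n + root_poly (\<lambda>i. Y i \<omega>) n"

text \<open>At a zero of the polynomial the value is 0 instead of minus infinity, which concerns
  finitely many z only. Division by zero makes \<open>F 0\<close> vanish.\<close>

definition F :: "nat \<Rightarrow> complex \<Rightarrow> 'a \<Rightarrow> real" where
  "F n z \<omega> = ln (cmod (poly (pq n \<omega>) z)) / n"

definition u :: "complex \<Rightarrow> real" where
  "u z = max (log_pot \<mu> z) (log_pot \<nu> z)"

lemma u_measurable [measurable]: "u \<in> borel_measurable borel"
  unfolding u_def by measurable

lemma poly_pq: "poly (pq n \<omega>) z = (\<Prod>i<n. z - X (Suc i) \<omega>) + (\<Prod>i<n. z - Y (Suc i) \<omega>)"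
  by (simp add: pq_def poly_root_poly)

lemma F_measurable [measurable]: "(\<lambda>p. F n (fst p) (snd p)) \<in> borel_measurable (borel \<Otimes>\<^sub>M M)"
  unfolding F_def poly_pq by measurable

lemma F_measurable' [measurable]: "F n z \<in> borel_measurable M"
  unfolding F_def poly_pq by measurable

lemma log_averages_converge:
  assumes "tame \<mu> z" "\<epsilon> > 0"
  shows "(\<lambda>n. prob {\<omega> \<in> space M. \<bar>(\<Sum>i<n. ln (cmod (z - X (Suc i) \<omega>))) / n - log_pot \<mu> z\<bar> > \<epsilon>}) \<longlonglongrightarrow> 0"
proof (rule weak_law_of_large_numbers[where s="\<integral>w. (ln (cmod (z - w)))\<^sup>2 \<partial>\<mu>"])
  show "indep_vars (\<lambda>_. borel) (\<lambda>i \<omega>. ln (cmod (z - X (Suc i) \<omega>))) UNIV"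
    by (rule indep_vars_pairs[of "\<lambda>x y. ln (cmod (z - x))"]) measurable
  show "integrable M (\<lambda>\<omega>. (ln (cmod (z - X (Suc i) \<omega>)))\<^sup>2)" for i
    using assms(1) transfer_X(2)[of "\<lambda>w. (ln (cmod (z - w)))\<^sup>2" i] by (simp add: tame_def)
  show "expectation (\<lambda>\<omega>. ln (cmod (z - X (Suc i) \<omega>))) = log_pot \<mu> z" for i
    using transfer_X(1)[of "\<lambda>w. ln (cmod (z - w))" i] by (simp add: log_pot_def)
  show "expectation (\<lambda>\<omega>. (ln (cmod (z - X (Suc i) \<omega>)))\<^sup>2) = (\<integral>w. (ln (cmod (z - w)))\<^sup>2 \<partial>\<mu>)" for i
    using transfer_X(1)[of "\<lambda>w. (ln (cmod (z - w)))\<^sup>2" i] by simp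
qed fact

lemma log_averages_converge':
  assumes "tame \<nu> z" "\<epsilon> > 0"
  shows "(\<lambda>n. prob {\<omega> \<in> space M. \<bar>(\<Sum>i<n. ln (cmod (z - Y (Suc i) \<omega>))) / n - log_pot \<nu> z\<bar> > \<epsilon>}) \<longlonglongrightarrow> 0"
proof (rule weak_law_of_large_numbers[where s="\<integral>w. (ln (cmod (z - w)))\<^sup>2 \<partial>\<nu>"])
  show "indep_vars (\<lambda>_. borel) (\<lambda>i \<omega>. ln (cmod (z - Y (Suc i) \<omega>))) UNIV"
    by (rule indep_vars_pairs[of "\<lambda>x y. ln (cmod (z - y))"]) measurable
  show "integrable M (\<lambda>\<omega>. (ln (cmod (z - Y (Suc i) \<omega>)))\<^sup>2)" for i
    using assms(1) transfer_Y(2)[of "\<lambda>w. (ln (cmod (z - w)))\<^sup>2" i] by (simp add: tame_def)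
  show "expectation (\<lambda>\<omega>. ln (cmod (z - Y (Suc i) \<omega>))) = log_pot \<nu> z" for i
    using transfer_Y(1)[of "\<lambda>w. ln (cmod (z - w))" i] by (simp add: log_pot_def)
  show "expectation (\<lambda>\<omega>. (ln (cmod (z - Y (Suc i) \<omega>)))\<^sup>2) = (\<integral>w. (ln (cmod (z - w)))\<^sup>2 \<partial>\<nu>)" for i
    using transfer_Y(1)[of "\<lambda>w. (ln (cmod (z - w)))\<^sup>2" i] by simp
qed fact

text \<open>Only positivity of the variance is at stake. If it were zero, ln |z - x| - ln |z - y|
  would equal a constant m for almost every pair; integrating over y gives ln |z - x| = m + U_nu(z)
  for almost every x, and mu would live on a circle centred at z.\<close>

lemma log_ratio_anticoncentration:
  assumes z: "tame \<mu> z" "tame \<nu> z" and circle: "\<not> supported_on_circle \<mu>"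
  shows "(\<lambda>n. prob {\<omega> \<in> space M. \<bar>\<Sum>i<n. ln (cmod (z - X (Suc i) \<omega>)) - ln (cmod (z - Y (Suc i) \<omega>))\<bar>
      \<le> 1}) \<longlonglongrightarrow> 0"
proof -
  let ?f = "\<lambda>w. ln (cmod (z - w))"
  let ?W = "\<lambda>i \<omega>. ?f (X (Suc i) \<omega>) - ?f (Y (Suc i) \<omega>)"
  have 1: "indep_vars (\<lambda>_. borel) ?W UNIV"
    by (rule indep_vars_pairs[of "\<lambda>x y. ?f x - ?f y"]) measurable
  have gm: "(\<lambda>p. ?f (fst p) - ?f (snd p)) \<in> borel_measurable (borel \<Otimes>\<^sub>M borel)" by measurable
  have 2: "distr M borel (?W i) = distr (\<mu> \<Otimes>\<^sub>M \<nu>) borel (\<lambda>p. ?f (fst p) - ?f (snd p))" for i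
    unfolding pair_distr[of i, symmetric] by (subst distr_distr) (auto simp: comp_def)
  have sX: "integrable M (\<lambda>\<omega>. (?f (X (Suc 0) \<omega>))\<^sup>2)" and sY: "integrable M (\<lambda>\<omega>. (?f (Y (Suc 0)
      \<omega>))\<^sup>2)"
    using z transfer_X(2)[of "\<lambda>w. (?f w)\<^sup>2" 0] transfer_Y(2)[of "\<lambda>w. (?f w)\<^sup>2" 0] by (auto simp:
        tame_def)
  have 3: "integrable M (\<lambda>\<omega>. (?W 0 \<omega>)\<^sup>2)"
  proof (rule Bochner_Integration.integrable_bound)
    show "integrable M (\<lambda>\<omega>. 2 * (?f (X (Suc 0) \<omega>))\<^sup>2 + 2 * (?f (Y (Suc 0) \<omega>))\<^sup>2)"
      using sX sY by simp
    have "(a - b)\<^sup>2 \<le> 2 * a\<^sup>2 + 2 * b\<^sup>2" for a b :: real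
      using zero_le_power2[of "a + b"] by (simp add: power2_sum power2_diff)
    then show "AE \<omega> in M. norm ((?W 0 \<omega>)\<^sup>2) \<le> norm (2 * (?f (X (Suc 0) \<omega>))\<^sup>2 + 2 * (?f (Y (Suc 0)
        \<omega>))\<^sup>2)"
      by simp
  qed measurable
  have Wi: "integrable M (?W 0)"
    by (rule square_integrable_imp_integrable[OF _ 3]) measurable
  have 4: "variance (?W 0) > 0"
  proof (rule ccontr)
    interpret P: pair_sigma_finite \<mu> \<nu> ..
    assume "\<not> 0 < variance (?W 0)"
    then have v0: "variance (?W 0) = 0" using variance_positive[of "?W 0"] by linarith
    define m where "m = expectation (?W 0)"
    have "integrable M (\<lambda>\<omega>. (?W 0 \<omega> - m)\<^sup>2)"
    proof -
      define D where "D = ?W 0"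
      have "(D \<omega> - m)\<^sup>2 = (D \<omega>)\<^sup>2 - 2 * m * D \<omega> + m\<^sup>2" for \<omega>
        by (simp add: power2_diff algebra_simps)
      moreover have "integrable M (\<lambda>\<omega>. (D \<omega>)\<^sup>2 - 2 * m * D \<omega> + m\<^sup>2)"
      proof -
        have "integrable M (\<lambda>\<omega>. (D \<omega>)\<^sup>2)" "integrable M D"
          using 3 Wi by (simp_all add: D_def)
        then show ?thesis by simp
      qed
      ultimately have "integrable M (\<lambda>\<omega>. (D \<omega> - m)\<^sup>2)" by simp
      then show ?thesis unfolding D_def .
    qed
    then have "AE \<omega> in M. (?W 0 \<omega> - m)\<^sup>2 = 0"
      using v0 unfolding m_def[symmetric] by (subst (asm) integral_nonneg_eq_0_iff_AE) auto
    then have "AE \<omega> in M. ?W 0 \<omega> = m" by simp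
    moreover have "{p \<in> space (borel \<Otimes>\<^sub>M borel). ?f (fst p) - ?f (snd p) = m} \<in> sets (borel \<Otimes>\<^sub>M
        borel)"
      using measurable_sets[OF gm, of "{m}"] by (simp add: vimage_def Int_def conj_commute)
    ultimately have "AE p in distr M (borel \<Otimes>\<^sub>M borel) (\<lambda>\<omega>. (X (Suc 0) \<omega>, Y (Suc 0) \<omega>)). ?f (fst
        p) - ?f (snd p) = m"
      by (subst AE_distr_iff) auto
    then have "AE p in \<mu> \<Otimes>\<^sub>M \<nu>. ?f (fst p) - ?f (snd p) = m"
      by (simp only: pair_distr)
    from P.AE_pair[OF this] have "AE x in \<mu>. AE y in \<nu>. ?f x - ?f y = m" by simp
    then have "AE x in \<mu>. ?f x = m + log_pot \<nu> z"
    proof eventually_elim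
      case (elim x)
      then have "AE y in \<nu>. ?f y = ?f x - m" by eventually_elim auto
      then have "log_pot \<nu> z = (\<integral>y. ?f x - m \<partial>\<nu>)"
        unfolding log_pot_def by (intro integral_cong_AE) auto
      then show ?case by (simp add: B.prob_space)
    qed
    moreover have "\<mu> \<in> borel_prob_measures"
      using A.prob_space_axioms A.sets_eq by (simp add: borel_prob_measures_def)
    ultimately have "supported_on_circle \<mu>"
      using z(1) by (intro supported_on_circleI) (auto simp: tame_def)
    with circle show False ..
  qed
  show ?thesis
    by (rule iid_sum_anticoncentration[OF 1 2 3 4])
qed

theorem F_converges_in_prob:
  assumes z: "tame \<mu> z" "tame \<nu> z" and circle: "\<not> supported_on_circle \<mu>" and e: "\<epsilon> > 0"
  shows "(\<lambda>n. prob {\<omega> \<in> space M. \<bar>F n z \<omega> - u z\<bar> > \<epsilon>}) \<longlonglongrightarrow> 0"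
proof -
  let ?f = "\<lambda>w. ln (cmod (z - w))"
  let ?E1 = "\<lambda>n. {\<omega> \<in> space M. \<bar>(\<Sum>i<n. ?f (X (Suc i) \<omega>)) / n - log_pot \<mu> z\<bar> > \<epsilon> / 2}"
  let ?E2 = "\<lambda>n. {\<omega> \<in> space M. \<bar>(\<Sum>i<n. ?f (Y (Suc i) \<omega>)) / n - log_pot \<nu> z\<bar> > \<epsilon> / 2}"
  let ?E3 = "\<lambda>n. {\<omega> \<in> space M. \<bar>\<Sum>i<n. ?f (X (Suc i) \<omega>) - ?f (Y (Suc i) \<omega>)\<bar> \<le> 1}"
  have lim: "(\<lambda>n. prob (?E1 n) + prob (?E2 n) + prob (?E3 n)) \<longlonglongrightarrow> 0 + 0 + 0"
    using e by (intro tendsto_intros log_averages_converge log_averages_converge'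
        log_ratio_anticoncentration z circle) auto
  have "AE w in \<mu>. w \<noteq> z" "AE w in \<nu>. w \<noteq> z" using z by (auto simp: tame_def)
  then have ae: "AE \<omega> in M. (\<forall>i. X (Suc i) \<omega> \<noteq> z) \<and> (\<forall>i. Y (Suc i) \<omega> \<noteq> z)"
    using AE_X[of "\<lambda>w. w \<noteq> z"] AE_Y[of "\<lambda>w. w \<noteq> z"] by simp
  \<comment> \<open>Outside three events of vanishing probability the estimate is deterministic:
    replacing ln |a + b| by the larger logarithm costs at most 1/n < \<epsilon>/2, and the two
    averages are within \<epsilon>/2 of their limits.\<close>
  have det: "\<omega> \<in> ?E1 n \<union> ?E2 n \<union> ?E3 n"
    if nz: "(\<forall>i. X (Suc i) \<omega> \<noteq> z) \<and> (\<forall>i. Y (Suc i) \<omega> \<noteq> z)" and n: "real n > 2 / \<epsilon>"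
      and sp: "\<omega> \<in> space M" and bad: "\<bar>F n z \<omega> - u z\<bar> > \<epsilon>" for n \<omega>
  proof (rule ccontr)
    assume not: "\<omega> \<notin> ?E1 n \<union> ?E2 n \<union> ?E3 n"
    define a b where "a = (\<Prod>i<n. z - X (Suc i) \<omega>)" and "b = (\<Prod>i<n. z - Y (Suc i) \<omega>)"
    have n0: "real n > 0" using n e by (meson divide_pos_pos less_trans zero_less_numeral)
    have nz': "a \<noteq> 0" "b \<noteq> 0" using nz by (auto simp: a_def b_def)
    have la: "ln (cmod a) = (\<Sum>i<n. ?f (X (Suc i) \<omega>))" and lb: "ln (cmod b) = (\<Sum>i<n. ?f (Y (Suc i)
        \<omega>))"
      unfolding a_def b_def prod_norm[symmetric] using nz by (auto intro!: ln_prod)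
    have "\<bar>ln (cmod a) - ln (cmod b)\<bar> > 1"
      using not sp unfolding la lb by (auto simp: sum_subtractf)
    from abs_ln_norm_add_sub_max_le[OF nz' this]
    have "\<bar>ln (cmod (a + b)) - max (ln (cmod a)) (ln (cmod b))\<bar> / n \<le> 1 / n"
      using n0 by (simp add: divide_right_mono)
    also have "1 / n < \<epsilon> / 2" using n n0 e by (simp add: field_simps)
    also have "\<bar>ln (cmod (a + b)) - max (ln (cmod a)) (ln (cmod b))\<bar> / n
       = \<bar>ln (cmod (a + b)) / n - max (ln (cmod a) / n) (ln (cmod b) / n)\<bar>"
    proof -
      have "max (ln (cmod a) / n) (ln (cmod b) / n) = max (ln (cmod a)) (ln (cmod b)) / n"
        using n0 by (auto simp: max_def divide_le_cancel)
      then show ?thesis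
        using n0 by (simp add: diff_divide_distrib[symmetric] abs_divide)
    qed
    finally have 1: "\<bar>F n z \<omega> - max (ln (cmod a) / n) (ln (cmod b) / n)\<bar> < \<epsilon> / 2"
      by (simp add: F_def poly_pq a_def b_def)
    have "\<bar>ln (cmod a) / n - log_pot \<mu> z\<bar> \<le> \<epsilon> / 2" "\<bar>ln (cmod b) / n - log_pot \<nu> z\<bar> \<le> \<epsilon> / 2"
      using not sp unfolding la lb by auto
    \<comment> \<open>The maximum is 1-Lipschitz for the sup norm.\<close>
    then have "\<bar>max (ln (cmod a) / n) (ln (cmod b) / n) - u z\<bar> \<le> \<epsilon> / 2"
      unfolding u_def by linarith
    with 1 bad show False by linarith
  qed
  have "\<forall>\<^sub>F n in sequentially. real n > 2 / \<epsilon>"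
    by (rule filterlim_real_sequentially[THEN filterlim_at_top_dense[THEN iffD1], rule_format])
  then have ev: "\<forall>\<^sub>F n in sequentially. prob {\<omega> \<in> space M. \<bar>F n z \<omega> - u z\<bar> > \<epsilon>} \<le> prob (?E1 n) +
      prob (?E2 n) + prob (?E3 n)"
  proof eventually_elim
    case (elim n)
    have sets: "?E1 n \<in> events" "?E2 n \<in> events" "?E3 n \<in> events" by measurable
    have "prob {\<omega> \<in> space M. \<bar>F n z \<omega> - u z\<bar> > \<epsilon>} \<le> prob (?E1 n \<union> ?E2 n \<union> ?E3 n)"
    proof (rule finite_measure_mono_AE)
      show "AE \<omega> in M. \<omega> \<in> {\<omega> \<in> space M. \<bar>F n z \<omega> - u z\<bar> > \<epsilon>} \<longrightarrow> \<omega> \<in> ?E1 n \<union> ?E2 n \<union> ?E3 n"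
        by (rule eventually_mono[OF ae], intro impI, elim CollectE conjE, rule det[OF _ elim])
            simp_all
      show "?E1 n \<union> ?E2 n \<union> ?E3 n \<in> events"
        by (intro sets.Un sets)
    qed
    also have "\<dots> \<le> prob (?E1 n \<union> ?E2 n) + prob (?E3 n)"
      by (intro measure_Un_le sets.Un sets)
    also have "\<dots> \<le> prob (?E1 n) + prob (?E2 n) + prob (?E3 n)"
      by (intro add_right_mono measure_Un_le sets)
    finally show ?case .
  qed
  have lim0: "(\<lambda>n. prob (?E1 n) + prob (?E2 n) + prob (?E3 n)) \<longlonglongrightarrow> 0"
    using lim by (simp only: add_0_left)
  have nn: "\<forall>\<^sub>F n in sequentially. 0 \<le> prob {\<omega> \<in> space M. \<bar>F n z \<omega> - u z\<bar> > \<epsilon>}"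
    by (intro always_eventually allI measure_nonneg)
  show ?thesis
    by (rule tendsto_sandwich[OF nn ev tendsto_const lim0])
qed

end

section \<open>Zeros and logarithms of polynomials\<close>

text \<open>Indexing the multiset of roots lets finite products, sums of integrals and the uniform
  law on indices all count multiplicities.\<close>

lemma complex_poly_roots_enum:
  fixes p :: "complex poly"
  obtains r where "\<And>z. poly p z = lead_coeff p * (\<Prod>i<degree p. z - r i)"
    and "\<And>\<phi> :: complex \<Rightarrow> complex. (\<Sum>z\<in>#proots p. \<phi> z) = (\<Sum>i<degree p. \<phi> (r i))"
proof -
  obtain xs where xs: "mset xs = proots p" using ex_mset by blast
  have len: "length xs = degree p"
    using size_proots_complex[of p] by (simp flip: xs)
  have "smult (lead_coeff p) (\<Prod>i<degree p. [:- (xs ! i), 1:]) = p"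
  proof -
    have "(\<Prod>x\<in>#proots p. [:- x, 1:]) = prod_list (map (\<lambda>x. [:- x, 1:]) xs)"
      unfolding xs[symmetric] mset_map[symmetric] by (rule prod_mset_prod_list)
    also have "\<dots> = (\<Prod>i<degree p. [:- (xs ! i), 1:])"
      by (simp add: prod.list_conv_set_nth len atLeast0LessThan)
    finally show ?thesis using complex_poly_decompose_multiset[of p] by simp
  qed
  then have "poly p z = poly (smult (lead_coeff p) (\<Prod>i<degree p. [:- (xs ! i), 1:])) z" for z
    by simp
  then have "poly p z = lead_coeff p * (\<Prod>i<degree p. z - xs ! i)" for z
    by (simp add: poly_prod)
  moreover have "(\<Sum>z\<in>#proots p. \<phi> z) = (\<Sum>i<degree p. \<phi> (xs ! i))" for \<phi> :: "complex \<Rightarrow> complex"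
  proof -
    have "(\<Sum>z\<in>#proots p. \<phi> z) = sum_list (map \<phi> xs)"
      unfolding xs[symmetric] mset_map[symmetric] by (rule sum_mset_sum_list)
    also have "\<dots> = (\<Sum>i<degree p. \<phi> (xs ! i))"
      by (simp add: sum.list_conv_set_nth len atLeast0LessThan)
    finally show ?thesis .
  qed
  ultimately show ?thesis by (rule that)
qed

lemma ln_cmod_prod:
  fixes z :: complex and r :: "nat \<Rightarrow> complex"
  assumes "c \<noteq> 0" "\<And>i. i < n \<Longrightarrow> z \<noteq> r i"
  shows "ln (cmod (c * (\<Prod>i<n. z - r i))) = ln (cmod c) + (\<Sum>i<n. ln (cmod (z - r i)))"
proof -
  define P where "P = (\<Prod>i<n. cmod (z - r i))"
  have "P > 0"
    unfolding P_def using assms(2) by (intro prod_pos) auto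
  moreover have "cmod (c * (\<Prod>i<n. z - r i)) = cmod c * P"
    unfolding P_def by (simp only: norm_mult prod_norm)
  ultimately have "ln (cmod (c * (\<Prod>i<n. z - r i))) = ln (cmod c) + ln P"
    using assms(1) by (simp add: ln_mult)
  also have "ln P = (\<Sum>i<n. ln (cmod (z - r i)))"
    unfolding P_def using assms(2) by (intro ln_prod) auto
  finally show ?thesis .
qed

text \<open>This removes the contribution of the leading coefficient in
  \<open>laplacian_log_poly\<close>.\<close>

lemma integral_laplacian_eq_0:
  assumes \<phi>: "\<phi> \<in> Cc_infinity"
  shows "(\<integral>z. laplacian \<phi> z \<partial>lborel) = 0"
proof -
  have "integrable lborel (dir_deriv v (dir_deriv v \<phi>)) \<and> (\<integral>z. dir_deriv v (dir_deriv v \<phi>) z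
      \<partial>lborel) = 0"
    if v: "v = 1 \<or> v = \<i>" for v
  proof -
    have 1: "dir_deriv v \<phi> \<in> Cc_infinity" by (rule Cc_infinity_dir_deriv[OF \<phi> v])
    obtain R where R: "\<And>z. cmod z > R \<Longrightarrow> dir_deriv v \<phi> z = 0"
      using Cc_infinity_bounded_support[OF 1] by blast
    show ?thesis
      using integral_dir_deriv_eq_0[OF Cc_infinity_Ck[OF 1] R v] Cc_infinity_integrable[OF
          Cc_infinity_dir_deriv[OF 1 v]]
      by blast
  qed
  from this[of 1] this[of \<i>] show ?thesis
    unfolding laplacian_def by simp
qed

lemma laplacian_log_poly:
  fixes p :: "complex poly"
  assumes \<phi>: "\<phi> \<in> Cc_infinity" and p: "p \<noteq> 0"
  shows "integrable lborel (\<lambda>z. laplacian \<phi> z * complex_of_real (ln (cmod (poly p z))))"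
    and "(\<integral>z. laplacian \<phi> z * complex_of_real (ln (cmod (poly p z))) \<partial>lborel) = 2 * of_real pi *
        (\<Sum>z\<in>#proots p. \<phi> z)"
proof -
  obtain r where r: "\<And>z. poly p z = lead_coeff p * (\<Prod>i<degree p. z - r i)"
    and r': "\<And>\<phi> :: complex \<Rightarrow> complex. (\<Sum>z\<in>#proots p. \<phi> z) = (\<Sum>i<degree p. \<phi> (r i))"
    using complex_poly_roots_enum[of p] by blast
  have [measurable]: "laplacian \<phi> \<in> borel_measurable borel"
    by (rule Cc_infinity_measurable[OF Cc_infinity_laplacian[OF \<phi>]])
  let ?g = "\<lambda>z. laplacian \<phi> z * complex_of_real (ln (cmod (lead_coeff p))) +
    (\<Sum>i<degree p. laplacian \<phi> z * complex_of_real (ln (cmod (z - r i))))"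
  have "AE z in lborel. \<forall>i\<in>{..<degree p}. z \<noteq> r i"
    by (subst AE_ball_countable) (auto intro: AE_lborel_singleton)
  then have ae: "AE z in lborel. ?g z = laplacian \<phi> z * complex_of_real (ln (cmod (poly p z)))"
  proof eventually_elim
    case (elim z)
    have "ln (cmod (poly p z)) = ln (cmod (lead_coeff p)) + (\<Sum>i<degree p. ln (cmod (z - r i)))"
      unfolding r[of z] using p elim by (intro ln_cmod_prod) auto
    then show ?case by (simp add: distrib_left sum_distrib_left)
  qed
  have i1: "integrable lborel (\<lambda>z. laplacian \<phi> z * complex_of_real (ln (cmod (lead_coeff p))))"
    by (intro integrable_mult_left Cc_infinity_integrable Cc_infinity_laplacian \<phi>)
  have i2: "integrable lborel (\<lambda>z. laplacian \<phi> z * complex_of_real (ln (cmod (z - r i))))" for i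
    by (rule laplacian_log_integral(1)[OF \<phi>])
  have gi: "integrable lborel ?g"
    by (intro Bochner_Integration.integrable_add Bochner_Integration.integrable_sum i1 i2)
  have pm: "(\<lambda>z. poly p z) \<in> borel_measurable borel"
    by (intro borel_measurable_continuous_onI continuous_intros)
  have pm': "(\<lambda>z. laplacian \<phi> z * complex_of_real (ln (cmod (poly p z)))) \<in> borel_measurable lborel"
    using pm by simp
  show "integrable lborel (\<lambda>z. laplacian \<phi> z * complex_of_real (ln (cmod (poly p z))))"
    by (rule integrable_cong_AE_imp[OF gi pm']) (use ae in \<open>simp add: eq_commute\<close>)
  have "(\<integral>z. laplacian \<phi> z * complex_of_real (ln (cmod (poly p z))) \<partial>lborel) = (\<integral>z. ?g z \<partial>lborel)"
    by (rule integral_cong_AE[OF pm' borel_measurable_integrable[OF gi]]) (use ae in \<open>simp add: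
        eq_commute\<close>)
  also have "\<dots> = (\<integral>z. laplacian \<phi> z * complex_of_real (ln (cmod (lead_coeff p))) \<partial>lborel) +
      (\<Sum>i<degree p. \<integral>z. laplacian \<phi> z * complex_of_real (ln (cmod (z - r i))) \<partial>lborel)"
    using i1 i2 by (simp add: Bochner_Integration.integral_sum Bochner_Integration.integral_add)
  also have "\<dots> = 2 * of_real pi * (\<Sum>z\<in>#proots p. \<phi> z)"
    unfolding r' laplacian_log_integral(2)[OF \<phi>] by (simp add: integral_laplacian_eq_0[OF \<phi>]
        sum_distrib_left)
  finally show "(\<integral>z. laplacian \<phi> z * complex_of_real (ln (cmod (poly p z))) \<partial>lborel)
    = 2 * of_real pi * (\<Sum>z\<in>#proots p. \<phi> z)" .
qed

text \<open>A nonnegative logarithm is at most ln 2 + n ln c <= n c. A negative one is bounded in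
  modulus by the sum of the negative parts of the n logarithms, and Cauchy-Schwarz bounds the square
  of that sum by n times the sum of squares. A vanishing product falls under the first case because
  \<open>ln 0 = 0\<close>.\<close>

lemma log_poly_sq_le:
  fixes r :: "nat \<Rightarrow> complex"
  assumes n: "n > 0" and c: "c \<ge> 1" and le: "cmod (2 * (\<Prod>i<n. z - r i)) \<le> 2 * c ^ n"
  shows "(ln (cmod (2 * (\<Prod>i<n. z - r i))) / n)\<^sup>2 \<le> c\<^sup>2 + (\<Sum>i<n. neglog_sq (z - r i)) / n"
proof -
  define L where "L = ln (cmod (2 * (\<Prod>i<n. z - r i)))"
  have nonneg: "(\<Sum>i<n. neglog_sq (z - r i)) / n \<ge> 0" by (simp add: sum_nonneg)
  show ?thesis
  proof (cases "L \<ge> 0")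
    case True
    have "L \<le> n * c"
    proof (cases "(\<Prod>i<n. z - r i) = 0")
      case True
      then have "L = 0" unfolding L_def by (simp only: mult_zero_right norm_zero ln_0)
      then show ?thesis using c n by simp
    next
      case False
      then have "0 < cmod (2 * (\<Prod>i<n. z - r i))"
        by (subst zero_less_norm_iff) simp
      then have "L \<le> ln (2 * c ^ n)"
        unfolding L_def by (rule ln_mono[OF le])
      also have "\<dots> = ln 2 + n * ln c" using c by (simp add: ln_mult ln_realpow)
      also have "\<dots> \<le> 1 + n * (c - 1)"
      proof (intro add_mono mult_left_mono)
        show "ln 2 \<le> (1::real)" using ln_le_minus_one[of 2] by simp
        show "ln c \<le> c - 1" using c by (intro ln_le_minus_one) auto
      qed simp
      also have "\<dots> \<le> n * c" using n by (simp add: algebra_simps)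
      finally show ?thesis .
    qed
    then have "L / n \<le> c" using n by (simp add: field_simps)
    then have "(L / n)\<^sup>2 \<le> c\<^sup>2" using True by (intro power_mono) auto
    then show ?thesis using nonneg unfolding L_def by linarith
  next
    case False
    have nz: "(\<Prod>i<n. z - r i) \<noteq> 0"
    proof
      assume eq: "(\<Prod>i<n. z - r i) = 0"
      have "L = 0" unfolding L_def by (simp only: eq mult_zero_right norm_zero ln_0)
      with False show False by simp
    qed
    let ?m = "\<lambda>i. min 0 (ln (cmod (z - r i)))"
    have "L = ln 2 + (\<Sum>i<n. ln (cmod (z - r i)))"
      unfolding L_def using nz by (subst ln_cmod_prod) auto
    then have "(\<Sum>i<n. ln (cmod (z - r i))) \<le> L" by simp
    moreover have "(\<Sum>i<n. ?m i) \<le> (\<Sum>i<n. ln (cmod (z - r i)))"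
      by (intro sum_mono) simp
    ultimately have "\<bar>L\<bar> \<le> \<bar>\<Sum>i<n. ?m i\<bar>" using False by linarith
    then have "L\<^sup>2 \<le> (\<Sum>i<n. ?m i)\<^sup>2" by (simp only: abs_le_square_iff)
    also have "\<dots> \<le> (\<Sum>i<n. (?m i)\<^sup>2) * card {..<n}" by (rule sum_squared_le_sum_of_squares)
    also have "\<dots> = (\<Sum>i<n. neglog_sq (z - r i)) * n" by (simp add: neglog_sq_def)
    finally have "L\<^sup>2 \<le> (\<Sum>i<n. neglog_sq (z - r i)) * n" .
    then have "(L / n)\<^sup>2 \<le> (\<Sum>i<n. neglog_sq (z - r i)) / n"
      using n by (simp add: power_divide power2_eq_square[of "real n"] field_simps)
    then show ?thesis unfolding L_def[symmetric] using zero_le_power2[of c] by linarith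
  qed
qed

text \<open>The singular terms are averaged over n roots, and each has the same integral by
  \<open>nn_integral_neglog_sq_shift\<close>; hence the bound depends neither on n nor on the
  roots.\<close>

lemma log_poly_sq_nn_integral_le:
  fixes p :: "complex poly"
  assumes "lead_coeff p = 2" "degree p = n" "n > 0" "c \<ge> 1"
    and le: "\<And>z. z \<in> cball 0 R \<Longrightarrow> cmod (poly p z) \<le> 2 * c ^ n"
  shows "(\<integral>\<^sup>+z. ennreal (indicator (cball 0 R) z * (ln (cmod (poly p z)) / n)\<^sup>2) \<partial>lborel)
    \<le> ennreal (c\<^sup>2) * emeasure lborel (cball (0::complex) R) + ennreal (\<integral>z. neglog_sq z \<partial>lborel)"
proof -
  obtain r where r: "\<And>z. poly p z = lead_coeff p * (\<Prod>i<degree p. z - r i)"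
    using complex_poly_roots_enum[of p] by blast
  have r2: "poly p z = 2 * (\<Prod>i<n. z - r i)" for z using r[of z] assms(1,2) by simp
  have "(\<integral>\<^sup>+z. ennreal (indicator (cball 0 R) z * (ln (cmod (poly p z)) / n)\<^sup>2) \<partial>lborel)
      \<le> (\<integral>\<^sup>+z. ennreal (c\<^sup>2) * indicator (cball 0 R) z + ennreal (1 / n) * (\<Sum>i<n. ennreal
          (neglog_sq (z - r i))) \<partial>lborel)"
  proof (rule nn_integral_mono)
    fix z
    have eq: "ennreal (1 / n) * (\<Sum>i<n. ennreal (neglog_sq (z - r i))) = ennreal ((\<Sum>i<n. neglog_sq
        (z - r i)) / n)"
      by (subst sum_ennreal) (simp_all add: ennreal_mult[symmetric] sum_nonneg)
    show "ennreal (indicator (cball 0 R) z * (ln (cmod (poly p z)) / n)\<^sup>2)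
        \<le> ennreal (c\<^sup>2) * indicator (cball 0 R) z + ennreal (1 / n) * (\<Sum>i<n. ennreal (neglog_sq (z
            - r i)))"
    proof (cases "z \<in> cball 0 R")
      case True
      have "(ln (cmod (poly p z)) / n)\<^sup>2 \<le> c\<^sup>2 + (\<Sum>i<n. neglog_sq (z - r i)) / n"
        unfolding r2 using le[OF True] assms(3,4) unfolding r2 by (intro log_poly_sq_le)
      then have "ennreal ((ln (cmod (poly p z)) / n)\<^sup>2) \<le> ennreal (c\<^sup>2 + (\<Sum>i<n. neglog_sq (z - r
          i)) / n)"
        by (rule ennreal_leI)
      also have "\<dots> = ennreal (c\<^sup>2) + ennreal ((\<Sum>i<n. neglog_sq (z - r i)) / n)"
        by (intro ennreal_plus) (auto simp: sum_nonneg)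
      finally show ?thesis using True unfolding eq by simp
    qed simp
  qed
  also have "\<dots> = ennreal (c\<^sup>2) * emeasure lborel (cball (0::complex) R) + ennreal (1 / n) * (\<Sum>i<n.
      \<integral>\<^sup>+z. ennreal (neglog_sq (z - r i)) \<partial>lborel)"
    by (subst nn_integral_add)
      (auto simp: nn_integral_cmult_indicator nn_integral_cmult nn_integral_sum simp del:
          sum_ennreal)
  also have "ennreal (1 / n) * (\<Sum>i<n. \<integral>\<^sup>+z. ennreal (neglog_sq (z - r i)) \<partial>lborel) = ennreal (\<integral>z.
      neglog_sq z \<partial>lborel)"
  proof -
    have "ennreal (1 / n) * (of_nat n * ennreal x) = ennreal x" if "x \<ge> 0" for x
      using assms(3) that by (simp add: ennreal_of_nat_eq_real_of_nat ennreal_mult[symmetric])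
    then show ?thesis by (simp add: nn_integral_neglog_sq_shift integral_nonneg_AE)
  qed
  finally show ?thesis .
qed

text \<open>Both summands are monic of the same degree, so the top coefficients cannot cancel and
  the normalisation by 1/n accounts for every zero.\<close>

lemma lead_coeff_sum_root_poly:
  "degree (root_poly x n + root_poly y n) = n" "lead_coeff (root_poly x n + root_poly y n) = 2"
proof -
  have deg: "degree (root_poly x n) = n" for x
    unfolding root_poly_def by (subst degree_prod_sum_eq) auto
  have "lead_coeff (root_poly x n) = 1" for x
    unfolding root_poly_def lead_coeff_prod by simp
  then have co: "coeff (root_poly x n) n = 1" for x by (simp add: deg)
  have c2: "coeff (root_poly x n + root_poly y n) n = 2" by (simp add: co)
  have "degree (root_poly x n + root_poly y n) \<le> n"
    by (rule degree_add_le) (simp_all add: deg)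
  moreover have "n \<le> degree (root_poly x n + root_poly y n)"
    by (rule le_degree) (simp only: c2, simp)
  ultimately show d: "degree (root_poly x n + root_poly y n) = n" by simp
  show "lead_coeff (root_poly x n + root_poly y n) = 2" by (simp only: d c2)
qed

section \<open>Uniform second moments and convergence in L1\<close>

context two_samples
begin

lemma F_sq_bound:
  assumes R: "R > 0"
  obtains C where "C \<ge> 0" and "AE \<omega> in M. \<forall>n>0. (\<integral>\<^sup>+z. ennreal (indicator (cball 0 R) z * (F n z
      \<omega>)\<^sup>2) \<partial>lborel) \<le> ennreal C"
proof -
  \<comment> \<open>R + K bounds the distance from a point of the ball to a sample point; the
    summand 1 ensures c >= 1, as \<open>log_poly_sq_le\<close> requires.\<close>
  let ?c = "1 + R + K"
  have c: "?c \<ge> 1" using R A.K_nonneg by simp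
  let ?C = "?c\<^sup>2 * measure lborel (cball (0::complex) R) + (\<integral>z. neglog_sq z \<partial>lborel)"
  have C0: "?C \<ge> 0" by (intro add_nonneg_nonneg mult_nonneg_nonneg) (auto intro: integral_nonneg_AE)
  have Ceq: "ennreal (?c\<^sup>2) * emeasure lborel (cball (0::complex) R) + ennreal (\<integral>z. neglog_sq z
      \<partial>lborel) = ennreal ?C"
  proof -
    have "emeasure lborel (cball (0::complex) R) = ennreal (measure lborel (cball (0::complex) R))"
      using emeasure_bounded_finite[of "cball (0::complex) R"] by (intro
          emeasure_eq_ennreal_measure) auto
    then show ?thesis
      by (simp add: ennreal_mult integral_nonneg_AE)
  qed
  have "AE \<omega> in M. \<forall>n>0. (\<integral>\<^sup>+z. ennreal (indicator (cball 0 R) z * (F n z \<omega>)\<^sup>2) \<partial>lborel) \<le> ennreal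
      ?C"
    using AE_X[OF A.AE_bound] AE_Y[OF B.AE_bound]
  proof eventually_elim
    case (elim \<omega>)
    show ?case
    proof (intro allI impI)
      fix n :: nat assume n: "n > 0"
      have "cmod (poly (pq n \<omega>) z) \<le> 2 * ?c ^ n" if z: "z \<in> cball 0 R" for z
      proof -
        have 1: "cmod (z - x) \<le> ?c" if "cmod x \<le> K" for x
          using z that norm_triangle_ineq4[of z x] by simp
        have "(\<Prod>i<n. cmod (z - X (Suc i) \<omega>)) \<le> (\<Prod>i<n. ?c)" "(\<Prod>i<n. cmod (z - Y (Suc i) \<omega>)) \<le>
            (\<Prod>i<n. ?c)"
          using elim 1 by (intro prod_mono; simp)+
        then have "cmod (\<Prod>i<n. z - X (Suc i) \<omega>) \<le> ?c ^ n" "cmod (\<Prod>i<n. z - Y (Suc i) \<omega>) \<le> ?c ^ n"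
          by (simp_all add: prod_norm)
        then show ?thesis
          unfolding poly_pq using norm_triangle_ineq[of "\<Prod>i<n. z - X (Suc i) \<omega>" "\<Prod>i<n. z - Y (Suc
              i) \<omega>"] by linarith
      qed
      moreover have "degree (pq n \<omega>) = n" "lead_coeff (pq n \<omega>) = 2"
        unfolding pq_def by (rule lead_coeff_sum_root_poly)+
      ultimately show "(\<integral>\<^sup>+z. ennreal (indicator (cball 0 R) z * (F n z \<omega>)\<^sup>2) \<partial>lborel) \<le> ennreal ?C"
        unfolding F_def Ceq[symmetric] using n c by (intro log_poly_sq_nn_integral_le)
    qed
  qed
  with C0 show ?thesis by (rule that)
qed

lemma u_sq_integrable: "integrable lborel (\<lambda>z. indicator (cball 0 R) z * (u z)\<^sup>2)"
proof (rule Bochner_Integration.integrable_bound)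
  show "integrable lborel (\<lambda>z. indicator (cball 0 R) z * (log_pot \<mu> z)\<^sup>2 + indicator (cball 0 R) z
      * (log_pot \<nu> z)\<^sup>2)"
    by (intro Bochner_Integration.integrable_add A.log_pot_sq_integrable B.log_pot_sq_integrable)
  have "(u z)\<^sup>2 \<le> (log_pot \<mu> z)\<^sup>2 + (log_pot \<nu> z)\<^sup>2" for z
    by (simp add: u_def max_def)
  then show "AE z in lborel. norm (indicator (cball 0 R) z * (u z)\<^sup>2)
      \<le> norm (indicator (cball 0 R) z * (log_pot \<mu> z)\<^sup>2 + indicator (cball 0 R) z * (log_pot \<nu>
          z)\<^sup>2)"
    by (intro AE_I2) (simp add: indicator_def)
qed simp

lemma u_locally_integrable: "integrable lborel (\<lambda>z. indicator (cball 0 R) z * u z)"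
proof (rule Bochner_Integration.integrable_bound)
  show "integrable lborel (\<lambda>z. \<bar>indicator (cball 0 R) z * log_pot \<mu> z\<bar> + \<bar>indicator (cball 0 R) z
      * log_pot \<nu> z\<bar>)"
    by (intro Bochner_Integration.integrable_add integrable_abs A.log_pot_locally_integrable
        B.log_pot_locally_integrable)
  show "AE z in lborel. norm (indicator (cball 0 R) z * u z)
      \<le> norm (\<bar>indicator (cball 0 R) z * log_pot \<mu> z\<bar> + \<bar>indicator (cball 0 R) z * log_pot \<nu> z\<bar>)"
    by (intro AE_I2) (auto simp: indicator_def u_def max_def)
qed simp

end

context two_samples
begin

lemma bad_set_measurable [measurable]:
  "(\<lambda>p. if \<bar>F n (fst p) (snd p) - u (fst p)\<bar> > \<epsilon> then 1 else (0::real)) \<in> borel_measurable (borel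
      \<Otimes>\<^sub>M M)"
  by measurable

lemma prob_bad_eq:
  "prob {\<omega> \<in> space M. \<bar>F n z \<omega> - u z\<bar> > \<epsilon>} = (\<integral>\<omega>. (if \<bar>F n z \<omega> - u z\<bar> > \<epsilon> then 1 else 0) \<partial>M)"
proof -
  have "(\<integral>\<omega>. (if \<bar>F n z \<omega> - u z\<bar> > \<epsilon> then 1 else (0::real)) \<partial>M) = (\<integral>\<omega>. indicator {\<omega> \<in> space M. \<bar>F
      n z \<omega> - u z\<bar> > \<epsilon>} \<omega> \<partial>M)"
    by (intro Bochner_Integration.integral_cong) (auto simp: indicator_def)
  then show ?thesis by simp
qed

lemma prob_bad_measurable [measurable]:
  "(\<lambda>z. prob {\<omega> \<in> space M. \<bar>F n z \<omega> - u z\<bar> > \<epsilon>}) \<in> borel_measurable borel"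
proof -
  have "case_prod (\<lambda>z \<omega>. if \<bar>F n z \<omega> - u z\<bar> > \<epsilon> then 1 else (0::real)) \<in> borel_measurable (borel
      \<Otimes>\<^sub>M M)"
    using bad_set_measurable[of \<epsilon> n] by (simp add: split_beta')
  then show ?thesis
    unfolding prob_bad_eq by (rule borel_measurable_lebesgue_integral)
qed

text \<open>Dominated convergence over the ball, from the convergence in probability at almost every
  z.\<close>

lemma bad_volume_tendsto_0:
  assumes circle: "\<not> supported_on_circle \<mu>" and e: "\<epsilon> > 0"
  shows "(\<lambda>n. \<integral>z. indicator (cball 0 R) z * prob {\<omega> \<in> space M. \<bar>F n z \<omega> - u z\<bar> > \<epsilon>} \<partial>lborel) \<longlonglongrightarrow> 0"
proof -
  have "(\<lambda>n. \<integral>z. indicator (cball 0 R) z * prob {\<omega> \<in> space M. \<bar>F n z \<omega> - u z\<bar> > \<epsilon>} \<partial>lborel)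
      \<longlonglongrightarrow> (\<integral>z. (0::real) \<partial>(lborel :: complex measure))"
  proof (rule integral_dominated_convergence[where w="indicator (cball 0 R)"])
    show "AE z in lborel. (\<lambda>n. indicator (cball 0 R) z * prob {\<omega> \<in> space M. \<bar>F n z \<omega> - u z\<bar> > \<epsilon>})
        \<longlonglongrightarrow> 0"
      using A.AE_lborel_tame B.AE_lborel_tame
    proof eventually_elim
      case (elim z)
      show ?case
        using tendsto_mult_left[OF F_converges_in_prob[OF elim circle e], of "indicator (cball 0
            R) z"] by simp
    qed
    show "AE z in lborel. norm (indicator (cball 0 R) z * prob {\<omega> \<in> space M. \<bar>F n z \<omega> - u z\<bar> > \<epsilon>})
        \<le> indicator (cball 0 R) z" for n
      by (intro AE_I2) (simp add: indicator_def)
  qed (simp_all add: integrable_indicator_cball)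
  then show ?thesis by simp
qed

text \<open>With values in \<open>ennreal\<close>, Tonelli and Markov apply without integrability
  side conditions.\<close>

definition L1_dist :: "real \<Rightarrow> nat \<Rightarrow> 'a \<Rightarrow> ennreal" where
  "L1_dist R n \<omega> = (\<integral>\<^sup>+z. ennreal (indicator (cball 0 R) z * \<bar>F n z \<omega> - u z\<bar>) \<partial>lborel)"

lemma L1_dist_measurable [measurable]: "L1_dist R n \<in> borel_measurable M"
proof -
  have "case_prod (\<lambda>\<omega> z. ennreal (indicator (cball 0 R) z * \<bar>F n z \<omega> - u z\<bar>)) \<in> borel_measurable
      (M \<Otimes>\<^sub>M lborel)"
  proof -
    have "(\<lambda>p. (snd p, fst p)) \<in> M \<Otimes>\<^sub>M lborel \<rightarrow>\<^sub>M borel \<Otimes>\<^sub>M M" by measurable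
    from measurable_compose[OF this F_measurable[of n]]
    have [measurable]: "(\<lambda>p. F n (snd p) (fst p)) \<in> borel_measurable (M \<Otimes>\<^sub>M lborel)" by simp
    show ?thesis unfolding split_beta' by measurable
  qed
  then show ?thesis
    unfolding L1_dist_def by (rule lborel.borel_measurable_nn_integral)
qed

text \<open>A uniform integrability argument. Where |F - u| exceeds \<epsilon>, it is at most \<eta>
  |F - u|^2 + 1/(4 \<eta>). The quadratic term has a bounded integral and is made small by \<eta>;
  the constant is weighted by the expected volume of the bad set, which tends to 0 once \<epsilon>
  and \<eta> are fixed.\<close>

theorem L1_dist_eventually_small:
  assumes circle: "\<not> supported_on_circle \<mu>" and R: "R > 0" and r: "r > 0"
  shows "\<forall>\<^sub>F n in sequentially. (\<integral>\<^sup>+\<omega>. L1_dist R n \<omega> \<partial>M) < ennreal r"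
proof -
  interpret P: pair_sigma_finite lborel M ..
  obtain C where C: "C \<ge> 0"
    and CF: "AE \<omega> in M. \<forall>n>0. (\<integral>\<^sup>+z. ennreal (indicator (cball 0 R) z * (F n z \<omega>)\<^sup>2) \<partial>lborel) \<le>
        ennreal C"
    using F_sq_bound[OF R] by blast
  let ?I = "\<lambda>z. indicator (cball (0::complex) R) z :: real"
  define U where "U = (\<integral>z. ?I z * (u z)\<^sup>2 \<partial>lborel)"
  define V where "V = measure lborel (cball (0::complex) R)"
  have U: "U \<ge> 0" unfolding U_def by (rule integral_nonneg_AE) simp
  have V: "V \<ge> 0" by (simp add: V_def)
  \<comment> \<open>Both parameters are chosen so that their terms contribute at most r/4; the
    summands 1 keep the denominators positive.\<close>
  define \<epsilon> where "\<epsilon> = r / (4 * (V + 1))"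
  define \<eta> where "\<eta> = r / (4 * (2 * C + 2 * U + 1))"
  have \<epsilon>: "\<epsilon> > 0" using r V by (simp add: \<epsilon>_def)
  have \<eta>: "\<eta> > 0" using r C U by (simp add: \<eta>_def)
  let ?h = "\<lambda>n z \<omega>. if \<bar>F n z \<omega> - u z\<bar> > \<epsilon> then 1 else (0::real)"
  define Pn where "Pn n = (\<integral>z. ?I z * prob {\<omega> \<in> space M. \<bar>F n z \<omega> - u z\<bar> > \<epsilon>} \<partial>lborel)" for n
  have Pn_nonneg: "Pn n \<ge> 0" for n unfolding Pn_def by (rule integral_nonneg_AE) simp
  have pw: "\<bar>F n z \<omega> - u z\<bar> \<le> \<epsilon> + 2 * \<eta> * (F n z \<omega>)\<^sup>2 + 2 * \<eta> * (u z)\<^sup>2 + 1 / (4 * \<eta>) * ?h n z \<omega>"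
      for n z \<omega>
  proof -
    define x where "x = F n z \<omega> - u z"
    have x2: "x\<^sup>2 \<le> 2 * (F n z \<omega>)\<^sup>2 + 2 * (u z)\<^sup>2"
      using zero_le_power2[of "F n z \<omega> + u z"] by (simp add: x_def power2_sum power2_diff)
    have rest: "0 \<le> 2 * \<eta> * (F n z \<omega>)\<^sup>2 + 2 * \<eta> * (u z)\<^sup>2" using \<eta> by simp
    show ?thesis
    proof (cases "\<bar>x\<bar> > \<epsilon>")
      case True
      \<comment> \<open>AM-GM: \<open>\<bar>x\<bar> \<le> \<eta> x\<^sup>2 + 1 / (4 \<eta>)\<close>\<close>
      have "0 \<le> (2 * \<eta> * \<bar>x\<bar> - 1)\<^sup>2" by simp
      also have "(2 * \<eta> * \<bar>x\<bar> - 1)\<^sup>2 = 4 * \<eta> * (\<eta> * x\<^sup>2 - \<bar>x\<bar>) + 1"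
        by (simp add: power2_diff power_mult_distrib algebra_simps power2_eq_square)
      finally have "4 * \<eta> * (\<bar>x\<bar> - \<eta> * x\<^sup>2) \<le> 1" by (simp add: algebra_simps)
      then have "\<bar>x\<bar> - \<eta> * x\<^sup>2 \<le> 1 / (4 * \<eta>)" using \<eta> by (simp add: pos_le_divide_eq mult.commute)
      moreover have "\<eta> * x\<^sup>2 \<le> \<eta> * (2 * (F n z \<omega>)\<^sup>2 + 2 * (u z)\<^sup>2)"
        using x2 \<eta> by (intro mult_left_mono) auto
      ultimately have "\<bar>x\<bar> \<le> 2 * \<eta> * (F n z \<omega>)\<^sup>2 + 2 * \<eta> * (u z)\<^sup>2 + 1 / (4 * \<eta>)"
        by (simp add: algebra_simps)
      then show ?thesis using True \<epsilon> by (simp add: x_def)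
    next
      case False
      then show ?thesis using rest by (simp add: x_def)
    qed
  qed
  have Vfin: "(\<integral>\<^sup>+z. ennreal (\<epsilon> * ?I z) \<partial>lborel) = ennreal (\<epsilon> * V)"
  proof -
    have "emeasure lborel (cball (0::complex) R) = ennreal V"
      unfolding V_def using emeasure_bounded_finite[of "cball (0::complex) R"] by (intro
          emeasure_eq_ennreal_measure) auto
    moreover have "(\<integral>\<^sup>+z. ennreal (\<epsilon> * ?I z) \<partial>lborel) = (\<integral>\<^sup>+z. ennreal \<epsilon> * indicator (cball 0 R) z
        \<partial>(lborel :: complex measure))"
      by (intro nn_integral_cong) (simp add: indicator_def)
    ultimately show ?thesis using \<epsilon> V by (simp add: nn_integral_cmult_indicator ennreal_mult)
  qed
  have Ufin: "(\<integral>\<^sup>+z. ennreal (2 * \<eta> * (?I z * (u z)\<^sup>2)) \<partial>lborel) = ennreal (2 * \<eta> * U)"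
    unfolding U_def using u_sq_integrable[of R] \<eta>
    by (subst nn_integral_eq_integral) auto
  have bound: "(\<integral>\<^sup>+\<omega>. L1_dist R n \<omega> \<partial>M) \<le> ennreal (\<epsilon> * V + 2 * \<eta> * C + 2 * \<eta> * U + 1 / (4 * \<eta>) *
      Pn n)" if n: "n > 0" for n
  proof -
    have [measurable]: "F n z \<in> borel_measurable M" "(\<lambda>z. F n z \<omega>) \<in> borel_measurable borel" for z \<omega>
      unfolding F_def poly_pq by measurable
    have meas_h: "case_prod (\<lambda>\<omega> z. ennreal (1 / (4 * \<eta>) * (?I z * ?h n z \<omega>))) \<in> borel_measurable
        (M \<Otimes>\<^sub>M lborel)"
    proof -
      have "(\<lambda>p. (snd p, fst p)) \<in> M \<Otimes>\<^sub>M lborel \<rightarrow>\<^sub>M borel \<Otimes>\<^sub>M M" by measurable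
      from measurable_compose[OF this F_measurable[of n]]
      have [measurable]: "(\<lambda>p. F n (snd p) (fst p)) \<in> borel_measurable (M \<Otimes>\<^sub>M lborel)" by simp
      show ?thesis unfolding split_beta' by measurable
    qed
    have inner_meas: "(\<lambda>\<omega>. \<integral>\<^sup>+z. ennreal (1 / (4 * \<eta>) * (?I z * ?h n z \<omega>)) \<partial>lborel) \<in>
        borel_measurable M"
      by (rule lborel.borel_measurable_nn_integral[OF meas_h])
    have "AE \<omega> in M. L1_dist R n \<omega> \<le> ennreal (\<epsilon> * V + 2 * \<eta> * C + 2 * \<eta> * U) + (\<integral>\<^sup>+z. ennreal (1 /
        (4 * \<eta>) * (?I z * ?h n z \<omega>)) \<partial>lborel)"
      using CF
    proof eventually_elim
      case (elim \<omega>)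
      let ?a = "\<lambda>z. ennreal (\<epsilon> * ?I z)" and ?b = "\<lambda>z. ennreal (2 * \<eta>) * ennreal (?I z * (F n z
          \<omega>)\<^sup>2)"
        and ?c = "\<lambda>z. ennreal (2 * \<eta> * (?I z * (u z)\<^sup>2))" and ?d = "\<lambda>z. ennreal (1 / (4 * \<eta>) * (?I
            z * ?h n z \<omega>))"
      have "L1_dist R n \<omega> \<le> (\<integral>\<^sup>+z. ?a z + ?b z + ?c z + ?d z \<partial>lborel)"
        unfolding L1_dist_def
      proof (rule nn_integral_mono)
        fix z
        show "ennreal (?I z * \<bar>F n z \<omega> - u z\<bar>) \<le> ?a z + ?b z + ?c z + ?d z"
        proof (cases "z \<in> cball 0 R")
          case True
          have "ennreal \<bar>F n z \<omega> - u z\<bar> \<le> ennreal (\<epsilon> + 2 * \<eta> * (F n z \<omega>)\<^sup>2 + 2 * \<eta> * (u z)\<^sup>2 + 1 /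
              (4 * \<eta>) * ?h n z \<omega>)"
            by (rule ennreal_leI[OF pw])
          also have "\<dots> = ennreal \<epsilon> + ennreal (2 * \<eta> * (F n z \<omega>)\<^sup>2) + ennreal (2 * \<eta> * (u z)\<^sup>2) +
              ennreal (1 / (4 * \<eta>) * ?h n z \<omega>)"
            using \<epsilon> \<eta> by (simp add: ennreal_plus[symmetric] del: ennreal_plus)
          also have "ennreal (2 * \<eta> * (F n z \<omega>)\<^sup>2) = ennreal (2 * \<eta>) * ennreal ((F n z \<omega>)\<^sup>2)"
            using \<eta> by (intro ennreal_mult) auto
          finally show ?thesis using True by simp
        qed simp
      qed
      also have "\<dots> = (\<integral>\<^sup>+z. ?a z \<partial>lborel) + (\<integral>\<^sup>+z. ?b z \<partial>lborel) + (\<integral>\<^sup>+z. ?c z \<partial>lborel) + (\<integral>\<^sup>+z.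
          ?d z \<partial>lborel)"
        by (subst nn_integral_add, simp, simp)+ simp
      also have "(\<integral>\<^sup>+z. ?b z \<partial>lborel) \<le> ennreal (2 * \<eta>) * ennreal C"
        using elim n by (subst nn_integral_cmult) (auto intro!: mult_left_mono)
      finally have "L1_dist R n \<omega> \<le> ennreal (\<epsilon> * V) + ennreal (2 * \<eta>) * ennreal C + ennreal (2 * \<eta>
          * U) + (\<integral>\<^sup>+z. ?d z \<partial>lborel)"
        unfolding Vfin Ufin by (simp add: add_right_mono add_left_mono)
      also have "ennreal (\<epsilon> * V) + ennreal (2 * \<eta>) * ennreal C + ennreal (2 * \<eta> * U) = ennreal (\<epsilon>
          * V + 2 * \<eta> * C + 2 * \<eta> * U)"
        using \<epsilon> \<eta> V U C by (simp add: ennreal_plus[symmetric] ennreal_mult[symmetric] del: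
            ennreal_plus)
      finally show ?case .
    qed
    then have "(\<integral>\<^sup>+\<omega>. L1_dist R n \<omega> \<partial>M) \<le> (\<integral>\<^sup>+\<omega>. ennreal (\<epsilon> * V + 2 * \<eta> * C + 2 * \<eta> * U) + (\<integral>\<^sup>+z.
        ennreal (1 / (4 * \<eta>) * (?I z * ?h n z \<omega>)) \<partial>lborel) \<partial>M)"
      by (rule nn_integral_mono_AE)
    also have "\<dots> = ennreal (\<epsilon> * V + 2 * \<eta> * C + 2 * \<eta> * U) + (\<integral>\<^sup>+\<omega>. \<integral>\<^sup>+z. ennreal (1 / (4 * \<eta>) *
        (?I z * ?h n z \<omega>)) \<partial>lborel \<partial>M)"
      using inner_meas by (subst nn_integral_add) (simp_all add: emeasure_space_1)
    also have "(\<integral>\<^sup>+\<omega>. \<integral>\<^sup>+z. ennreal (1 / (4 * \<eta>) * (?I z * ?h n z \<omega>)) \<partial>lborel \<partial>M)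
        = (\<integral>\<^sup>+z. \<integral>\<^sup>+\<omega>. ennreal (1 / (4 * \<eta>) * (?I z * ?h n z \<omega>)) \<partial>M \<partial>lborel)"
    proof (rule P.Fubini')
      show "case_prod (\<lambda>z \<omega>. ennreal (1 / (4 * \<eta>) * (?I z * ?h n z \<omega>))) \<in> borel_measurable (lborel
          \<Otimes>\<^sub>M M)"
        unfolding split_beta' by measurable
    qed
    also have "\<dots> = (\<integral>\<^sup>+z. ennreal (1 / (4 * \<eta>) * (?I z * prob {\<omega> \<in> space M. \<bar>F n z \<omega> - u z\<bar> > \<epsilon>}))
        \<partial>lborel)"
    proof (rule nn_integral_cong)
      fix z
      have i: "integrable M (?h n z)"
        by (rule integrable_const_bound[of _ 1]) auto
      show "(\<integral>\<^sup>+\<omega>. ennreal (1 / (4 * \<eta>) * (?I z * ?h n z \<omega>)) \<partial>M) = ennreal (1 / (4 * \<eta>) * (?I z *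
          prob {\<omega> \<in> space M. \<bar>F n z \<omega> - u z\<bar> > \<epsilon>}))"
      proof (subst nn_integral_eq_integral)
        show "integrable M (\<lambda>\<omega>. 1 / (4 * \<eta>) * (?I z * ?h n z \<omega>))"
          by (intro integrable_mult_right i)
        show "AE \<omega> in M. 0 \<le> 1 / (4 * \<eta>) * (?I z * ?h n z \<omega>)" using \<eta> by simp
        have "(\<integral>\<omega>. 1 / (4 * \<eta>) * (?I z * ?h n z \<omega>) \<partial>M) = 1 / (4 * \<eta>) * (?I z * (\<integral>\<omega>. ?h n z \<omega> \<partial>M))"
          by (simp only: integral_mult_right_zero)
        then show "ennreal (\<integral>\<omega>. 1 / (4 * \<eta>) * (?I z * ?h n z \<omega>) \<partial>M) = ennreal (1 / (4 * \<eta>) * (?I z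
            * prob {\<omega> \<in> space M. \<bar>F n z \<omega> - u z\<bar> > \<epsilon>}))"
          by (simp only: prob_bad_eq)
      qed
    qed
    also have "\<dots> = ennreal (1 / (4 * \<eta>) * Pn n)"
    proof (subst nn_integral_eq_integral)
      have i: "integrable lborel (\<lambda>z. ?I z * prob {\<omega> \<in> space M. \<bar>F n z \<omega> - u z\<bar> > \<epsilon>})"
        by (rule Bochner_Integration.integrable_bound[OF integrable_indicator_cball[of 0 R]])
          (simp_all add: indicator_def)
      then show "integrable lborel (\<lambda>z. 1 / (4 * \<eta>) * (?I z * prob {\<omega> \<in> space M. \<bar>F n z \<omega> - u z\<bar> >
          \<epsilon>}))"
        by (rule integrable_mult_right)
      show "AE z in lborel. 0 \<le> 1 / (4 * \<eta>) * (?I z * prob {\<omega> \<in> space M. \<bar>F n z \<omega> - u z\<bar> > \<epsilon>})"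
        using \<eta> by simp
      show "ennreal (\<integral>z. 1 / (4 * \<eta>) * (?I z * prob {\<omega> \<in> space M. \<bar>F n z \<omega> - u z\<bar> > \<epsilon>}) \<partial>lborel) =
          ennreal (1 / (4 * \<eta>) * Pn n)"
        unfolding Pn_def by (simp only: integral_mult_right_zero)
    qed
    also have "ennreal (\<epsilon> * V + 2 * \<eta> * C + 2 * \<eta> * U) + ennreal (1 / (4 * \<eta>) * Pn n)
        = ennreal (\<epsilon> * V + 2 * \<eta> * C + 2 * \<eta> * U + 1 / (4 * \<eta>) * Pn n)"
      using \<epsilon> \<eta> V U C Pn_nonneg by (intro ennreal_plus[symmetric]) auto
    finally show ?thesis .
  qed
  have "Pn \<longlonglongrightarrow> 0"
    unfolding Pn_def by (rule bad_volume_tendsto_0[OF circle \<epsilon>])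
  then have "(\<lambda>n. 1 / (4 * \<eta>) * Pn n) \<longlonglongrightarrow> 1 / (4 * \<eta>) * 0"
    by (intro tendsto_intros)
  then have "\<forall>\<^sub>F n in sequentially. 1 / (4 * \<eta>) * Pn n < r / 4"
    by (rule order_tendstoD) (use r in simp)
  moreover have "\<forall>\<^sub>F n in sequentially. n > (0::nat)" by (rule eventually_gt_at_top)
  ultimately show ?thesis
  proof eventually_elim
    case (elim n)
    have "\<epsilon> * V \<le> \<epsilon> * (V + 1)" using \<epsilon> by simp
    also have "\<dots> = r / 4"
    proof -
      have "V + 1 \<noteq> 0" using V by linarith
      then show ?thesis unfolding \<epsilon>_def by (simp add: divide_simps)
    qed
    finally have 1: "\<epsilon> * V \<le> r / 4" .
    have "2 * \<eta> * C + 2 * \<eta> * U \<le> \<eta> * (2 * C + 2 * U + 1)" using \<eta> by (simp add: algebra_simps)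
    also have "\<dots> = r / 4"
    proof -
      have "2 * C + 2 * U + 1 \<noteq> 0" using C U by linarith
      then show ?thesis unfolding \<eta>_def by (simp add: divide_simps)
    qed
    finally have "\<epsilon> * V + 2 * \<eta> * C + 2 * \<eta> * U + 1 / (4 * \<eta>) * Pn n < r" using 1 elim(1) r by
        linarith
    then have "ennreal (\<epsilon> * V + 2 * \<eta> * C + 2 * \<eta> * U + 1 / (4 * \<eta>) * Pn n) < ennreal r"
      using r by (intro ennreal_lessI)
    with bound[OF elim(2)] show ?case by (rule le_less_trans)
  qed
qed

end

section \<open>Averages of test functions over the zeros\<close>

context two_samples
begin

text \<open>It depends on the locale parameters only through \<mu> and \<nu>, so its values agree
  for all sample spaces.\<close>

definition limit_functional :: "(complex \<Rightarrow> complex) \<Rightarrow> complex" where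
  "limit_functional \<phi> = 1 / (2 * of_real pi) * (\<integral>z. laplacian \<phi> z * complex_of_real (u z) \<partial>lborel)"

definition zero_average :: "(complex \<Rightarrow> complex) \<Rightarrow> nat \<Rightarrow> 'a \<Rightarrow> complex" where
  "zero_average \<phi> n \<omega> = 1 / of_nat n * (\<Sum>z\<in>#proots (pq n \<omega>). \<phi> z)"

lemma laplacian_times_locally_integrable:
  fixes g :: "complex \<Rightarrow> real"
  assumes \<phi>: "\<phi> \<in> Cc_infinity" and g: "\<And>R. integrable lborel (\<lambda>z. indicator (cball 0 R) z * g z)"
    and [measurable]: "g \<in> borel_measurable borel"
  shows "integrable lborel (\<lambda>z. laplacian \<phi> z * complex_of_real (g z))"
proof -
  obtain R C where C: "\<And>z. cmod (laplacian \<phi> z) \<le> C * indicator (cball 0 R) z"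
    using Cc_infinity_bounded[OF Cc_infinity_laplacian[OF \<phi>]] by metis
  have [measurable]: "laplacian \<phi> \<in> borel_measurable borel"
    by (rule Cc_infinity_measurable[OF Cc_infinity_laplacian[OF \<phi>]])
  show ?thesis
  proof (rule Bochner_Integration.integrable_bound)
    show "integrable lborel (\<lambda>z. C * (indicator (cball 0 R) z * g z))"
      by (intro integrable_mult_right g)
    show "AE z in lborel. norm (laplacian \<phi> z * complex_of_real (g z)) \<le> norm (C * (indicator
        (cball 0 R) z * g z))"
    proof (intro AE_I2)
      fix z
      have "cmod (laplacian \<phi> z) * \<bar>g z\<bar> \<le> C * indicator (cball 0 R) z * \<bar>g z\<bar>"
        by (intro mult_right_mono C) simp
      also have "\<dots> \<le> \<bar>C * (indicator (cball 0 R) z * g z)\<bar>"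
        by (simp add: abs_mult indicator_def mult_right_mono)
      finally show "norm (laplacian \<phi> z * complex_of_real (g z)) \<le> norm (C * (indicator (cball 0
          R) z * g z))"
        by (simp add: norm_mult)
    qed
  qed measurable
qed

lemma laplacian_u_integrable:
  "\<phi> \<in> Cc_infinity \<Longrightarrow> integrable lborel (\<lambda>z. laplacian \<phi> z * complex_of_real (u z))"
  by (rule laplacian_times_locally_integrable[OF _ u_locally_integrable u_measurable])

lemma pq_degree: "degree (pq n \<omega>) = n" "lead_coeff (pq n \<omega>) = 2" "pq n \<omega> \<noteq> 0"
proof -
  show "degree (pq n \<omega>) = n" "lead_coeff (pq n \<omega>) = 2"
    unfolding pq_def by (rule lead_coeff_sum_root_poly)+
  then show "pq n \<omega> \<noteq> 0" by auto
qed

lemma zero_average_eq: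
  assumes \<phi>: "\<phi> \<in> Cc_infinity" and n: "n > 0"
  shows "integrable lborel (\<lambda>z. laplacian \<phi> z * complex_of_real (F n z \<omega>))"
    and "zero_average \<phi> n \<omega> = 1 / (2 * of_real pi) * (\<integral>z. laplacian \<phi> z * complex_of_real (F n z
        \<omega>) \<partial>lborel)"
proof -
  have eq: "laplacian \<phi> z * complex_of_real (F n z \<omega>) = laplacian \<phi> z * complex_of_real (ln (cmod
      (poly (pq n \<omega>) z))) * (1 / of_nat n)" for z
    by (simp add: F_def)
  show "integrable lborel (\<lambda>z. laplacian \<phi> z * complex_of_real (F n z \<omega>))"
    unfolding eq by (intro integrable_mult_left laplacian_log_poly(1)[OF \<phi> pq_degree(3)])
  show "zero_average \<phi> n \<omega> = 1 / (2 * of_real pi) * (\<integral>z. laplacian \<phi> z * complex_of_real (F n z \<omega>)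
      \<partial>lborel)"
    unfolding eq integral_mult_left_zero laplacian_log_poly(2)[OF \<phi> pq_degree(3)] zero_average_def
    by simp
qed

text \<open>The estimate holds for each sample point separately, so it serves both convergence in
  probability and the selection of single polynomials. The factor 1/(2 pi) is simply bounded by
  1.\<close>

lemma zero_average_bound:
  assumes \<phi>: "\<phi> \<in> Cc_infinity"
  obtains R C where "R > 0" "C > 0"
    and "\<And>n \<omega>. n > 0 \<Longrightarrow> ennreal (cmod (zero_average \<phi> n \<omega> - limit_functional \<phi>)) \<le> ennreal C *
        L1_dist R n \<omega>"
proof -
  obtain R C where R: "R > 0" and C: "C > 0" "\<And>z. cmod (laplacian \<phi> z) \<le> C * indicator (cball 0 R)
      z"
    using Cc_infinity_bounded[OF Cc_infinity_laplacian[OF \<phi>]] by metis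
  have "ennreal (cmod (zero_average \<phi> n \<omega> - limit_functional \<phi>)) \<le> ennreal C * L1_dist R n \<omega>" if
      n: "n > 0" for n \<omega>
  proof -
    let ?g = "\<lambda>z. laplacian \<phi> z * complex_of_real (F n z \<omega>) - laplacian \<phi> z * complex_of_real (u z)"
    have gi: "integrable lborel ?g"
      by (intro Bochner_Integration.integrable_diff zero_average_eq(1) laplacian_u_integrable \<phi> n)
    have "zero_average \<phi> n \<omega> - limit_functional \<phi> = 1 / (2 * of_real pi) * (\<integral>z. ?g z \<partial>lborel)"
      unfolding zero_average_eq(2)[OF \<phi> n] limit_functional_def
      using zero_average_eq(1)[OF \<phi> n] laplacian_u_integrable[OF \<phi>]
      by (subst Bochner_Integration.integral_diff) (simp_all add: right_diff_distrib)
    then have "cmod (zero_average \<phi> n \<omega> - limit_functional \<phi>) = 1 / (2 * pi) * cmod (\<integral>z. ?g z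
        \<partial>lborel)"
      by (simp only: norm_mult) (simp add: norm_divide norm_mult)
    also have "\<dots> \<le> 1 * cmod (\<integral>z. ?g z \<partial>lborel)"
      using pi_gt3 by (intro mult_right_mono) auto
    finally have "ennreal (cmod (zero_average \<phi> n \<omega> - limit_functional \<phi>)) \<le> ennreal (cmod (\<integral>z. ?g
        z \<partial>lborel))"
      by (intro ennreal_leI) simp
    also have "\<dots> \<le> (\<integral>\<^sup>+z. ennreal (norm (?g z)) \<partial>lborel)"
      by (rule integral_norm_bound_ennreal[OF gi])
    also have "\<dots> \<le> (\<integral>\<^sup>+z. ennreal C * ennreal (indicator (cball 0 R) z * \<bar>F n z \<omega> - u z\<bar>) \<partial>lborel)"
    proof (rule nn_integral_mono)
      fix z
      have "norm (?g z) = cmod (laplacian \<phi> z) * \<bar>F n z \<omega> - u z\<bar>"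
        by (simp only: right_diff_distrib[symmetric] of_real_diff[symmetric] norm_mult norm_of_real)
      also have "\<dots> \<le> C * indicator (cball 0 R) z * \<bar>F n z \<omega> - u z\<bar>"
        by (intro mult_right_mono C) simp
      finally have "ennreal (norm (?g z)) \<le> ennreal (C * (indicator (cball 0 R) z * \<bar>F n z \<omega> - u
          z\<bar>))"
        by (intro ennreal_leI) (simp add: mult.assoc)
      also have "\<dots> = ennreal C * ennreal (indicator (cball 0 R) z * \<bar>F n z \<omega> - u z\<bar>)"
        using C(1) by (intro ennreal_mult) auto
      finally show "ennreal (norm (?g z)) \<le> ennreal C * ennreal (indicator (cball 0 R) z * \<bar>F n z
          \<omega> - u z\<bar>)" .
    qed
    also have "\<dots> = ennreal C * L1_dist R n \<omega>"
    proof -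
      have [measurable]: "(\<lambda>z. F n z \<omega>) \<in> borel_measurable borel"
        unfolding F_def poly_pq by measurable
      show ?thesis unfolding L1_dist_def by (rule nn_integral_cmult) measurable
    qed
    finally show ?thesis .
  qed
  with R C(1) show ?thesis by (rule that)
qed

text \<open>No measurable selection of roots is made: the average is an integral of the jointly
  measurable \<open>F\<close>, hence measurable by Fubini.\<close>

lemma zero_average_measurable:
  assumes \<phi>: "\<phi> \<in> Cc_infinity"
  shows "zero_average \<phi> n \<in> borel_measurable M"
proof (cases "n = 0")
  case True
  then have "zero_average \<phi> n = (\<lambda>_. 0)" by (simp add: fun_eq_iff zero_average_def)
  then show ?thesis by simp
next
  case False
  have [measurable]: "laplacian \<phi> \<in> borel_measurable borel"
    by (rule Cc_infinity_measurable[OF Cc_infinity_laplacian[OF \<phi>]])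
  have "(\<lambda>p. (snd p, fst p)) \<in> M \<Otimes>\<^sub>M lborel \<rightarrow>\<^sub>M borel \<Otimes>\<^sub>M M" by measurable
  from measurable_compose[OF this F_measurable[of n]]
  have [measurable]: "(\<lambda>p. F n (snd p) (fst p)) \<in> borel_measurable (M \<Otimes>\<^sub>M lborel)" by simp
  have "case_prod (\<lambda>\<omega> z. laplacian \<phi> z * complex_of_real (F n z \<omega>)) \<in> borel_measurable (M \<Otimes>\<^sub>M
      lborel)"
    unfolding split_beta' by measurable
  then have "(\<lambda>\<omega>. \<integral>z. laplacian \<phi> z * complex_of_real (F n z \<omega>) \<partial>lborel) \<in> borel_measurable M"
    by (rule lborel.borel_measurable_lebesgue_integral)
  moreover have "zero_average \<phi> n = (\<lambda>\<omega>. 1 / (2 * of_real pi) * (\<integral>z. laplacian \<phi> z *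
      complex_of_real (F n z \<omega>) \<partial>lborel))"
    using zero_average_eq(2)[OF \<phi>] False by (simp add: fun_eq_iff)
  ultimately show ?thesis by simp
qed

theorem zero_average_converges:
  assumes circle: "\<not> supported_on_circle \<mu>" and \<phi>: "\<phi> \<in> Cc_infinity"
  shows "converges_in_prob M (zero_average \<phi>) (limit_functional \<phi>)"
  unfolding converges_in_prob_def
proof (intro conjI allI impI)
  show [measurable]: "zero_average \<phi> n \<in> borel_measurable M" for n
    by (rule zero_average_measurable[OF \<phi>])
  fix \<epsilon> :: real assume e: "\<epsilon> > 0"
  obtain R C where R: "R > 0" and C: "C > 0"
    and le: "\<And>n \<omega>. n > 0 \<Longrightarrow> ennreal (cmod (zero_average \<phi> n \<omega> - limit_functional \<phi>)) \<le> ennreal C *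
        L1_dist R n \<omega>"
    using zero_average_bound[OF \<phi>] by blast
  show "(\<lambda>n. prob {\<omega> \<in> space M. cmod (zero_average \<phi> n \<omega> - limit_functional \<phi>) > \<epsilon>}) \<longlonglongrightarrow> 0"
  proof (rule LIMSEQ_I)
    fix r :: real assume r: "r > 0"
    \<comment> \<open>The tolerance for which Markov's inequality yields a probability below
      r.\<close>
    have pos: "r * \<epsilon> / C > 0" using r e C by simp
    have "\<forall>\<^sub>F n in sequentially. norm (prob {\<omega> \<in> space M. cmod (zero_average \<phi> n \<omega> -
        limit_functional \<phi>) > \<epsilon>} - 0) < r"
      using L1_dist_eventually_small[OF circle R pos] eventually_gt_at_top[of 0]
    proof eventually_elim
      case (elim n)
      let ?E = "{\<omega> \<in> space M. cmod (zero_average \<phi> n \<omega> - limit_functional \<phi>) > \<epsilon>}"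
      have E: "?E \<in> events" by measurable
      \<comment> \<open>Markov's inequality, with \<open>zero_average_bound\<close> inserted
        pointwise.\<close>
      have "ennreal \<epsilon> * emeasure M ?E = (\<integral>\<^sup>+\<omega>. ennreal \<epsilon> * indicator ?E \<omega> \<partial>M)"
        using E by (simp add: nn_integral_cmult_indicator)
      also have "\<dots> \<le> (\<integral>\<^sup>+\<omega>. ennreal C * L1_dist R n \<omega> \<partial>M)"
      proof (rule nn_integral_mono)
        fix \<omega>
        show "ennreal \<epsilon> * indicator ?E \<omega> \<le> ennreal C * L1_dist R n \<omega>"
        proof (cases "\<omega> \<in> ?E")
          case True
          then have "ennreal \<epsilon> \<le> ennreal (cmod (zero_average \<phi> n \<omega> - limit_functional \<phi>))"
            by (intro ennreal_leI) simp
          also have "\<dots> \<le> ennreal C * L1_dist R n \<omega>" by (rule le[OF elim(2)])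
          finally show ?thesis using True by simp
        qed simp
      qed
      also have "\<dots> = ennreal C * (\<integral>\<^sup>+\<omega>. L1_dist R n \<omega> \<partial>M)"
        by (rule nn_integral_cmult) measurable
      also have "\<dots> < ennreal C * ennreal (r * \<epsilon> / C)"
        using elim(1) C by (intro ennreal_mult_strict_left_mono) auto
      also have "\<dots> = ennreal (r * \<epsilon>)"
        using C r e by (simp add: ennreal_mult[symmetric])
      finally have "ennreal (\<epsilon> * prob ?E) < ennreal (r * \<epsilon>)"
        using e by (simp add: emeasure_eq_measure ennreal_mult)
      then have "\<epsilon> * prob ?E < r * \<epsilon>" using e by (simp add: ennreal_less_iff)
      then show ?case using e by simp
    qed
    then show "\<exists>n0. \<forall>n\<ge>n0. norm (prob {\<omega> \<in> space M. cmod (zero_average \<phi> n \<omega> - limit_functional \<phi>)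
        > \<epsilon>} - 0) < r"
      by (simp add: eventually_sequentially)
  qed
qed

lemma L1_dist_mono: "R \<le> S \<Longrightarrow> L1_dist R n \<omega> \<le> L1_dist S n \<omega>"
  unfolding L1_dist_def
  by (intro nn_integral_mono ennreal_leI mult_right_mono) (auto simp: indicator_def)

text \<open>A small expectation leaves some sample point with a small L1 distance. Asking for less
  than 1/(k+1) on the ball of radius k+1 makes one sequence work for all test functions at once,
  since every support is eventually covered.\<close>

lemma deterministic_polynomials:
  assumes circle: "\<not> supported_on_circle \<mu>"
  obtains p :: "nat \<Rightarrow> complex poly" where "\<And>k. degree (p k) > 0"
    and "\<And>\<phi>. \<phi> \<in> Cc_infinity \<Longrightarrow>
      (\<lambda>k. 1 / of_nat (degree (p k)) * (\<Sum>z\<in>#proots (p k). \<phi> z)) \<longlonglongrightarrow> limit_functional \<phi>"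
proof -
  have "\<exists>n \<omega>. n > 0 \<and> L1_dist (Suc k) n \<omega> < ennreal (1 / Suc k)" for k
  proof -
    have "\<forall>\<^sub>F n in sequentially. (\<integral>\<^sup>+\<omega>. L1_dist (Suc k) n \<omega> \<partial>M) < ennreal (1 / Suc k) \<and> n > 0"
      by (intro eventually_conj L1_dist_eventually_small circle eventually_gt_at_top) simp_all
    from eventually_happens'[OF sequentially_bot this]
    obtain n where n: "(\<integral>\<^sup>+\<omega>. L1_dist (Suc k) n \<omega> \<partial>M) < ennreal (1 / Suc k)" "n > 0"
      by blast
    have "\<exists>\<omega>\<in>space M. L1_dist (Suc k) n \<omega> < ennreal (1 / Suc k)"
    proof (rule ccontr)
      assume "\<not> ?thesis"
      then have "\<And>\<omega>. \<omega> \<in> space M \<Longrightarrow> ennreal (1 / Suc k) \<le> L1_dist (Suc k) n \<omega>" by (simp add: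
          not_less)
      then have "(\<integral>\<^sup>+\<omega>. ennreal (1 / Suc k) \<partial>M) \<le> (\<integral>\<^sup>+\<omega>. L1_dist (Suc k) n \<omega> \<partial>M)"
        by (rule nn_integral_mono)
      then show False using n(1) by (simp add: emeasure_space_1)
    qed
    with n(2) show ?thesis by blast
  qed
  then obtain n \<omega> where n: "\<And>k. n k > 0" and small: "\<And>k. L1_dist (Suc k) (n k) (\<omega> k) < ennreal (1
      / Suc k)"
    by metis
  show ?thesis
  proof (rule that[of "\<lambda>k. pq (n k) (\<omega> k)"])
    show "degree (pq (n k) (\<omega> k)) > 0" for k using n by (simp add: pq_degree)
    fix \<phi> :: "complex \<Rightarrow> complex" assume \<phi>: "\<phi> \<in> Cc_infinity"
    obtain R C where R: "R > 0" and C: "C > 0"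
      and le: "\<And>n \<omega>. n > 0 \<Longrightarrow> ennreal (cmod (zero_average \<phi> n \<omega> - limit_functional \<phi>)) \<le> ennreal C
          * L1_dist R n \<omega>"
      using zero_average_bound[OF \<phi>] by blast
    have lim: "(\<lambda>k. C * (1 / real (Suc k))) \<longlonglongrightarrow> 0"
      using tendsto_mult_left[OF LIMSEQ_Suc[OF lim_1_over_n], of C] by simp
    have "\<forall>\<^sub>F k in sequentially. real (Suc k) > R"
      using filterlim_compose[OF filterlim_real_sequentially filterlim_Suc] by (simp add:
          filterlim_at_top_dense)
    then have ev: "\<forall>\<^sub>F k in sequentially. norm (zero_average \<phi> (n k) (\<omega> k) - limit_functional \<phi>) \<le>
        C * (1 / real (Suc k))"
    proof eventually_elim
      case (elim k)
      have "ennreal (cmod (zero_average \<phi> (n k) (\<omega> k) - limit_functional \<phi>)) \<le> ennreal C * L1_dist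
          R (n k) (\<omega> k)"
        by (rule le[OF n])
      also have "\<dots> \<le> ennreal C * ennreal (1 / Suc k)"
        using elim by (intro mult_left_mono order_trans[OF L1_dist_mono less_imp_le[OF small]]) auto
      also have "\<dots> = ennreal (C * (1 / Suc k))"
        using C by (intro ennreal_mult[symmetric]) auto
      finally show ?case using C by (subst (asm) ennreal_le_iff) auto
    qed
    have "(\<lambda>k. zero_average \<phi> (n k) (\<omega> k) - limit_functional \<phi>) \<longlonglongrightarrow> 0"
      by (rule Lim_null_comparison[OF ev lim])
    then have "(\<lambda>k. zero_average \<phi> (n k) (\<omega> k)) \<longlonglongrightarrow> limit_functional \<phi>"
      by (simp only: LIM_zero_iff)
    then show "(\<lambda>k. 1 / of_nat (degree (pq (n k) (\<omega> k))) * (\<Sum>z\<in>#proots (pq (n k) (\<omega> k)). \<phi> z)) \<longlonglongrightarrow>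
        limit_functional \<phi>"
      by (simp only: pq_degree zero_average_def)
  qed
qed

end

section \<open>Vague compactness on the complex plane\<close>

text \<open>Schoenberg's building block: even and of period 2, equal to 0 on [0, 1/3] and to 1 on
  [2/3, 1], so on the Cantor set it reads the first ternary digit. Clipping a cosine makes
  periodicity and continuity immediate.\<close>

definition ramp :: "real \<Rightarrow> real" where
  "ramp t = max 0 (min 1 (1 / 2 - cos (pi * t)))"

lemma ramp_bounds: "0 \<le> ramp t" "ramp t \<le> 1"
  by (auto simp: ramp_def)

lemma ramp_periodic: "ramp (2 * of_int m + t) = ramp t"
proof -
  have "cos (pi * (2 * of_int m + t)) = cos (pi * t + 2 * pi * of_int m)" by (simp add:
      algebra_simps)
  also have "\<dots> = cos (pi * t)"
    by (simp add: cos_add cos_int_2pin sin_int_2pin)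
  finally show ?thesis by (simp add: ramp_def)
qed

lemma ramp_eq_0: "0 \<le> t \<Longrightarrow> t \<le> 1 / 3 \<Longrightarrow> ramp t = 0"
proof -
  assume t: "0 \<le> t" "t \<le> 1 / 3"
  have "cos (pi / 3) \<le> cos (pi * t)"
    using t by (intro cos_monotone_0_pi_le) auto
  then show ?thesis by (simp add: ramp_def cos_60)
qed

lemma ramp_eq_1: "2 / 3 \<le> t \<Longrightarrow> t \<le> 1 \<Longrightarrow> ramp t = 1"
proof -
  assume t: "2 / 3 \<le> t" "t \<le> 1"
  have "cos (pi / 3) \<le> cos (pi - pi * t)"
    using t by (intro cos_monotone_0_pi_le) auto
  then have "cos (pi * t) \<le> - 1 / 2" by (simp add: cos_60)
  then show ?thesis by (simp add: ramp_def)
qed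

lemma continuous_ramp: "continuous_on UNIV ramp"
  unfolding ramp_def by (intro continuous_intros)

text \<open>As 9^k = 3^(2k), on the Cantor set a = 1 reads the digits with even index and a = 3
  those with odd index; these are the two coordinates of the curve.\<close>

definition schoenberg :: "real \<Rightarrow> real \<Rightarrow> real" where
  "schoenberg a t = (\<Sum>k. ramp (a * 9 ^ k * t) / 2 ^ Suc k)"

lemma continuous_schoenberg: "continuous_on UNIV (schoenberg a)"
proof -
  have "uniform_limit UNIV (\<lambda>n t. \<Sum>k<n. ramp (a * 9 ^ k * t) / 2 ^ Suc k) (\<lambda>t. \<Sum>k. ramp (a * 9 ^ k
      * t) / 2 ^ Suc k) sequentially"
  proof (rule Weierstrass_m_test)
    show "norm (ramp (a * 9 ^ k * t) / 2 ^ Suc k) \<le> (1 / 2) ^ Suc k" for k t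
      using ramp_bounds[of "a * 9 ^ k * t"] by (simp add: power_divide divide_right_mono)
    show "summable (\<lambda>k. (1 / 2 :: real) ^ Suc k)"
      by (subst summable_Suc_iff) (rule summable_geometric, simp)
  qed
  moreover have "\<forall>\<^sub>F n in sequentially. continuous_on UNIV (\<lambda>t. \<Sum>k<n. ramp (a * 9 ^ k * t) / 2 ^
      Suc k)"
    by (intro always_eventually allI continuous_intros continuous_on_compose2[OF continuous_ramp])
        auto
  ultimately have "continuous_on UNIV (\<lambda>t. \<Sum>k. ramp (a * 9 ^ k * t) / 2 ^ Suc k)"
    by (intro uniform_limit_theorem[rotated]) auto
  then show ?thesis by (simp add: schoenberg_def[abs_def])
qed

definition cantor :: "(nat \<Rightarrow> real) \<Rightarrow> real" where
  "cantor d = (\<Sum>i. 2 * d i / 3 ^ Suc i)"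

lemma cantor_summable:
  fixes d :: "nat \<Rightarrow> real"
  assumes "\<And>i. d i \<in> {0, 1}"
  shows "summable (\<lambda>i. 2 * d i / 3 ^ Suc i)"
proof (rule summable_comparison_test')
  show "summable (\<lambda>i. (1 / 3 :: real) ^ i)" by (rule summable_geometric) simp
  show "norm (2 * d i / 3 ^ Suc i) \<le> (1 / 3) ^ i" if "i \<ge> 0" for i
    using assms[of i] by (auto simp: power_divide field_simps)
qed

lemma cantor_bounds:
  fixes d :: "nat \<Rightarrow> real"
  assumes d: "\<And>i. d i \<in> {0, 1}"
  shows "0 \<le> cantor d" "cantor d \<le> 1"
proof -
  have nn: "0 \<le> d i" "d i \<le> 1" for i using d[of i] by auto
  show "0 \<le> cantor d"
    unfolding cantor_def by (intro suminf_nonneg cantor_summable d) (simp add: nn)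
  have s: "(\<lambda>i. 2 / 3 * (1 / 3 :: real) ^ i) sums (2 / 3 * (1 / (1 - 1 / 3)))"
    by (intro sums_mult geometric_sums) simp
  have "cantor d \<le> (\<Sum>i. 2 / 3 * (1 / 3 :: real) ^ i)"
    unfolding cantor_def
  proof (rule suminf_le)
    show "2 * d i / 3 ^ Suc i \<le> 2 / 3 * (1 / 3) ^ i" for i
      using nn(2)[of i] by (simp add: power_divide field_simps)
  qed (use cantor_summable[OF d] s sums_summable in auto)
  also have "\<dots> = 1" using sums_unique[OF s] by simp
  finally show "cantor d \<le> 1" .
qed

lemma cantor_shift:
  fixes d :: "nat \<Rightarrow> real"
  assumes d: "\<And>i. d i \<in> {0, 1}"
  shows "3 * cantor d = 2 * d 0 + cantor (\<lambda>i. d (Suc i))"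
proof -
  have "cantor d = 2 * d 0 / 3 + (\<Sum>i. 2 * d (Suc i) / 3 ^ Suc (Suc i))"
    unfolding cantor_def using suminf_split_head[OF cantor_summable[of d, OF d]] by simp
  also have "(\<Sum>i. 2 * d (Suc i) / 3 ^ Suc (Suc i)) = cantor (\<lambda>i. d (Suc i)) / 3"
    unfolding cantor_def using suminf_divide[OF cantor_summable[of "\<lambda>i. d (Suc i)"], of 3] d by simp
  finally show ?thesis by simp
qed

text \<open>Multiplication by 3^j shifts the ternary digits. Since the digits are 0 or 2, the
  integer part split off is even and invisible to the 2-periodic \<open>ramp\<close>; the remainder
  lies in [0, 1/3] or in [2/3, 1] according to digit j.\<close>

lemma ramp_cantor:
  fixes d :: "nat \<Rightarrow> real"
  assumes d: "\<And>i. d i \<in> {0, 1}"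
  shows "ramp (3 ^ j * cantor d) = d j"
proof -
  let ?S = "\<lambda>j. cantor (\<lambda>i. d (i + j))"
  have dj: "\<And>i. d (i + j) \<in> {0, 1}" for j using d by simp
  have cb: "0 \<le> ?S j" "?S j \<le> 1" for j
    using cantor_bounds[of "\<lambda>i. d (i + j)"] dj by blast+
  have sh: "3 * ?S j = 2 * d j + ?S (Suc j)" for j
    using cantor_shift[of "\<lambda>i. d (i + j)", OF dj] by simp
  have "\<exists>m. 3 ^ j * cantor d = 2 * of_int m + ?S j"
  proof (induction j)
    case 0
    then show ?case by (intro exI[of _ 0]) simp
  next
    case (Suc j)
    then obtain m where m: "3 ^ j * cantor d = 2 * of_int m + ?S j" ..
    have "\<exists>b :: int. d j = of_int b" using d[of j] by (auto intro: exI[of _ 0] exI[of _ 1])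
    then obtain b :: int where b: "d j = of_int b" ..
    have "3 ^ Suc j * cantor d = 2 * of_int (3 * m + b) + ?S (Suc j)"
      using m sh[of j] by (simp add: b algebra_simps)
    then show ?case ..
  qed
  then obtain m where "3 ^ j * cantor d = 2 * of_int m + ?S j" ..
  then have "ramp (3 ^ j * cantor d) = ramp (?S j)" by (simp only: ramp_periodic)
  also have "\<dots> = d j"
    using d[of j] sh[of j] cb[of "Suc j"] ramp_eq_0[of "?S j"] ramp_eq_1[of "?S j"] by auto
  finally show ?thesis .
qed

section \<open>Binary digits and the inverse of the curve\<close>

definition bit_at :: "real \<Rightarrow> nat \<Rightarrow> real" where
  "bit_at x k = of_int \<lfloor>2 ^ Suc k * x\<rfloor> - 2 * of_int \<lfloor>2 ^ k * x\<rfloor>"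

lemma bit_at_01: "bit_at x k \<in> {0, 1}"
proof -
  define y where "y = 2 ^ k * x"
  have "\<lfloor>2 * y\<rfloor> = 2 * \<lfloor>y\<rfloor> \<or> \<lfloor>2 * y\<rfloor> = 2 * \<lfloor>y\<rfloor> + 1" by linarith
  moreover have "bit_at x k = of_int \<lfloor>2 * y\<rfloor> - 2 * of_int \<lfloor>y\<rfloor>"
    by (simp add: bit_at_def y_def mult.assoc)
  ultimately show ?thesis by auto
qed

lemma bit_at_sums:
  assumes "0 \<le> x" "x < 1"
  shows "(\<lambda>k. bit_at x k / 2 ^ Suc k) sums x"
proof -
  \<comment> \<open>The sum telescopes.\<close>
  have part: "(\<Sum>k<n. bit_at x k / 2 ^ Suc k) = of_int \<lfloor>2 ^ n * x\<rfloor> / 2 ^ n" for n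
  proof (induction n)
    case 0
    then show ?case using assms by (simp add: floor_eq_iff)
  next
    case (Suc n)
    then show ?case by (simp add: bit_at_def field_simps)
  qed
  have "(\<lambda>n. of_int \<lfloor>2 ^ n * x\<rfloor> / 2 ^ n) \<longlonglongrightarrow> x"
  proof (rule tendsto_sandwich[of "\<lambda>n. x - (1 / 2) ^ n" _ _ "\<lambda>_. x"])
    have "x - (1 / 2) ^ n \<le> of_int \<lfloor>2 ^ n * x\<rfloor> / 2 ^ n" for n
    proof -
      have "2 ^ n * x - 1 \<le> of_int \<lfloor>2 ^ n * x\<rfloor>" by linarith
      then have "(2 ^ n * x - 1) / 2 ^ n \<le> of_int \<lfloor>2 ^ n * x\<rfloor> / 2 ^ n" by (rule divide_right_mono)
          simp
      then show ?thesis by (simp add: diff_divide_distrib power_divide)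
    qed
    then show "\<forall>\<^sub>F n in sequentially. x - (1 / 2) ^ n \<le> of_int \<lfloor>2 ^ n * x\<rfloor> / 2 ^ n" by simp
    have "of_int \<lfloor>2 ^ n * x\<rfloor> / 2 ^ n \<le> x" for n
    proof -
      have "of_int \<lfloor>2 ^ n * x\<rfloor> / 2 ^ n \<le> 2 ^ n * x / 2 ^ n" by (intro divide_right_mono) auto
      then show ?thesis by simp
    qed
    then show "\<forall>\<^sub>F n in sequentially. of_int \<lfloor>2 ^ n * x\<rfloor> / 2 ^ n \<le> x" by simp
    have "(\<lambda>n. x - (1 / 2) ^ n) \<longlonglongrightarrow> x - 0"
      by (intro tendsto_intros LIMSEQ_power_zero) simp
    then show "(\<lambda>n. x - (1 / 2) ^ n) \<longlonglongrightarrow> x" by simp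
  qed simp
  then show ?thesis unfolding sums_def part .
qed

text \<open>A Borel right inverse of Schoenberg's space-filling curve: interleave the binary digits of the
  coordinates and read them as the ternary digits \<open>0\<close>, \<open>2\<close> of a point of the Cantor set.\<close>

definition curve_code :: "real \<Rightarrow> real \<Rightarrow> real" where
  "curve_code x y = cantor (\<lambda>j. if even j then bit_at x (j div 2) else bit_at y (j div 2))"

lemma interleave_01: "(if even j then bit_at x (j div 2) else bit_at y (j div 2)) \<in> {0, 1}"
  using bit_at_01 by simp

lemma curve_code_bounds: "0 \<le> curve_code x y" "curve_code x y \<le> 1"
  unfolding curve_code_def by (intro cantor_bounds interleave_01)+

lemma schoenberg_curve_code:
  assumes "0 \<le> x" "x < 1" "0 \<le> y" "y < 1"
  shows "schoenberg 1 (curve_code x y) = x" "schoenberg 3 (curve_code x y) = y"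
proof -
  have "ramp (3 ^ (2 * k) * curve_code x y) = bit_at x k" for k
    unfolding curve_code_def by (subst ramp_cantor[OF interleave_01]) simp
  then have "ramp (1 * 9 ^ k * curve_code x y) = bit_at x k" for k
    by (simp add: power_mult)
  then show "schoenberg 1 (curve_code x y) = x"
    using sums_unique[OF bit_at_sums[OF assms(1,2)]] by (simp add: schoenberg_def)
  have "ramp (3 ^ Suc (2 * k) * curve_code x y) = bit_at y k" for k
    unfolding curve_code_def by (subst ramp_cantor[OF interleave_01]) simp
  then have "ramp (3 * 9 ^ k * curve_code x y) = bit_at y k" for k
    by (simp add: power_mult)
  then show "schoenberg 3 (curve_code x y) = y"
    using sums_unique[OF bit_at_sums[OF assms(3,4)]] by (simp add: schoenberg_def)
qed

section \<open>The plane inside the unit square\<close>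

text \<open>An increasing homeomorphism of the line onto (0, 1); applied to both coordinates it
  carries the plane onto the open square inside the region filled by the curve.\<close>

definition squash :: "real \<Rightarrow> real" where
  "squash x = 1 / 2 + arctan x / pi"

definition unsquash :: "real \<Rightarrow> real" where
  "unsquash a = tan (pi * (a - 1 / 2))"

lemma squash_bounds: "0 < squash x" "squash x < 1"
  using arctan_bounded[of x] by (auto simp: squash_def field_simps)

lemma unsquash_squash: "unsquash (squash x) = x"
  by (simp add: unsquash_def squash_def arctan tan_arctan)

lemma squash_unsquash: "0 < a \<Longrightarrow> a < 1 \<Longrightarrow> squash (unsquash a) = a"
proof -
  assume a: "0 < a" "a < 1"
  have "pi * a < pi * 1" using a by (intro mult_strict_left_mono) auto
  moreover have "0 < pi * a" using a by simp
  ultimately have "- (pi / 2) < pi * (a - 1 / 2)" "pi * (a - 1 / 2) < pi / 2" by (auto simp: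
      algebra_simps)
  then have "arctan (unsquash a) = pi * (a - 1 / 2)" unfolding unsquash_def by (rule arctan_tan)
  then show ?thesis by (simp add: squash_def)
qed

lemma squash_mono: "squash x \<le> squash y \<longleftrightarrow> x \<le> y"
  by (simp add: squash_def divide_le_cancel arctan_le_iff)

definition encode :: "complex \<Rightarrow> real" where
  "encode z = curve_code (squash (Re z)) (squash (Im z))"

definition decode :: "real \<Rightarrow> complex" where
  "decode t = Complex (unsquash (schoenberg 1 t)) (unsquash (schoenberg 3 t))"

text \<open>The parameters at which the curve is in the open square. Its boundary stands for
  infinity, where \<open>decode\<close> has no meaning.\<close>

definition decodable :: "real set" where
  "decodable = {t. 0 < schoenberg 1 t \<and> schoenberg 1 t < 1 \<and> 0 < schoenberg 3 t \<and> schoenberg 3 t <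
      1}"

lemma decode_encode: "decode (encode z) = z" "encode z \<in> decodable"
  using schoenberg_curve_code[of "squash (Re z)" "squash (Im z)"] squash_bounds[of "Re z"]
      squash_bounds[of "Im z"]
  by (simp_all add: decode_def encode_def decodable_def unsquash_squash)

lemma encode_measurable [measurable]: "encode \<in> borel_measurable borel"
proof -
  have [measurable]: "squash \<in> borel_measurable borel"
    unfolding squash_def by (intro borel_measurable_continuous_onI continuous_intros) simp_all
  have [measurable]: "(\<lambda>x. bit_at x k) \<in> borel_measurable borel" for k
    unfolding bit_at_def by measurable
  have d: "(\<lambda>z. if even j then bit_at (squash (Re z)) (j div 2) else bit_at (squash (Im z)) (j div
      2)) \<in> borel_measurable borel" for j
    by (cases "even j") simp_all
  show ?thesis
    unfolding encode_def curve_code_def cantor_def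
    by (intro borel_measurable_suminf borel_measurable_divide borel_measurable_times d) simp_all
qed

lemma schoenberg_measurable [measurable]: "schoenberg a \<in> borel_measurable borel"
  by (intro borel_measurable_continuous_onI continuous_schoenberg)

lemma decode_measurable [measurable]: "decode \<in> borel_measurable borel"
proof -
  have "(\<lambda>x::real. tan x) \<in> borel_measurable borel" unfolding tan_def by measurable
  then have [measurable]: "unsquash \<in> borel_measurable borel" unfolding unsquash_def by measurable
  show ?thesis unfolding decode_def Complex_eq by measurable
qed

lemma decodable_measurable [measurable]: "decodable \<in> sets borel"
  unfolding decodable_def by measurable

text \<open>The support of g stays away from the boundary of the square, so the product can be
  written with clamped coordinates, a formula continuous at all parameters. This is what allows weak
  convergence to be tested against it.\<close>

lemma continuous_decoded:
  fixes g :: "complex \<Rightarrow> complex"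
  assumes g: "continuous_on UNIV g" and R: "\<And>z. cmod z > R \<Longrightarrow> g z = 0" and "R > 0"
  shows "continuous_on UNIV (\<lambda>t. indicator decodable t *\<^sub>R g (decode t))"
proof -
  \<comment> \<open>Clamping happens at R + 1 rather than R because g is known to vanish only at
    moduli strictly above R.\<close>
  define c where "c a = max (squash (- (R + 1))) (min (squash (R + 1)) a)" for a
  have c01: "0 < c a" "c a < 1" for a
    using squash_bounds[of "- (R + 1)"] squash_bounds[of "R + 1"] by (auto simp: c_def)
  have cc: "continuous_on UNIV (\<lambda>t. unsquash (c (schoenberg a t)))" for a
  proof -
    have "isCont (\<lambda>x. unsquash x) x" if "0 < x" "x < 1" for x
    proof -
      have "0 < pi * x" "pi * x < pi" using that by auto
      then have "cos (pi * (x - 1 / 2)) > 0" by (intro cos_gt_zero_pi) (auto simp: algebra_simps)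
      then show ?thesis unfolding unsquash_def by (intro continuous_intros isCont_tan') auto
    qed
    then have "continuous_on {0<..<1} unsquash" by (simp add: continuous_on_eq_continuous_at)
    moreover have "continuous_on UNIV (\<lambda>t. c (schoenberg a t))"
      unfolding c_def by (intro continuous_intros continuous_schoenberg)
    ultimately show ?thesis
      by (rule continuous_on_compose2) (use c01 in auto)
  qed
  have out: "g (Complex x y) = 0" if "\<bar>x\<bar> \<ge> R + 1 \<or> \<bar>y\<bar> \<ge> R + 1" for x y
    using that abs_Re_le_cmod[of "Complex x y"] abs_Im_le_cmod[of "Complex x y"] by (intro R) auto
  \<comment> \<open>Where clamping changes a coordinate, the clamped point and, if it is in the open
    square, the original one both lie where g vanishes.\<close>
  have trunc: "c a = a \<or> \<bar>unsquash (c a)\<bar> \<ge> R + 1 \<and> (0 < a \<and> a < 1 \<longrightarrow> \<bar>unsquash a\<bar> \<ge> R + 1)" for a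
  proof -
    have sm: "squash (- (R + 1)) \<le> squash (R + 1)" using \<open>R > 0\<close> by (simp add: squash_mono)
    consider "a < squash (- (R + 1))" | "a > squash (R + 1)" | "squash (- (R + 1)) \<le> a" "a \<le>
        squash (R + 1)" by linarith
    then show ?thesis
    proof cases
      case 1
      then have "c a = squash (- (R + 1))" using sm by (simp add: c_def)
      moreover have "unsquash a \<le> - (R + 1)" if "0 < a" "a < 1"
        using 1 squash_mono[of "unsquash a" "- (R + 1)"] squash_unsquash[OF that] by simp
      ultimately show ?thesis using \<open>R > 0\<close> by (force simp: unsquash_squash)
    next
      case 2
      then have "c a = squash (R + 1)" using sm by (simp add: c_def)
      moreover have "unsquash a \<ge> R + 1" if "0 < a" "a < 1"
        using 2 squash_mono[of "R + 1" "unsquash a"] squash_unsquash[OF that] by simp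
      ultimately show ?thesis using \<open>R > 0\<close> by (force simp: unsquash_squash)
    next
      case 3
      then show ?thesis by (simp add: c_def)
    qed
  qed
  have "indicator decodable t *\<^sub>R g (decode t) = g (Complex (unsquash (c (schoenberg 1 t)))
      (unsquash (c (schoenberg 3 t))))" for t
  proof (cases "c (schoenberg 1 t) = schoenberg 1 t \<and> c (schoenberg 3 t) = schoenberg 3 t")
    case True
    then have "t \<in> decodable" using c01[of "schoenberg 1 t"] c01[of "schoenberg 3 t"] by (simp
        add: decodable_def)
    then show ?thesis using True by (simp add: decode_def)
  next
    case False
    then have "\<bar>unsquash (c (schoenberg 1 t))\<bar> \<ge> R + 1 \<or> \<bar>unsquash (c (schoenberg 3 t))\<bar> \<ge> R + 1"
      using trunc[of "schoenberg 1 t"] trunc[of "schoenberg 3 t"] by blast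
    moreover have "g (decode t) = 0" if "t \<in> decodable"
      unfolding decode_def using False that trunc[of "schoenberg 1 t"] trunc[of "schoenberg 3 t"]
      by (intro out) (auto simp: decodable_def)
    ultimately show ?thesis by (auto simp: indicator_def out)
  qed
  moreover have "continuous_on UNIV (\<lambda>t. g (Complex (unsquash (c (schoenberg 1 t))) (unsquash (c
      (schoenberg 3 t)))))"
    unfolding Complex_eq by (intro continuous_on_compose2[OF g] continuous_intros cc) auto
  ultimately show ?thesis by simp
qed

text \<open>The encoded measures live on [0, 1], so tightness comes for free. The price is that the
  limit on the line may charge parameters outside \<open>decodable\<close>: this is mass lost at
  infinity, and only total mass at most 1 remains certain.\<close>

theorem vague_sequential_compactness:
  fixes \<rho> :: "nat \<Rightarrow> complex measure"
  assumes \<rho>: "\<And>k. \<rho> k \<in> borel_prob_measures"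
  obtains r \<rho>' where "strict_mono (r :: nat \<Rightarrow> nat)" and "sets \<rho>' = sets borel" and "emeasure \<rho>'
      UNIV \<le> 1"
    and "\<And>g :: complex \<Rightarrow> complex. continuous_on UNIV g \<Longrightarrow> (\<exists>R>0. \<forall>z. cmod z > R \<longrightarrow> g z = 0) \<Longrightarrow>
      (\<lambda>k. \<integral>z. g z \<partial>\<rho> (r k)) \<longlonglongrightarrow> (\<integral>z. g z \<partial>\<rho>')"
proof -
  have sets: "sets (\<rho> k) = sets borel" and ps: "prob_space (\<rho> k)" for k
    using \<rho> by (auto simp: borel_prob_measures_def)
  have enc: "encode \<in> borel_measurable (\<rho> k)" for k
    using encode_measurable sets by (simp cong: measurable_cong_sets)
  define \<tau> where "\<tau> k = distr (\<rho> k) borel encode" for k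
  have rd: "real_distribution (\<tau> k)" for k
    unfolding \<tau>_def using prob_space.real_distribution_distr[OF ps enc] .
  have tight: "tight \<tau>"
    unfolding tight_def
  proof (intro conjI allI impI)
    show "real_distribution (\<tau> k)" for k by (rule rd)
    fix \<epsilon> :: real assume "\<epsilon> > 0"
    have "measure (\<tau> k) {-1<..2} = 1" for k
    proof -
      interpret real_distribution "\<tau> k" by (rule rd)
      have "encode z \<in> {-1<..2}" for z
        using curve_code_bounds[of "squash (Re z)" "squash (Im z)"] by (simp add: encode_def)
      then have "encode -` {-1<..2} \<inter> space (\<rho> k) = space (\<rho> k)"
        by blast
      then show ?thesis
        unfolding \<tau>_def by (subst measure_distr[OF enc]) (simp_all add: prob_space.prob_space[OF
            ps])
    qed
    then show "\<exists>a b. a < b \<and> (\<forall>k. 1 - \<epsilon> < measure (\<tau> k) {a<..b})"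
      using \<open>\<epsilon> > 0\<close> by (intro exI[of _ "-1"] exI[of _ 2]) simp
  qed
  obtain r T where r: "strict_mono (r :: nat \<Rightarrow> nat)" and T: "real_distribution T" and conv:
      "weak_conv_m (\<tau> \<circ> id \<circ> r) T"
    using tight_imp_convergent_subsubsequence[OF tight strict_mono_id] by blast
  interpret T: real_distribution T by (rule T)
  define \<rho>' where "\<rho>' = distr (density T (indicator decodable)) borel decode"
  have decT: "decode \<in> borel_measurable T" by simp
  have dec: "decode \<in> borel_measurable (density T (indicator decodable))" by simp
  show ?thesis
  proof (rule that[OF r])
    show "sets \<rho>' = sets borel" by (simp add: \<rho>'_def)
    have "emeasure \<rho>' UNIV = emeasure (density T (indicator decodable)) UNIV"
      unfolding \<rho>'_def using dec by (subst emeasure_distr) auto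
    also have "\<dots> = emeasure T decodable"
      by (subst emeasure_density) auto
    also have "\<dots> \<le> 1" by (rule T.emeasure_le_1)
    finally show "emeasure \<rho>' UNIV \<le> 1" .
    fix g :: "complex \<Rightarrow> complex"
    assume g: "continuous_on UNIV g" and "\<exists>R>0. \<forall>z. cmod z > R \<longrightarrow> g z = 0"
    then obtain R where R: "R > 0" "\<And>z. cmod z > R \<Longrightarrow> g z = 0" by blast
    have [measurable]: "g \<in> borel_measurable borel" by (rule borel_measurable_continuous_onI[OF g])
    obtain C where C: "C > 0" "\<And>z. cmod (g z) \<le> C * indicator (cball 0 R) z"
      using continuous_compact_support_bounded[OF g R(2)] by blast
    let ?H = "\<lambda>t. indicator decodable t *\<^sub>R g (decode t)"
    have H1: "isCont ?H t" for t
      using continuous_decoded[OF g R(2,1)] by (simp add: continuous_on_eq_continuous_at)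
    have H2: "norm (?H t) \<le> C" for t
    proof -
      have "norm (?H t) \<le> cmod (g (decode t))" by (simp add: indicator_def)
      also have "\<dots> \<le> C * indicator (cball 0 R) (decode t)" by (rule C(2))
      also have "\<dots> \<le> C" using C(1) by (simp add: indicator_def)
      finally show ?thesis .
    qed
    have "(\<lambda>k. \<integral>t. ?H t \<partial>(\<tau> \<circ> id \<circ> r) k) \<longlonglongrightarrow> (\<integral>t. ?H t \<partial>T)"
      by (rule weak_conv_imp_integral_bdd_continuous_conv[OF _ T conv H1 H2]) (simp add: rd)
    moreover have "(\<integral>t. ?H t \<partial>(\<tau> \<circ> id \<circ> r) k) = (\<integral>z. g z \<partial>\<rho> (r k))" for k
      unfolding \<tau>_def comp_def id_def using enc
      by (subst integral_distr) (simp_all add: decode_encode)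
    moreover have "(\<integral>t. ?H t \<partial>T) = (\<integral>z. g z \<partial>\<rho>')"
    proof -
      have "(\<integral>z. g z \<partial>\<rho>') = (\<integral>t. g (decode t) \<partial>density T (indicator decodable))"
        unfolding \<rho>'_def using dec by (subst integral_distr) simp_all
      also have "density T (indicator decodable) = density T (\<lambda>t. ennreal (indicator decodable t))"
        by (intro arg_cong2[where f=density] refl ext) (simp add: indicator_def)
      also have "(\<integral>t. g (decode t) \<partial>density T (\<lambda>t. ennreal (indicator decodable t))) = (\<integral>t. ?H t
          \<partial>T)"
        by (subst integral_density) simp_all
      finally show ?thesis ..
    qed
    ultimately show "(\<lambda>k. \<integral>z. g z \<partial>\<rho> (r k)) \<longlonglongrightarrow> (\<integral>z. g z \<partial>\<rho>')" by simp
  qed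
qed

section \<open>The limit measure\<close>

text \<open>As the image of the uniform law on indices it weighs repeated roots by their
  multiplicity.\<close>

definition empirical_measure :: "nat \<Rightarrow> (nat \<Rightarrow> complex) \<Rightarrow> complex measure" where
  "empirical_measure n r = distr (measure_pmf (pmf_of_set {..<n})) borel r"

lemma empirical_measure_prob: "empirical_measure n r \<in> borel_prob_measures"
  unfolding empirical_measure_def borel_prob_measures_def
  by (simp add: prob_space.prob_space_distr[OF prob_space_measure_pmf])

lemma integral_empirical_measure:
  fixes g :: "complex \<Rightarrow> complex"
  assumes "n > 0" and [measurable]: "g \<in> borel_measurable borel"
  shows "(\<integral>z. g z \<partial>empirical_measure n r) = 1 / of_nat n * (\<Sum>i<n. g (r i))"
proof -
  have ne: "{..<n} \<noteq> {}" "finite {..<n}" using assms(1) by auto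
  have "(\<integral>z. g z \<partial>empirical_measure n r) = (\<integral>i. g (r i) \<partial>measure_pmf (pmf_of_set {..<n}))"
    unfolding empirical_measure_def by (subst integral_distr) auto
  also have "\<dots> = (\<Sum>i<n. pmf (pmf_of_set {..<n}) i *\<^sub>R g (r i))"
    by (rule integral_measure_pmf) (use ne in auto)
  also have "\<dots> = (\<Sum>i<n. (1 / of_nat n) * g (r i))"
    using ne by (intro sum.cong refl) (simp add: pmf_of_set scaleR_conv_of_real)
  finally show ?thesis by (simp only: sum_distrib_left)
qed

lemma laplacian_scale:
  assumes \<phi>: "\<phi> \<in> Cc_infinity"
  shows "laplacian (\<lambda>z. \<phi> (c *\<^sub>R z)) z = c\<^sup>2 *\<^sub>R laplacian \<phi> (c *\<^sub>R z)"
proof -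
  have diff: "\<phi> differentiable (at w)" for w using Cc_infinity_Ck[OF \<phi>, of "Suc 0"] by simp
  have "dir_deriv v (dir_deriv v (\<lambda>z. \<phi> (c *\<^sub>R z))) z = c\<^sup>2 *\<^sub>R dir_deriv v (dir_deriv v \<phi>) (c *\<^sub>R
      z)" if v: "v = 1 \<or> v = \<i>" for v
  proof -
    have D: "dir_deriv v (\<lambda>z. \<phi> (c *\<^sub>R z)) = (\<lambda>z. c *\<^sub>R dir_deriv v \<phi> (c *\<^sub>R z))"
      by (intro ext dir_deriv_scale diff)
    have dd: "dir_deriv v \<phi> differentiable (at w)" for w
      using Cc_infinity_Ck[OF Cc_infinity_dir_deriv[OF \<phi> v], of "Suc 0"] by simp
    have "((\<lambda>z. c *\<^sub>R dir_deriv v \<phi> (c *\<^sub>R z)) has_derivative (\<lambda>w. c *\<^sub>R dir_deriv w (\<lambda>z.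
        dir_deriv v \<phi> (c *\<^sub>R z)) z)) (at z)"
      by (intro has_derivative_scaleR_right differentiable_has_dir_deriv dir_deriv_scale dd)
    from dir_deriv_eq[OF this, of v] show ?thesis
      unfolding D dir_deriv_scale(1)[OF dd] by (simp add: power2_eq_square)
  qed
  from this[of 1] this[of \<i>] show ?thesis by (simp add: laplacian_def scaleR_right_distrib)
qed

lemma Cc_infinity_scale:
  assumes \<phi>: "\<phi> \<in> Cc_infinity" and c: "c > 0"
  shows "(\<lambda>z. \<phi> (c *\<^sub>R z)) \<in> Cc_infinity"
proof -
  obtain R where R: "R > 0" "\<And>z. cmod z > R \<Longrightarrow> \<phi> z = 0"
    using Cc_infinity_bounded_support[OF \<phi>] by blast
  show ?thesis
  proof (rule Cc_infinityI)
    show "Ck k (\<lambda>z. \<phi> (c *\<^sub>R z))" for k by (rule Ck_scale[OF Cc_infinity_Ck[OF \<phi>]])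
    show "\<phi> (c *\<^sub>R z) = 0" if "cmod z > R / c" for z
      using that c by (intro R(2)) (simp add: field_simps)
  qed
qed

text \<open>Stretched test functions converge boundedly to the constant \<phi> 0 and so detect the
  total mass.\<close>

lemma integral_scaled_tendsto:
  fixes \<rho> :: "complex measure"
  assumes \<phi>: "\<phi> \<in> Cc_infinity" and fin: "finite_measure \<rho>" and sets: "sets \<rho> = sets borel"
  shows "(\<lambda>k. \<integral>z. \<phi> ((1 / Suc k) *\<^sub>R z) \<partial>\<rho>) \<longlonglongrightarrow> \<phi> 0 * complex_of_real (measure \<rho> UNIV)"
proof -
  interpret finite_measure \<rho> by (rule fin)
  have space: "space \<rho> = UNIV" using sets_eq_imp_space_eq[OF sets] by simp
  obtain R C where C: "C > 0" "\<And>z. cmod (\<phi> z) \<le> C * indicator (cball 0 R) z"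
    using Cc_infinity_bounded[OF \<phi>] by metis
  have C': "cmod (\<phi> z) \<le> C" for z
    by (rule order_trans[OF C(2)]) (use C(1) in \<open>simp add: indicator_def\<close>)
  have cont: "isCont \<phi> 0"
    using Cc_infinity_continuous[OF \<phi>] by (simp add: continuous_on_eq_continuous_at)
  have "(\<lambda>k. \<integral>z. \<phi> ((1 / Suc k) *\<^sub>R z) \<partial>\<rho>) \<longlonglongrightarrow> (\<integral>z. \<phi> 0 \<partial>\<rho>)"
  proof (rule integral_dominated_convergence[where w="\<lambda>_. C"])
    show "(\<lambda>z. \<phi> ((1 / Suc k) *\<^sub>R z)) \<in> borel_measurable \<rho>" for k
    proof -
      have "(\<lambda>z. \<phi> ((1 / Suc k) *\<^sub>R z)) \<in> borel_measurable borel"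
        by (rule Cc_infinity_measurable[OF Cc_infinity_scale[OF \<phi>]]) simp
      then show ?thesis using sets by (simp cong: measurable_cong_sets)
    qed
    show "AE z in \<rho>. (\<lambda>k. \<phi> ((1 / Suc k) *\<^sub>R z)) \<longlonglongrightarrow> \<phi> 0"
    proof (intro AE_I2)
      fix z :: complex
      have "(\<lambda>k. (1 / real (Suc k)) *\<^sub>R z) \<longlonglongrightarrow> 0 *\<^sub>R z"
        by (rule tendsto_scaleR[OF LIMSEQ_Suc[OF lim_1_over_n] tendsto_const])
      then show "(\<lambda>k. \<phi> ((1 / Suc k) *\<^sub>R z)) \<longlonglongrightarrow> \<phi> 0"
        using isCont_tendsto_compose[OF cont] by simp
    qed
    show "AE z in \<rho>. norm (\<phi> ((1 / Suc k) *\<^sub>R z)) \<le> C" for k by (intro AE_I2 C')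
  qed simp_all
  then show ?thesis by (simp add: space scaleR_conv_of_real mult.commute)
qed

section \<open>Total mass of the limit\<close>

context two_samples
begin

text \<open>The mass of \<mu> is known to be 1, so the mass of the limit is found by comparing
  \<open>u\<close> with the potential of \<mu>.\<close>

definition excess :: "complex \<Rightarrow> real" where
  "excess z = u z - log_pot \<mu> z"

lemma excess_measurable [measurable]: "excess \<in> borel_measurable borel"
  unfolding excess_def by measurable

lemma excess_locally_integrable: "integrable lborel (\<lambda>z. indicator (cball 0 R) z * excess z)"
  unfolding excess_def right_diff_distrib
  by (intro Bochner_Integration.integrable_diff u_locally_integrable A.log_pot_locally_integrable)

lemma excess_vanishes_at_infinity:
  assumes "e > 0"
  obtains T where "\<And>z. cmod z > T \<Longrightarrow> \<bar>excess z\<bar> \<le> e"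
proof -
  have "((\<lambda>x::real. ln (x + K) - ln (x - K)) \<longlongrightarrow> 0) at_top" by real_asymp
  then have "\<forall>\<^sub>F x in at_top. ln (x + K) - ln (x - K) < e"
    using assms by (rule order_tendstoD)
  then have "\<forall>\<^sub>F x in at_top. ln (x + K) - ln (x - K) < e \<and> x > K"
    using eventually_gt_at_top[of K] by eventually_elim simp
  then obtain T where T: "\<And>x. x \<ge> T \<Longrightarrow> ln (x + K) - ln (x - K) < e \<and> x > K"
    by (auto simp: eventually_at_top_linorder)
  have "\<bar>excess z\<bar> \<le> e" if "cmod z > T" for z
  proof -
    have z: "ln (cmod z + K) - ln (cmod z - K) < e" "cmod z > K" using T[of "cmod z"] that by auto
    show ?thesis
      using z(1) A.log_pot_bounds[OF z(2)] B.log_pot_bounds[OF z(2)] unfolding excess_def u_def by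
          linarith
  qed
  then show ?thesis by (rule that)
qed

text \<open>Scaling multiplies the Laplacian by \<open>c\<^sup>2\<close> and the area of its support by \<open>1 / c\<^sup>2\<close>, so only
    the size
  of \<open>excess\<close> near infinity matters.\<close>

lemma scaled_excess_tendsto_0:
  assumes \<phi>: "\<phi> \<in> Cc_infinity"
  shows "(\<lambda>k. \<integral>z. laplacian (\<lambda>z. \<phi> ((1 / Suc k) *\<^sub>R z)) z * complex_of_real (excess z) \<partial>lborel) \<longlonglongrightarrow> 0"
proof (rule LIMSEQ_I)
  fix r :: real assume r: "r > 0"
  obtain R C where R: "R > 0" and C: "C > 0" "\<And>z. cmod (laplacian \<phi> z) \<le> C * indicator (cball 0 R)
      z"
    using Cc_infinity_bounded[OF Cc_infinity_laplacian[OF \<phi>]] by metis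
  define V where "V = unit_ball_vol 2 * R\<^sup>2"
  have V: "V \<ge> 0" by (simp add: V_def)
  \<comment> \<open>Then C e V <= r/2, where V is the area of the disc of radius R.\<close>
  define e where "e = r / (2 * (C * V + 1))"
  have CV: "C * V \<ge> 0" using C V by simp
  have e: "e > 0" using r CV by (simp add: e_def)
  obtain T where T: "\<And>z. cmod z > T \<Longrightarrow> \<bar>excess z\<bar> \<le> e"
    using excess_vanishes_at_infinity[OF e] by blast
  define S where "S = (\<integral>z. \<bar>indicator (cball 0 T) z * excess z\<bar> \<partial>lborel)"
  have bound: "cmod (\<integral>z. laplacian (\<lambda>z. \<phi> (c *\<^sub>R z)) z * complex_of_real (excess z) \<partial>lborel) \<le> c\<^sup>2
      * C * S + C * e * V"
    if c: "c > 0" for c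
  proof -
    have \<phi>c: "(\<lambda>z. \<phi> (c *\<^sub>R z)) \<in> Cc_infinity" by (rule Cc_infinity_scale[OF \<phi> c])
    let ?h = "\<lambda>z. laplacian (\<lambda>z. \<phi> (c *\<^sub>R z)) z * complex_of_real (excess z)"
    let ?W = "\<lambda>z. c\<^sup>2 * C * \<bar>indicator (cball 0 T) z * excess z\<bar> + c\<^sup>2 * C * e * indicator (cball
        (0::complex) (R / c)) z"
    have hi: "integrable lborel ?h"
      by (rule laplacian_times_locally_integrable[OF \<phi>c excess_locally_integrable
          excess_measurable])
    have i1: "integrable lborel (\<lambda>z. c\<^sup>2 * C * \<bar>indicator (cball 0 T) z * excess z\<bar>)"
      by (intro integrable_mult_right integrable_abs excess_locally_integrable)
    have i2: "integrable lborel (\<lambda>z. c\<^sup>2 * C * e * indicator (cball (0::complex) (R / c)) z)"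
      by (intro integrable_mult_right integrable_indicator_cball)
    have le: "norm (?h z) \<le> ?W z" for z
    proof -
      have ex: "\<bar>excess z\<bar> \<le> \<bar>indicator (cball 0 T) z * excess z\<bar> + e"
        using T[of z] e by (cases "cmod z > T") (auto simp: indicator_def)
      have "norm (?h z) = c\<^sup>2 * cmod (laplacian \<phi> (c *\<^sub>R z)) * \<bar>excess z\<bar>"
        by (simp add: laplacian_scale[OF \<phi>] norm_mult)
      also have "\<dots> \<le> c\<^sup>2 * (C * indicator (cball 0 R) (c *\<^sub>R z)) * \<bar>excess z\<bar>"
        by (intro mult_right_mono mult_left_mono C) auto
      also have "(indicator (cball 0 R) (c *\<^sub>R z) :: real) = indicator (cball 0 (R / c)) z"
        using c by (auto simp: indicator_def field_simps)
      also have "c\<^sup>2 * (C * indicator (cball 0 (R / c)) z) * \<bar>excess z\<bar> \<le> ?W z"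
      proof (cases "z \<in> cball 0 (R / c)")
        case True
        have "c\<^sup>2 * C * \<bar>excess z\<bar> \<le> c\<^sup>2 * C * (\<bar>indicator (cball 0 T) z * excess z\<bar> + e)"
          using ex C(1) by (intro mult_left_mono) auto
        then show ?thesis using True by (simp add: distrib_left)
      next
        case False
        then show ?thesis using C(1) by simp
      qed
      finally show ?thesis .
    qed
    have "cmod (\<integral>z. ?h z \<partial>lborel) \<le> (\<integral>z. norm (?h z) \<partial>lborel)" by (rule integral_norm_bound)
    also have "\<dots> \<le> (\<integral>z. ?W z \<partial>lborel)"
      by (rule integral_mono[OF integrable_norm[OF hi] Bochner_Integration.integrable_add[OF i1
          i2] le])
    also have "\<dots> = c\<^sup>2 * C * S + c\<^sup>2 * C * e * measure lborel (cball (0::complex) (R / c))"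
      unfolding S_def using i1 i2 by (subst Bochner_Integration.integral_add) simp_all
    also have "measure lborel (cball (0::complex) (R / c)) = unit_ball_vol 2 * (R / c)\<^sup>2"
      using R c content_cball[of "R / c" "0::complex"] by simp
    also have "c\<^sup>2 * C * e * (unit_ball_vol 2 * (R / c)\<^sup>2) = C * e * V"
      using c by (simp add: V_def power_divide)
    finally show ?thesis .
  qed
  have "(\<lambda>k. (1 / real (Suc k))\<^sup>2 * C * S + C * e * V) \<longlonglongrightarrow> 0\<^sup>2 * C * S + C * e * V"
    by (intro tendsto_intros LIMSEQ_Suc[OF lim_1_over_n])
  moreover have "0\<^sup>2 * C * S + C * e * V < r"
  proof -
    have "C * e * V \<le> e * (C * V + 1)" using e by (simp add: algebra_simps)
    also have "e * (C * V + 1) = r / 2"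
    proof -
      have "C * V + 1 \<noteq> 0" using CV by linarith
      then show ?thesis unfolding e_def by (simp add: divide_simps)
    qed
    finally show ?thesis using r by simp
  qed
  ultimately have "\<forall>\<^sub>F k in sequentially. (1 / real (Suc k))\<^sup>2 * C * S + C * e * V < r"
    by (rule order_tendstoD)
  then have "\<forall>\<^sub>F k in sequentially. norm ((\<integral>z. laplacian (\<lambda>z. \<phi> ((1 / Suc k) *\<^sub>R z)) z *
      complex_of_real (excess z) \<partial>lborel) - 0) < r"
  proof eventually_elim
    case (elim k)
    have "cmod (\<integral>z. laplacian (\<lambda>z. \<phi> ((1 / Suc k) *\<^sub>R z)) z * complex_of_real (excess z) \<partial>lborel)
        \<le> (1 / real (Suc k))\<^sup>2 * C * S + C * e * V"
      by (rule bound) simp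
    with elim show ?case unfolding diff_zero by linarith
  qed
  then show "\<exists>n0. \<forall>k\<ge>n0. norm ((\<integral>z. laplacian (\<lambda>z. \<phi> ((1 / Suc k) *\<^sub>R z)) z * complex_of_real
      (excess z) \<partial>lborel) - 0) < r"
    by (simp only: eventually_sequentially)
qed

text \<open>In u = U_mu + \<open>excess\<close> the first summand yields the integral of the
  stretched function against \<mu>, which tends to \<phi> 0, and the second yields a vanishing term:
  the functional has total mass 1.\<close>

lemma limit_functional_scaled_tendsto:
  assumes \<phi>: "\<phi> \<in> Cc_infinity"
  shows "(\<lambda>k. limit_functional (\<lambda>z. \<phi> ((1 / Suc k) *\<^sub>R z))) \<longlonglongrightarrow> \<phi> 0"
proof -
  have eq: "limit_functional (\<lambda>z. \<phi> ((1 / Suc k) *\<^sub>R z)) = (\<integral>z. \<phi> ((1 / Suc k) *\<^sub>R z) \<partial>\<mu>) +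
      1 / (2 * of_real pi) * (\<integral>z. laplacian (\<lambda>z. \<phi> ((1 / Suc k) *\<^sub>R z)) z * complex_of_real
          (excess z) \<partial>lborel)" for k
  proof -
    define \<psi> where "\<psi> = (\<lambda>z. \<phi> ((1 / Suc k) *\<^sub>R z))"
    have \<psi>: "\<psi> \<in> Cc_infinity" unfolding \<psi>_def by (rule Cc_infinity_scale[OF \<phi>]) simp
    have i1: "integrable lborel (\<lambda>z. laplacian \<psi> z * complex_of_real (log_pot \<mu> z))"
      by (rule laplacian_times_locally_integrable[OF \<psi> A.log_pot_locally_integrable
          A.log_pot_measurable])
    have i2: "integrable lborel (\<lambda>z. laplacian \<psi> z * complex_of_real (excess z))"
      by (rule laplacian_times_locally_integrable[OF \<psi> excess_locally_integrable excess_measurable])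
    have "(\<integral>z. laplacian \<psi> z * complex_of_real (u z) \<partial>lborel) =
        (\<integral>z. laplacian \<psi> z * complex_of_real (log_pot \<mu> z) + laplacian \<psi> z * complex_of_real
            (excess z) \<partial>lborel)"
      by (simp add: excess_def algebra_simps)
    also have "\<dots> = 2 * of_real pi * (\<integral>w. \<psi> w \<partial>\<mu>) + (\<integral>z. laplacian \<psi> z * complex_of_real (excess z)
        \<partial>lborel)"
      using i1 i2 by (simp only: Bochner_Integration.integral_add A.laplacian_log_pot_integral[OF
          \<psi>])
    finally have "limit_functional \<psi> = (\<integral>w. \<psi> w \<partial>\<mu>) + 1 / (2 * of_real pi) * (\<integral>z. laplacian \<psi> z *
        complex_of_real (excess z) \<partial>lborel)"
      unfolding limit_functional_def by (simp add: distrib_left)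
    then show ?thesis by (simp only: \<psi>_def)
  qed
  have "measure \<mu> UNIV = 1"
    using A.prob_space sets_eq_imp_space_eq[OF A.sets_eq] by simp
  then have "(\<lambda>k. \<integral>z. \<phi> ((1 / Suc k) *\<^sub>R z) \<partial>\<mu>) \<longlonglongrightarrow> \<phi> 0"
    using integral_scaled_tendsto[OF \<phi> A.finite_measure_axioms A.sets_eq] by simp
  then have "(\<lambda>k. limit_functional (\<lambda>z. \<phi> ((1 / Suc k) *\<^sub>R z))) \<longlonglongrightarrow> \<phi> 0 + 1 / (2 * of_real pi) * 0"
    unfolding eq by (intro tendsto_intros scaled_excess_tendsto_0 \<phi>)
  then show ?thesis by simp
qed

text \<open>Along a vaguely convergent subsequence the averages over zeros tend both to the integral
  against \<rho> and to \<open>limit_functional\<close>. The vague limit is only known to have mass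
  at most 1; equality follows from stretched test functions.\<close>

theorem limit_measure_exists:
  assumes circle: "\<not> supported_on_circle \<mu>"
  obtains \<rho> where "\<rho> \<in> borel_prob_measures" and "\<And>\<phi>. \<phi> \<in> Cc_infinity \<Longrightarrow> (\<integral>z. \<phi> z \<partial>\<rho>) =
      limit_functional \<phi>"
proof -
  obtain p :: "nat \<Rightarrow> complex poly" where p: "\<And>k. degree (p k) > 0"
    and lim: "\<And>\<phi>. \<phi> \<in> Cc_infinity \<Longrightarrow>
      (\<lambda>k. 1 / of_nat (degree (p k)) * (\<Sum>z\<in>#proots (p k). \<phi> z)) \<longlonglongrightarrow> limit_functional \<phi>"
    using deterministic_polynomials[OF circle] by blast
  have "\<exists>r. \<forall>\<phi> :: complex \<Rightarrow> complex. (\<Sum>z\<in>#proots (p k). \<phi> z) = (\<Sum>i<degree (p k). \<phi> (r i))" for k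
    using complex_poly_roots_enum[of "p k"] by metis
  then obtain r where r: "\<And>k (\<phi> :: complex \<Rightarrow> complex). (\<Sum>z\<in>#proots (p k). \<phi> z) = (\<Sum>i<degree (p k).
      \<phi> (r k i))"
    by metis
  obtain s \<rho> where s: "strict_mono (s :: nat \<Rightarrow> nat)" and sets: "sets \<rho> = sets borel" and mass:
      "emeasure \<rho> UNIV \<le> 1"
    and conv: "\<And>g :: complex \<Rightarrow> complex. continuous_on UNIV g \<Longrightarrow> (\<exists>R>0. \<forall>z. cmod z > R \<longrightarrow> g z = 0) \<Longrightarrow>
      (\<lambda>k. \<integral>z. g z \<partial>empirical_measure (degree (p (s k))) (r (s k))) \<longlonglongrightarrow> (\<integral>z. g z \<partial>\<rho>)"
    using vague_sequential_compactness[of "\<lambda>k. empirical_measure (degree (p k)) (r k)", OF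
        empirical_measure_prob] by blast
  have int: "(\<integral>z. \<phi> z \<partial>\<rho>) = limit_functional \<phi>" if \<phi>: "\<phi> \<in> Cc_infinity" for \<phi>
  proof -
    have "\<exists>R>0. \<forall>z. cmod z > R \<longrightarrow> \<phi> z = 0"
      using Cc_infinity_bounded_support[OF \<phi>] by metis
    from conv[OF Cc_infinity_continuous[OF \<phi>] this]
    have 1: "(\<lambda>k. 1 / of_nat (degree (p (s k))) * (\<Sum>z\<in>#proots (p (s k)). \<phi> z)) \<longlonglongrightarrow> (\<integral>z. \<phi> z \<partial>\<rho>)"
      by (simp only: integral_empirical_measure[OF p Cc_infinity_measurable[OF \<phi>]] r)
    have 2: "(\<lambda>k. 1 / of_nat (degree (p (s k))) * (\<Sum>z\<in>#proots (p (s k)). \<phi> z)) \<longlonglongrightarrow> limit_functional \<phi>"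
      using LIMSEQ_subseq_LIMSEQ[OF lim[OF \<phi>] s] by (simp only: comp_def)
    show ?thesis by (rule LIMSEQ_unique[OF 1 2])
  qed
  have space: "space \<rho> = UNIV" using sets_eq_imp_space_eq[OF sets] by simp
  interpret R: finite_measure \<rho>
  proof (rule finite_measureI)
    show "emeasure \<rho> (space \<rho>) \<noteq> \<infinity>"
      unfolding space using mass by (auto simp: top_unique)
  qed
  \<comment> \<open>Any test function that does not vanish at the origin would serve to compare the
    masses.\<close>
  define w where "w = (\<lambda>z. complex_of_real (box_bump (Complex (-1) (-1)) (Complex 1 1) z))"
  have w: "w \<in> Cc_infinity" unfolding w_def by (rule Cc_infinity_box_bump)
  have "0 \<in> box (Complex (-1) (-1)) (Complex 1 1)" by (simp add: in_box_complex_iff)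
  from box_bump_pos[OF this] have w0: "w 0 \<noteq> 0" by (simp add: w_def)
  have "(\<lambda>k. limit_functional (\<lambda>z. w ((1 / Suc k) *\<^sub>R z))) \<longlonglongrightarrow> w 0 * complex_of_real (measure \<rho> UNIV)"
  proof -
    have "(\<integral>z. w ((1 / Suc k) *\<^sub>R z) \<partial>\<rho>) = limit_functional (\<lambda>z. w ((1 / Suc k) *\<^sub>R z))" for k
      by (rule int[OF Cc_infinity_scale[OF w]]) simp
    then show ?thesis
      using integral_scaled_tendsto[OF w R.finite_measure_axioms sets] by (simp only:)
  qed
  from LIMSEQ_unique[OF this limit_functional_scaled_tendsto[OF w]]
  have "measure \<rho> UNIV = 1" using w0 by (metis mult_cancel_left1 of_real_eq_1_iff)
  then have "prob_space \<rho>"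
    by (intro prob_spaceI) (simp add: space R.emeasure_eq_measure)
  then have "\<rho> \<in> borel_prob_measures" using sets by (simp add: borel_prob_measures_def)
  then show ?thesis using int by (rule that)
qed

end

section \<open>A concrete sample space and the conclusion\<close>

text \<open>The measure \<rho> must exist before any sample is given, even for a type
  \<open>'a\<close> that carries no such sample; the coordinates of an infinite product supply
  one.\<close>

lemma two_samples_exists:
  assumes "bounded_prob \<mu> K" "bounded_prob \<nu> K"
  shows "two_samples (PiM ({1..} <+> {1..}) (case_sum (\<lambda>_. \<mu>) (\<lambda>_. \<nu>))) \<mu> \<nu> K
    (\<lambda>i \<omega>. \<omega> (Inl i)) (\<lambda>i \<omega>. \<omega> (Inr i))"
proof -
  interpret A: bounded_prob \<mu> K by fact
  interpret B: bounded_prob \<nu> K by fact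
  let ?I = "{1..} <+> {1..} :: (nat + nat) set"
  let ?D = "case_sum (\<lambda>_. \<mu>) (\<lambda>_. \<nu>) :: nat + nat \<Rightarrow> complex measure"
  let ?P = "PiM ?I ?D"
  have ps: "prob_space (?D i)" for i
    using A.prob_space_axioms B.prob_space_axioms by (cases i) auto
  have sets: "sets (?D i) = sets borel" for i
    using A.sets_eq B.sets_eq by (cases i) auto
  interpret P: product_prob_space ?D ?I
    by (intro product_prob_spaceI ps)
  have comp: "(\<lambda>\<omega>. \<omega> i) \<in> borel_measurable ?P" if "i \<in> ?I" for i
    using measurable_component_singleton[OF that, of ?D] sets[of i] by (simp cong:
        measurable_cong_sets)
  have distr: "distr ?P borel (\<lambda>\<omega>. \<omega> i) = ?D i" if "i \<in> ?I" for i
  proof -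
    have "distr ?P borel (\<lambda>\<omega>. \<omega> i) = distr ?P (?D i) (\<lambda>\<omega>. \<omega> i)"
      by (rule distr_cong) (simp_all add: sets)
    then show ?thesis using P.PiM_component[OF that] by simp
  qed
  have eqfun: "case_sum (\<lambda>i \<omega>. \<omega> (Inl i)) (\<lambda>i \<omega>. \<omega> (Inr i)) = (\<lambda>i \<omega>. \<omega> i)"
    by (auto simp: fun_eq_iff split: sum.split)
  have "P.indep_vars (\<lambda>_. borel) (\<lambda>i \<omega>. \<omega> i) ?I"
  proof (subst P.indep_vars_iff_distr_eq_PiM')
    show "?I \<noteq> {}" by auto
    show "(\<lambda>\<omega>. \<omega> i) \<in> borel_measurable ?P" if "i \<in> ?I" for i by (rule comp[OF that])
    have setsP: "sets (PiM ?I (\<lambda>_. borel)) = sets ?P"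
      by (rule sets_PiM_cong) (simp_all add: sets)
    have "distr ?P (PiM ?I (\<lambda>_. borel)) (\<lambda>x. \<lambda>i\<in>?I. x i) = distr ?P ?P (\<lambda>x. x)"
    proof (rule distr_cong[OF refl setsP])
      show "(\<lambda>i\<in>?I. x i) = x" if "x \<in> space ?P" for x
        using that by (auto simp: space_PiM PiE_def extensional_restrict)
    qed
    also have "\<dots> = ?P" by (rule distr_id)
    also have "\<dots> = PiM ?I (\<lambda>i. distr ?P borel (\<lambda>\<omega>. \<omega> i))"
      by (rule PiM_cong[OF refl distr[symmetric]])
    finally show "distr ?P (PiM ?I (\<lambda>_. borel)) (\<lambda>x. \<lambda>i\<in>?I. x i) = PiM ?I (\<lambda>i. distr ?P borel (\<lambda>\<omega>.
        \<omega> i))" .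
  qed
  then have ind: "P.indep_vars (\<lambda>_. borel) (case_sum (\<lambda>i \<omega>. \<omega> (Inl i)) (\<lambda>i \<omega>. \<omega> (Inr i))) ?I"
    by (simp only: eqfun)
  show ?thesis
  proof (intro_locales, unfold two_samples_axioms_def, intro conjI allI impI)
    show "P.indep_vars (\<lambda>_. borel) (case_sum (\<lambda>i \<omega>. \<omega> (Inl i)) (\<lambda>i \<omega>. \<omega> (Inr i))) ?I" by (rule ind)
    show "distr ?P borel (\<lambda>\<omega>. \<omega> (Inl i)) = \<mu>" if "i \<ge> 1" for i
      using distr[of "Inl i"] that by auto
    show "distr ?P borel (\<lambda>\<omega>. \<omega> (Inr i)) = \<nu>" if "i \<ge> 1" for i
      using distr[of "Inr i"] that by auto
  qed
qed

lemma (in bounded_prob) log_potential_measurable: "log_potential \<mu> \<in> borel_measurable borel"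
  unfolding log_potential_def elog_def by measurable

text \<open>At tame points the extended potentials are real and equal \<open>log_pot\<close>. As
  almost every point is tame for both measures, the two integrands agree almost everywhere.\<close>

lemma (in two_samples) laplace_max_condition_iff:
  "laplace_max_condition \<mu> \<nu> \<rho> \<longleftrightarrow> (\<forall>\<phi>\<in>Cc_infinity. (\<integral>z. \<phi> z \<partial>\<rho>) = limit_functional \<phi>)"
proof -
  let ?g = "\<lambda>\<phi> z. laplacian \<phi> z * complex_of_real (real_of_ereal (max (log_potential \<mu> z)
      (log_potential \<nu> z)))"
  have "integrable lborel (?g \<phi>) \<and> (\<integral>z. ?g \<phi> z \<partial>lborel) = (\<integral>z. laplacian \<phi> z * complex_of_real (u
      z) \<partial>lborel)"
    if \<phi>: "\<phi> \<in> Cc_infinity" for \<phi>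
  proof -
    have ae: "AE z in lborel. laplacian \<phi> z * complex_of_real (u z) = ?g \<phi> z"
      using A.AE_lborel_tame B.AE_lborel_tame
    proof eventually_elim
      case (elim z)
      have "max (log_potential \<mu> z) (log_potential \<nu> z) = ereal (u z)"
        by (simp only: A.log_potential_eq[OF elim(1)] B.log_potential_eq[OF elim(2)] u_def
            ereal_max)
      then show ?case by simp
    qed
    have [measurable]: "laplacian \<phi> \<in> borel_measurable borel"
      by (rule Cc_infinity_measurable[OF Cc_infinity_laplacian[OF \<phi>]])
    note [measurable] = A.log_potential_measurable B.log_potential_measurable
    have m1: "?g \<phi> \<in> borel_measurable lborel" by measurable
    have m2: "(\<lambda>z. laplacian \<phi> z * complex_of_real (u z)) \<in> borel_measurable lborel" by measurable
    show ?thesis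
      by (intro conjI integrable_cong_AE_imp[OF laplacian_u_integrable[OF \<phi>] m1 ae]
          integral_cong_AE[OF m2 m1 ae, symmetric])
  qed
  then show ?thesis
    unfolding laplace_max_condition_def limit_functional_def Let_def by simp
qed

theorem theorem1p3:
  fixes \<mu> \<nu> :: "complex measure"
  assumes "\<mu> \<in> compact_prob_measures" and "\<nu> \<in> compact_prob_measures"
    and "\<not> supported_on_circle \<mu>"
  shows "\<exists>\<rho>\<in>borel_prob_measures.
    (\<forall>(M :: 'a measure) (X :: nat \<Rightarrow> 'a \<Rightarrow> complex) (Y :: nat \<Rightarrow> 'a \<Rightarrow> complex).
       prob_space M \<longrightarrow>
       prob_space.indep_vars M (\<lambda>_. borel) (case_sum X Y) ({1..} <+> {1..}) \<longrightarrow>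
       (\<forall>i\<ge>1. distr M borel (X i) = \<mu>) \<longrightarrow>
       (\<forall>i\<ge>1. distr M borel (Y i) = \<nu>) \<longrightarrow>
       (\<forall>\<phi>\<in>Cc_infinity.
          converges_in_prob M
            (\<lambda>n \<omega>. 1 / of_nat n *
               (\<Sum>z\<in>#proots (root_poly (\<lambda>i. X i \<omega>) n + root_poly (\<lambda>i. Y i \<omega>) n). \<phi> z))
            (\<integral>z. \<phi> z \<partial>\<rho>))) \<and>
    laplace_max_condition \<mu> \<nu> \<rho> \<and>
    (\<forall>\<rho>'\<in>borel_prob_measures. laplace_max_condition \<mu> \<nu> \<rho>' \<longrightarrow> \<rho>' = \<rho>)"
proof -
  obtain K1 K2 where K1: "bounded_prob \<mu> K1" and K2: "bounded_prob \<nu> K2"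
    using compact_prob_measures_bounded[OF assms(1)] compact_prob_measures_bounded[OF assms(2)] by metis
  define K where "K = max K1 K2"
  have \<mu>: "bounded_prob \<mu> K" and \<nu>: "bounded_prob \<nu> K"
    using K1 K2 by (auto simp: bounded_prob_def bounded_prob_axioms_def K_def elim!: eventually_mono)
  \<comment> \<open>An auxiliary sample, used only to produce \<rho> and its
    characterisation.\<close>
  interpret S: two_samples "PiM ({1..} <+> {1..}) (case_sum (\<lambda>_. \<mu>) (\<lambda>_. \<nu>))" \<mu> \<nu> K
    "\<lambda>i \<omega>. \<omega> (Inl i)" "\<lambda>i \<omega>. \<omega> (Inr i)"
    by (rule two_samples_exists[OF \<mu> \<nu>])
  obtain \<rho> where \<rho>: "\<rho> \<in> borel_prob_measures"
    and int: "\<And>\<phi>. \<phi> \<in> Cc_infinity \<Longrightarrow> (\<integral>z. \<phi> z \<partial>\<rho>) = S.limit_functional \<phi>"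
    using S.limit_measure_exists[OF assms(3)] by blast
  show ?thesis
  proof (intro bexI[of _ \<rho>] conjI allI impI ballI \<rho>)
    fix M :: "'a measure" and X Y :: "nat \<Rightarrow> 'a \<Rightarrow> complex" and \<phi> :: "complex \<Rightarrow> complex"
    assume M: "prob_space M"
      "prob_space.indep_vars M (\<lambda>_. borel) (case_sum X Y) ({1..} <+> {1..})"
      "\<forall>i\<ge>1. distr M borel (X i) = \<mu>" "\<forall>i\<ge>1. distr M borel (Y i) = \<nu>"
      and \<phi>: "\<phi> \<in> Cc_infinity"
    \<comment> \<open>The given sample. Its \<open>limit_functional\<close> is the same constant as
      that of \<open>S\<close>, since only \<mu> and \<nu> enter.\<close>
    interpret two_samples M \<mu> \<nu> K X Y
      using M \<mu> \<nu> by (simp add: two_samples_def two_samples_axioms_def)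
    have "converges_in_prob M (zero_average \<phi>) (limit_functional \<phi>)"
      by (rule zero_average_converges[OF assms(3) \<phi>])
    then show "converges_in_prob M
            (\<lambda>n \<omega>. 1 / of_nat n *
               (\<Sum>z\<in>#proots (root_poly (\<lambda>i. X i \<omega>) n + root_poly (\<lambda>i. Y i \<omega>) n). \<phi> z))
            (\<integral>z. \<phi> z \<partial>\<rho>)"
      by (simp only: int[OF \<phi>] zero_average_def[abs_def] pq_def)
  next
    show "laplace_max_condition \<mu> \<nu> \<rho>"
      unfolding S.laplace_max_condition_iff using int by blast
  next
    fix \<rho>' assume \<rho>': "\<rho>' \<in> borel_prob_measures" "laplace_max_condition \<mu> \<nu> \<rho>'"
    show "\<rho>' = \<rho>"
      by (rule prob_measure_eq_if_Cc_integrals_eq[OF \<rho>'(1) \<rho>])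
        (use \<rho>'(2) in \<open>simp add: S.laplace_max_condition_iff int\<close>)
  qed
qed

end
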